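(* Let $\ell,k\in\{1,2,\dots\}\cup\{\infty\}$, let $K\ge1$, and let $M$ be a $C^\ell$ Finsler manifold in the sense of Neeb-Upmeier which is $K$-uniform and modeled on a Banach space $(X,\|\cdot\|)$ which admits property $( *^k)$ with constant $C_0$. Then for every Lipschitz function $f:M\to\mathbb{R}$ and every continuous function $\varepsilon:M\to(0,\infty)$ there is a Lipschitz, $C^m$-smooth function $g:M\to\mathbb{R}$, where $m:=\min\{\ell,k\}$, such that $$|g(p)-f(p)|<\varepsilon(p)\quad\text{and}\quad\|dg(p)\|_p\le C_1\operatorname{Lip}(f)\qquad\text{for every }p\in M,$$ and thus $\operatorname{Lip}(g)\le C_1\operatorname{Lip}(f)$, where $C_1:=2C_0K^2$.
   Context: Let $M$ be a paracompact $C^\ell$ Banach manifold ($\ell\ge1$) modeled on a real Banach space $(X,\|\cdot\|)$, with tangent bundle $TM$, and let $\|\cdot\|_M:TM\to[0,\infty)$ be a continuous map; write $\|\cdot\|_x$ for its restriction to $T_xM$. Condition (P1): for every $x\in M$, $\|\cdot\|_x$ is a norm on $T_xM$ such that for every chart $\varphi:U\to X$ with $x\in U$, the norm $v\in X\mapsto\|d\varphi^{-1}(\varphi(x))(v)\|_x$ is equivalent to $\|\cdot\|$ on $X$. $(M,\|\cdot\|_M)$ is a $C^\ell$ Finsler manifold in the sense of Neeb-Upmeier which is $K$-uniform ($K\ge1$) if (P1) holds and for every $x_0\in M$ there is a chart $\varphi:U\to X$ with $x_0\in U$ such that $$\tfrac1K\|v\|_x\le\|d\varphi(x)(v)\|\le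 K\|v\|_x\qquad\text{for every }x\in U\text{ and }v\in T_xM.$$ The length of a piecewise $C^1$ path $c:[a,b]\to M$ is $\ell(c)=\int_a^b\|c'(t)\|_{c(t)}\,dt$, and the Finsler metric is $d_M(p,q)=\inf\{\ell(c): c \text{ a piecewise } C^1 \text{ path joining } p \text{ to } q\}$ (with value $+\infty$ if $p,q$ lie in different connected components). Lipschitz constants on $M$ are with respect to $d_M$: $\operatorname{Lip}(f)$ is the least $L\ge 0$ with $|f(p)-f(q)|\le L\,d_M(p,q)$ for all $p,q$ with $d_M(p,q)<\infty$. For a differentiable $g:M\to\mathbb{R}$, $\|dg(p)\|_p=\sup\{|dg(p)(v)|: v\in T_pM,\ \|v\|_p\le1\}$. Property $( *^k)$: a Banach space $(X,\|\cdot\|)$ satisfies property $( *^k)$ with constant $C_0\ge1$ (depending only on $(X,\|\cdot\|)$) if for every Lipschitz function $f:X\to\mathbb{R}$ and every $\varepsilon>0$ there is a Lipschitz, $C^k$-smooth function $h:X\to\mathbb{R}$ with $|f(x)-h(x)|<\varepsilon$ for all $x\in X$ and $\operatorname{Lip}(h)\le C_0\operatorname{Lip}(f)$. *)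

theory Defs
  imports "HOL-Analysis.Analysis"
begin

section \<open>Smooth maps between normed spaces\<close>

definition bounded_multilinear ::
    "nat \<Rightarrow> ('a::real_normed_vector list \<Rightarrow> 'b::real_normed_vector) \<Rightarrow> bool" where
  "bounded_multilinear n T \<longleftrightarrow>
     (\<forall>us ws. Suc (length us + length ws) = n \<longrightarrow> linear (\<lambda>v. T (us @ v # ws))) \<and>
     (\<exists>B. \<forall>vs. length vs = n \<longrightarrow> norm (T vs) \<le> B * prod_list (map norm vs))"

text \<open>
  \<open>C_smooth_on k S f\<close>: \<open>f\<close> is \<open>k\<close> times continuously Frechet differentiable on the open set \<open>S\<close>
  (all orders, if \<open>k = \<infinity>\<close>). The \<open>n\<close>-th derivative is viewed, through the usual isometry
  \<open>L(X, L(X, \<dots> L(X, Y))) = L\<^sup>n(X; Y)\<close>, as a bounded \<open>n\<close>-linear map, namely the restriction of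
  \<open>D x\<close> to lists of length \<open>n\<close>. The last two clauses are continuity and Frechet
  differentiability with respect to the operator norm on \<open>L\<^sup>n(X; Y)\<close>; this is why the estimates are
  uniform in \<open>vs\<close>.
\<close>

definition C_smooth_on ::
    "enat \<Rightarrow> 'a::real_normed_vector set \<Rightarrow> ('a \<Rightarrow> 'b::real_normed_vector) \<Rightarrow> bool" where
  "C_smooth_on k S f \<longleftrightarrow>
     (\<exists>D :: 'a \<Rightarrow> 'a list \<Rightarrow> 'b. \<forall>x\<in>S.
        D x [] = f x \<and>
        (\<forall>n. enat n \<le> k \<longrightarrow> bounded_multilinear n (D x)) \<and>
        (\<forall>n. enat n \<le> k \<longrightarrow>
          (\<forall>e>0. \<forall>\<^sub>F y in at x within S. \<forall>vs. length vs = n \<longrightarrow>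
             norm (D y vs - D x vs) \<le> e * prod_list (map norm vs))) \<and>
        (\<forall>n. enat n < k \<longrightarrow>
          (\<forall>e>0. \<forall>\<^sub>F y in at x within S. \<forall>vs. length vs = n \<longrightarrow>
             norm (D y vs - D x vs - D x ((y - x) # vs)) \<le> e * norm (y - x) * prod_list (map norm vs))))"


section \<open>Banach manifolds\<close>

text \<open>
  A chart \<open>\<phi> : U \<rightarrow> X\<close> is the pair \<open>(U, \<phi>)\<close>; the values of \<open>\<phi>\<close> outside \<open>U\<close> are irrelevant.
\<close>

type_synonym ('m, 'x) chart = "'m set \<times> ('m \<Rightarrow> 'x)"

definition topological_chart :: "('m::topological_space, 'x::real_normed_vector) chart \<Rightarrow> bool" where
  "topological_chart c \<longleftrightarrow>
     open (fst c) \<and> open (snd c ` fst c) \<and> (\<exists>\<psi>. homeomorphism (fst c) (snd c ` fst c) (snd c) \<psi>)"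

definition chart_inv :: "('m, 'x) chart \<Rightarrow> 'x \<Rightarrow> 'm" where
  "chart_inv c = inv_into (fst c) (snd c)"

definition transition :: "('m, 'x) chart \<Rightarrow> ('m, 'x) chart \<Rightarrow> 'x \<Rightarrow> 'x" where
  "transition c d = snd d \<circ> chart_inv c"

definition compatible_charts ::
    "enat \<Rightarrow> ('m, 'x::real_normed_vector) chart \<Rightarrow> ('m, 'x) chart \<Rightarrow> bool" where
  "compatible_charts l c d \<longleftrightarrow>
     C_smooth_on l (snd c ` (fst c \<inter> fst d)) (transition c d) \<and>
     C_smooth_on l (snd d ` (fst c \<inter> fst d)) (transition d c)"

definition C_atlas :: "enat \<Rightarrow> ('m::topological_space, 'x::real_normed_vector) chart set \<Rightarrow> bool" where
  "C_atlas l \<A> \<longleftrightarrow>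
     (\<forall>c\<in>\<A>. topological_chart c) \<and> (\<Union>c\<in>\<A>. fst c) = UNIV \<and>
     (\<forall>c\<in>\<A>. \<forall>d\<in>\<A>. compatible_charts l c d)"

definition paracompact_space :: "'a topology \<Rightarrow> bool" where
  "paracompact_space X \<longleftrightarrow>
     (\<forall>\<U>. (\<forall>U\<in>\<U>. openin X U) \<and> \<Union>\<U> = topspace X \<longrightarrow>
       (\<exists>\<V>. (\<forall>V\<in>\<V>. openin X V \<and> (\<exists>U\<in>\<U>. V \<subseteq> U)) \<and> \<Union>\<V> = topspace X \<and> locally_finite_in X \<V>))"

text \<open>
  A manifold is the whole type \<open>'m\<close> with its topology, together with a maximal \<open>C\<^sup>l\<close> atlas \<open>\<A>\<close>;
  thus the charts of the manifold are exactly the members of \<open>\<A>\<close>.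
\<close>

definition paracompact_manifold :: "enat \<Rightarrow> ('m::t2_space, 'x::banach) chart set \<Rightarrow> bool" where
  "paracompact_manifold l \<A> \<longleftrightarrow>
     paracompact_space (euclidean :: 'm topology) \<and>
     C_atlas l \<A> \<and>
     (\<forall>c. topological_chart c \<and> (\<forall>d\<in>\<A>. compatible_charts l c d) \<longrightarrow> c \<in> \<A>)"

definition charts_at :: "('m, 'x) chart set \<Rightarrow> 'm \<Rightarrow> ('m, 'x) chart set" where
  "charts_at \<A> p = {c \<in> \<A>. p \<in> fst c}"

definition C_smooth_map ::
    "enat \<Rightarrow> ('m, 'x::real_normed_vector) chart set \<Rightarrow> ('m \<Rightarrow> real) \<Rightarrow> bool" where
  "C_smooth_map m \<A> g \<longleftrightarrow> (\<forall>c\<in>\<A>. C_smooth_on m (snd c ` fst c) (g \<circ> chart_inv c))"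


section \<open>The tangent bundle\<close>

text \<open>
  A tangent vector at \<open>p\<close> is a family of vectors in the model space, indexed by the charts around
  \<open>p\<close> and transforming under the derivatives of the transition maps; equivalently, it is the graph
  of an equivalence class of pairs (chart, vector). It is padded with \<open>0\<close> at all other indices, so
  that the linear structure of the tangent space is pointwise. In particular, for a chart
  \<open>c = (U, \<phi>)\<close>, the image of \<open>v\<close> under \<open>d\<phi>(p)\<close> is just \<open>v c\<close>, and \<open>tangent_vector \<A> c p\<close> is the
  inverse map of \<open>d\<phi>(p)\<close>.
\<close>

type_synonym ('m, 'x) tangent = "('m, 'x) chart \<Rightarrow> 'x"

definition tangent_space ::
    "('m, 'x::real_normed_vector) chart set \<Rightarrow> 'm \<Rightarrow> ('m, 'x) tangent set" where
  "tangent_space \<A> p =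
     {v. (\<forall>c. c \<notin> charts_at \<A> p \<longrightarrow> v c = 0) \<and>
         (\<forall>c\<in>charts_at \<A> p. \<forall>d\<in>charts_at \<A> p.
            v d = frechet_derivative (transition c d) (at (snd c p)) (v c))}"

definition tangent_vector ::
    "('m, 'x::real_normed_vector) chart set \<Rightarrow> ('m, 'x) chart \<Rightarrow> 'm \<Rightarrow> 'x \<Rightarrow> ('m, 'x) tangent" where
  "tangent_vector \<A> c p w =
     (\<lambda>d. if d \<in> charts_at \<A> p then frechet_derivative (transition c d) (at (snd c p)) w else 0)"

definition tangent_bundle ::
    "('m, 'x::real_normed_vector) chart set \<Rightarrow> ('m \<times> ('m, 'x) tangent) set" where
  "tangent_bundle \<A> = Sigma UNIV (tangent_space \<A>)"

text \<open>The inverse of the bundle chart \<open>TU \<rightarrow> \<phi>(U) \<times> X\<close> induced by a chart \<open>c = (U, \<phi>)\<close>.\<close>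

definition bundle_param ::
    "('m, 'x::real_normed_vector) chart set \<Rightarrow> ('m, 'x) chart \<Rightarrow> 'x \<times> 'x \<Rightarrow> 'm \<times> ('m, 'x) tangent" where
  "bundle_param \<A> c = (\<lambda>(x, w). (chart_inv c x, tangent_vector \<A> c (chart_inv c x) w))"

definition tangent_topology ::
    "('m, 'x::real_normed_vector) chart set \<Rightarrow> ('m \<times> ('m, 'x) tangent) topology" where
  "tangent_topology \<A> = topology (\<lambda>W. W \<subseteq> tangent_bundle \<A> \<and>
     (\<forall>c\<in>\<A>. open ((snd c ` fst c \<times> UNIV) \<inter> bundle_param \<A> c -` W)))"

lemma openin_tangent_topology:
  "openin (tangent_topology \<A>) W \<longleftrightarrow> W \<subseteq> tangent_bundle \<A> \<and>
     (\<forall>c\<in>\<A>. open ((snd c ` fst c \<times> UNIV) \<inter> bundle_param \<A> c -` W))"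
proof -
  let ?P = "\<lambda>W. W \<subseteq> tangent_bundle \<A> \<and>
     (\<forall>c\<in>\<A>. open ((snd c ` fst c \<times> UNIV) \<inter> bundle_param \<A> c -` W))"
  have "istopology ?P"
    unfolding istopology_def
  proof (intro conjI allI impI ballI)
    fix S T c assume "?P S" "?P T" and c: "c \<in> \<A>"
    then have "open (((snd c ` fst c \<times> UNIV) \<inter> bundle_param \<A> c -` S) \<inter>
                     ((snd c ` fst c \<times> UNIV) \<inter> bundle_param \<A> c -` T))"
      by (meson open_Int)
    then show "open ((snd c ` fst c \<times> UNIV) \<inter> bundle_param \<A> c -` (S \<inter> T))"
      by (rule back_subst[where P = "open"]) auto
  next
    fix \<K> c assume "\<forall>S\<in>\<K>. ?P S" and c: "c \<in> \<A>"
    then have "open (\<Union>S\<in>\<K>. (snd c ` fst c \<times> UNIV) \<inter> bundle_param \<A> c -` S)"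
      by (meson open_UN)
    then show "open ((snd c ` fst c \<times> UNIV) \<inter> bundle_param \<A> c -` \<Union>\<K>)"
      by (rule back_subst[where P = "open"]) auto
  qed auto
  then show ?thesis
    by (simp add: tangent_topology_def)
qed


section \<open>Finsler manifolds\<close>

definition norm_on_tangent_space ::
    "('m, 'x::real_normed_vector) chart set \<Rightarrow> ('m \<times> ('m, 'x) tangent \<Rightarrow> real) \<Rightarrow> 'm \<Rightarrow> bool" where
  "norm_on_tangent_space \<A> N p \<longleftrightarrow>
     (\<forall>v\<in>tangent_space \<A> p. 0 \<le> N (p, v) \<and> (N (p, v) = 0 \<longleftrightarrow> v = (\<lambda>c. 0))) \<and>
     (\<forall>v\<in>tangent_space \<A> p. \<forall>r. N (p, \<lambda>c. r *\<^sub>R v c) = \<bar>r\<bar> * N (p, v)) \<and>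
     (\<forall>v\<in>tangent_space \<A> p. \<forall>w\<in>tangent_space \<A> p. N (p, \<lambda>c. v c + w c) \<le> N (p, v) + N (p, w))"

definition finsler_P1 ::
    "('m, 'x::real_normed_vector) chart set \<Rightarrow> ('m \<times> ('m, 'x) tangent \<Rightarrow> real) \<Rightarrow> bool" where
  "finsler_P1 \<A> N \<longleftrightarrow>
     (\<forall>p. norm_on_tangent_space \<A> N p \<and>
       (\<forall>c\<in>charts_at \<A> p. \<exists>a>0. \<exists>b>0. \<forall>w.
          a * norm w \<le> N (p, tangent_vector \<A> c p w) \<and> N (p, tangent_vector \<A> c p w) \<le> b * norm w))"

definition uniform_finsler_manifold ::
    "enat \<Rightarrow> real \<Rightarrow> ('m::t2_space, 'x::banach) chart set \<Rightarrow> ('m \<times> ('m, 'x) tangent \<Rightarrow> real) \<Rightarrow> bool" where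
  "uniform_finsler_manifold l K \<A> N \<longleftrightarrow>
     paracompact_manifold l \<A> \<and>
     continuous_map (tangent_topology \<A>) (top_of_set {0..}) N \<and>
     finsler_P1 \<A> N \<and>
     (\<forall>p. \<exists>c\<in>charts_at \<A> p. \<forall>x\<in>fst c. \<forall>v\<in>tangent_space \<A> x.
        1 / K * N (x, v) \<le> norm (v c) \<and> norm (v c) \<le> K * N (x, v))"

text \<open>
  In the next definition \<open>J\<close> is a nondegenerate compact interval; derivatives at its endpoints are
  one-sided. (The library's \<open>piecewise_C1_differentiable_on\<close> does not require one-sided derivatives
  at the break points, nor boundedness of the derivative near them.)
\<close>

definition C1_path_on ::
    "('m::topological_space, 'x::real_normed_vector) chart set \<Rightarrow> real set \<Rightarrow> (real \<Rightarrow> 'm) \<Rightarrow> bool" where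
  "C1_path_on \<A> J \<gamma> \<longleftrightarrow>
     continuous_on J \<gamma> \<and>
     (\<forall>c\<in>\<A>. \<exists>\<delta>. continuous_on (J \<inter> \<gamma> -` fst c) \<delta> \<and>
        (\<forall>t \<in> J \<inter> \<gamma> -` fst c. ((snd c \<circ> \<gamma>) has_vector_derivative \<delta> t) (at t within J)))"

definition piecewise_C1_path ::
    "('m::topological_space, 'x::real_normed_vector) chart set \<Rightarrow> real \<Rightarrow> real \<Rightarrow> (real \<Rightarrow> 'm) \<Rightarrow> bool" where
  "piecewise_C1_path \<A> a b \<gamma> \<longleftrightarrow>
     a < b \<and>
     (\<exists>n (s :: nat \<Rightarrow> real). s 0 = a \<and> s n = b \<and>
        (\<forall>i<n. s i < s (Suc i) \<and> C1_path_on \<A> {s i..s (Suc i)} \<gamma>))"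

definition velocity ::
    "('m, 'x::real_normed_vector) chart set \<Rightarrow> real \<Rightarrow> real \<Rightarrow> (real \<Rightarrow> 'm) \<Rightarrow> real \<Rightarrow> ('m, 'x) tangent" where
  "velocity \<A> a b \<gamma> t =
     (\<lambda>c. if c \<in> charts_at \<A> (\<gamma> t) then vector_derivative (snd c \<circ> \<gamma>) (at t within {a..b}) else 0)"

text \<open>
  The velocity is meaningless at the finitely many break points of \<open>\<gamma>\<close>; these do not affect the
  integral.
\<close>

definition path_length_finsler ::
    "('m, 'x::real_normed_vector) chart set \<Rightarrow> ('m \<times> ('m, 'x) tangent \<Rightarrow> real) \<Rightarrow>
     real \<Rightarrow> real \<Rightarrow> (real \<Rightarrow> 'm) \<Rightarrow> real" where
  "path_length_finsler \<A> N a b \<gamma> = integral {a..b} (\<lambda>t. N (\<gamma> t, velocity \<A> a b \<gamma> t))"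

text \<open>The infimum is taken in the extended reals, hence is \<open>\<infinity>\<close> if no path joins \<open>p\<close> to \<open>q\<close>.\<close>

definition finsler_dist ::
    "('m::topological_space, 'x::real_normed_vector) chart set \<Rightarrow> ('m \<times> ('m, 'x) tangent \<Rightarrow> real) \<Rightarrow>
     'm \<Rightarrow> 'm \<Rightarrow> ereal" where
  "finsler_dist \<A> N p q =
     Inf {ereal (path_length_finsler \<A> N a b \<gamma>) | a b \<gamma>.
            piecewise_C1_path \<A> a b \<gamma> \<and> \<gamma> a = p \<and> \<gamma> b = q}"

definition finsler_lipschitz_const ::
    "('m::topological_space, 'x::real_normed_vector) chart set \<Rightarrow> ('m \<times> ('m, 'x) tangent \<Rightarrow> real) \<Rightarrow>
     real \<Rightarrow> ('m \<Rightarrow> real) \<Rightarrow> bool" where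
  "finsler_lipschitz_const \<A> N L f \<longleftrightarrow>
     0 \<le> L \<and> (\<forall>p q. finsler_dist \<A> N p q < \<infinity> \<longrightarrow>
                 \<bar>f p - f q\<bar> \<le> L * real_of_ereal (finsler_dist \<A> N p q))"

definition finsler_lipschitz ::
    "('m::topological_space, 'x::real_normed_vector) chart set \<Rightarrow> ('m \<times> ('m, 'x) tangent \<Rightarrow> real) \<Rightarrow>
     ('m \<Rightarrow> real) \<Rightarrow> bool" where
  "finsler_lipschitz \<A> N f \<longleftrightarrow> (\<exists>L. finsler_lipschitz_const \<A> N L f)"

text \<open>For a Lipschitz function the infimum is attained, so it is the least Lipschitz constant.\<close>

definition finsler_Lip ::
    "('m::topological_space, 'x::real_normed_vector) chart set \<Rightarrow> ('m \<times> ('m, 'x) tangent \<Rightarrow> real) \<Rightarrow>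
     ('m \<Rightarrow> real) \<Rightarrow> real" where
  "finsler_Lip \<A> N f = Inf {L. finsler_lipschitz_const \<A> N L f}"

text \<open>The value \<open>dg(p)(v)\<close>, computed in an arbitrary chart around \<open>p\<close>.\<close>

definition differential ::
    "('m, 'x::real_normed_vector) chart set \<Rightarrow> ('m \<Rightarrow> real) \<Rightarrow> 'm \<Rightarrow> ('m, 'x) tangent \<Rightarrow> real" where
  "differential \<A> g p v =
     (let c = (SOME c. c \<in> charts_at \<A> p)
      in frechet_derivative (g \<circ> chart_inv c) (at (snd c p)) (v c))"

definition differential_norm ::
    "('m, 'x::real_normed_vector) chart set \<Rightarrow> ('m \<times> ('m, 'x) tangent \<Rightarrow> real) \<Rightarrow>
     ('m \<Rightarrow> real) \<Rightarrow> 'm \<Rightarrow> ereal" where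
  "differential_norm \<A> N g p =
     Sup {ereal \<bar>differential \<A> g p v\<bar> | v. v \<in> tangent_space \<A> p \<and> N (p, v) \<le> 1}"


section \<open>The approximation property of the model space\<close>

definition Lip :: "('a::metric_space \<Rightarrow> 'b::metric_space) \<Rightarrow> real" where
  "Lip f = Inf {L. L-lipschitz_on UNIV f}"

definition property_star :: "'x::banach itself \<Rightarrow> enat \<Rightarrow> real \<Rightarrow> bool" where
  "property_star _ k C0 \<longleftrightarrow>
     1 \<le> C0 \<and>
     (\<forall>f :: 'x \<Rightarrow> real. \<forall>\<epsilon>>0. (\<exists>L. L-lipschitz_on UNIV f) \<longrightarrow>
        (\<exists>h :: 'x \<Rightarrow> real. (\<exists>L. L-lipschitz_on UNIV h) \<and> C_smooth_on k UNIV h \<and>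
           (\<forall>x. \<bar>f x - h x\<bar> < \<epsilon>) \<and> Lip h \<le> C0 * Lip f))"

end

theory Submission
  imports Defs
begin

text \<open>
  On a small ball of a \<open>K\<close>-uniform chart the function \<open>f\<close> is \<open>K Lip(f)\<close>-Lipschitz, because straight
  segments of the chart are short paths; extending it to the model space and using property
  \<open>(*\<^sup>k)\<close> gives smooth local approximations with \<open>\<parallel>dh\<parallel> \<le> C\<^sub>0 K\<^sup>2 Lip(f)\<close>, as close to \<open>f\<close> as desired.
  They are glued with a partition of unity \<open>\<psi>\<^sub>n\<close>. Since \<open>d(\<Sum> \<psi>\<^sub>n f\<^sub>n) = \<Sum> \<psi>\<^sub>n df\<^sub>n + \<Sum> (f\<^sub>n - f(p)) d\<psi>\<^sub>n\<close>
  at \<open>p\<close>, the second sum must stay below \<open>C\<^sub>0 K\<^sup>2 Lip(f)\<close>, which is where the factor 2 is spent. This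
  requires a countable partition with \<open>\<parallel>d\<psi>\<^sub>n\<parallel>\<close> bounded for each \<open>n\<close>: well-ordering a locally finite cover
  by chart balls turns it into countably many open sets \<open>W\<^sub>n\<close>, each a disjoint union of pieces of charts,
  on which one may approximate piece by piece. The bound on \<open>dg\<close> finally integrates along paths.
\<close>

section \<open>Multilinear maps and iterated derivatives\<close>

text \<open>Since \<open>X\<close> may be nonseparable, a cover by charts may be uncountable, and
  smooth bump functions are not given: the cutoffs must themselves come from
  \<open>property_star\<close>, applied to Lipschitz functions in charts, and their slopes are
  controlled only by constants that grow with the index. The gluing error at a point is a sum of
  terms (accuracy of the n-th approximation) times (slope of the n-th weight). Accuracies can be
  made summable over the natural numbers, but not over an uncountable set of charts, where local
  finiteness gives no bound on the number of charts meeting at a point. Hence the countably many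
  layers. Within a layer one cutoff and one approximation serve all pieces at once, while the
  accuracy still varies from piece to piece, as a merely continuous \<open>\<epsilon>\<close>
  demands. The two factors \<open>K\<close> in \<open>C0 * K\<^sup>2 * L\<close> have different
  origins: one is paid for comparing the Finsler distance with the chart norm, which makes
  \<open>f\<close> Lipschitz in the chart, the other for measuring a chart derivative by
  \<open>N\<close>.\<close>

definition multilin :: "('a::real_normed_vector list \<Rightarrow> 'b::real_normed_vector) \<Rightarrow> bool" where
  "multilin p \<longleftrightarrow> (\<forall>us ws. linear (\<lambda>v. p (us @ v # ws)))"

text \<open>
  One type contains \<open>L\<^sup>n(X; Y)\<close> for all \<open>n\<close> (the values on lists of length \<open>n\<close>), so that derivatives of all
  orders live in the same space and one can argue by induction on the order.
\<close>

typedef (overloaded) ('a, 'b) mlin =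
  "{p :: 'a::real_normed_vector list \<Rightarrow> 'b::real_normed_vector.
     multilin p \<and> (\<exists>B. \<forall>vs. norm (p vs) \<le> B * prod_list (map norm vs))}"
  morphisms mapp Mlin
proof -
  have "multilin (\<lambda>_::'a list. 0::'b)"
    by (auto simp: multilin_def module_hom_zero)
  then show ?thesis by (auto intro!: exI[of _ "\<lambda>_::'a list. 0::'b"] exI[of _ 0])
qed

lemma mlin_eqI: "(\<And>vs. mapp p vs = mapp q vs) \<Longrightarrow> p = q"
  by (simp add: mapp_inject[symmetric] ext)

lemma linear_mapp: "linear (\<lambda>v. mapp p (us @ v # ws))"
  using mapp[of p] by (simp add: multilin_def)

lemma prod_norm_nonneg: "0 \<le> prod_list (map norm (vs :: 'a::real_normed_vector list))"
  by (induction vs) auto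

lemma mapp_bound: "\<exists>B\<ge>0. \<forall>vs. norm (mapp p vs) \<le> B * prod_list (map norm vs)"
proof -
  obtain B where B: "\<And>vs. norm (mapp p vs) \<le> B * prod_list (map norm vs)"
    using mapp[of p] by auto
  have "norm (mapp p vs) \<le> max B 0 * prod_list (map norm vs)" for vs
    using B[of vs] mult_right_mono[OF max.cobounded1[of B 0] prod_norm_nonneg[of vs]] by linarith
  then show ?thesis by (intro exI[of _ "max B 0"]) auto
qed

lemma mapp_Mlin:
  assumes "multilin p" "\<And>vs. norm (p vs) \<le> B * prod_list (map norm vs)"
  shows "mapp (Mlin p) = p"
  using assms by (subst Mlin_inverse) auto

instantiation mlin :: (real_normed_vector, real_normed_vector) real_normed_vector
begin

definition "0 = Mlin (\<lambda>_. 0)"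
definition "p + q = Mlin (\<lambda>vs. mapp p vs + mapp q vs)"
definition "p - q = Mlin (\<lambda>vs. mapp p vs - mapp q vs)"
definition "- p = Mlin (\<lambda>vs. - mapp p vs)"
definition "a *\<^sub>R p = Mlin (\<lambda>vs. a *\<^sub>R mapp p vs)"
text \<open>One supremum runs over lists of all lengths. A list with a zero entry contributes 0
  because division by zero yields 0; this fits, since \<open>p\<close> vanishes on such
  lists.\<close>

definition "norm p = (SUP vs. norm (mapp p vs) / prod_list (map norm vs))"
definition "dist p q = norm (p - q :: ('a, 'b) mlin)"
definition "sgn p = inverse (norm p) *\<^sub>R (p :: ('a, 'b) mlin)"
definition [code del]: "(uniformity :: (('a, 'b) mlin \<times> ('a, 'b) mlin) filter) =
  (INF e\<in>{0<..}. principal {(x, y). dist x y < e})"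
definition [code del]: "open (U :: ('a, 'b) mlin set) \<longleftrightarrow>
  (\<forall>x\<in>U. eventually (\<lambda>(x', y). x' = x \<longrightarrow> y \<in> U) uniformity)"

lemma mapp_zero [simp]: "mapp 0 vs = 0"
  unfolding zero_mlin_def
  by (subst mapp_Mlin[where B = 0]) (auto simp: multilin_def module_hom_zero)

lemma mapp_add [simp]: "mapp (p + q) vs = mapp p vs + mapp q vs"
proof -
  obtain B C where "\<And>vs. norm (mapp p vs) \<le> B * prod_list (map norm vs)"
    "\<And>vs. norm (mapp q vs) \<le> C * prod_list (map norm vs)"
    using mapp_bound by metis
  then show ?thesis
    unfolding plus_mlin_def
    by (subst mapp_Mlin[where B = "B + C"])
       (auto simp: multilin_def distrib_right intro!: linear_compose_add linear_mapp
         intro: order.trans[OF norm_triangle_ineq add_mono])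
qed

lemma mapp_scaleR [simp]: "mapp (a *\<^sub>R p) vs = a *\<^sub>R mapp p vs"
proof -
  obtain B where "\<And>vs. norm (mapp p vs) \<le> B * prod_list (map norm vs)"
    using mapp_bound by metis
  then show ?thesis
    unfolding scaleR_mlin_def
    by (subst mapp_Mlin[where B = "\<bar>a\<bar> * B"])
       (auto simp: multilin_def mult.assoc intro!: linear_compose_scale_right linear_mapp mult_left_mono)
qed

lemma mapp_uminus [simp]: "mapp (- p) vs = - mapp p vs"
proof -
  have "(- p :: ('a, 'b) mlin) = (- 1) *\<^sub>R p"
    by (simp add: uminus_mlin_def scaleR_mlin_def)
  then show ?thesis by simp
qed

lemma mapp_diff [simp]: "mapp (p - q) vs = mapp p vs - mapp q vs"
proof -
  have "(p - q :: ('a, 'b) mlin) = p + (- q)"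
    by (simp add: minus_mlin_def plus_mlin_def[of p "- q"])
  then show ?thesis by simp
qed

lemma mapp_eq_0: "0 \<in> set vs \<Longrightarrow> mapp p vs = 0"
  using linear_0[OF linear_mapp] by (auto simp: in_set_conv_decomp)

lemma norm_mlin_bdd: "bdd_above (range (\<lambda>vs. norm (mapp p vs) / prod_list (map norm vs)))"
proof -
  obtain B where B: "B \<ge> 0" "\<And>vs. norm (mapp p vs) \<le> B * prod_list (map norm vs)"
    using mapp_bound by metis
  show ?thesis
  proof (rule bdd_aboveI2)
    fix vs
    show "norm (mapp p vs) / prod_list (map norm vs) \<le> B"
      using B(1) B(2)[of vs] prod_norm_nonneg[of vs]
      by (cases "prod_list (map norm vs) = 0") (auto simp: divide_le_eq)
  qed
qed

lemma norm_mapp_le: "norm (mapp p vs) \<le> norm p * prod_list (map norm vs)"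
proof (cases "0 \<in> set vs")
  case True
  have "prod_list (map norm vs) = 0"
    using True by (simp add: prod_list_zero_iff image_iff)
  with True show ?thesis by (simp add: mapp_eq_0)
next
  case False
  then have "prod_list (map norm vs) \<noteq> 0"
    by (auto simp: prod_list_zero_iff)
  moreover have "norm (mapp p vs) / prod_list (map norm vs) \<le> norm p"
    unfolding norm_mlin_def by (rule cSUP_upper[OF UNIV_I norm_mlin_bdd])
  ultimately show ?thesis
    using prod_norm_nonneg[of vs] by (simp add: divide_le_eq)
qed

lemma norm_mlin_le:
  assumes "0 \<le> B" "\<And>vs. norm (mapp p vs) \<le> B * prod_list (map norm vs)"
  shows "norm p \<le> B"
  unfolding norm_mlin_def
proof (rule cSUP_least)
  fix vs
  show "norm (mapp p vs) / prod_list (map norm vs) \<le> B"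
    using assms(1) assms(2)[of vs] prod_norm_nonneg[of vs]
    by (cases "prod_list (map norm vs) = 0") (auto simp: divide_le_eq)
qed simp

lemma norm_mlin_nonneg: "0 \<le> norm (p :: ('a, 'b) mlin)"
proof -
  have "norm (mapp p []) \<le> norm p" using norm_mapp_le[of p "[]"] by simp
  then show ?thesis using norm_ge_zero order_trans by blast
qed

instance
proof
  fix p q r :: "('a, 'b) mlin" and a b :: real
  show "norm p = 0 \<longleftrightarrow> p = 0"
  proof
    assume "norm p = 0"
    then have "mapp p vs = mapp 0 vs" for vs
      using norm_mapp_le[of p vs] by simp
    then show "p = 0" by (rule mlin_eqI)
  next
    assume "p = 0"
    then have "norm p \<le> 0" by (intro norm_mlin_le) auto
    then show "norm p = 0" using norm_mlin_nonneg[of p] by simp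
  qed
  show "norm (p + q) \<le> norm p + norm q"
  proof (rule norm_mlin_le)
    fix vs
    show "norm (mapp (p + q) vs) \<le> (norm p + norm q) * prod_list (map norm vs)"
      using norm_triangle_ineq[of "mapp p vs" "mapp q vs"] norm_mapp_le[of p vs] norm_mapp_le[of q vs]
      by (simp add: distrib_right)
  qed (simp add: norm_mlin_nonneg)
  have *: "norm (c *\<^sub>R s) \<le> \<bar>c\<bar> * norm s" for c and s :: "('a, 'b) mlin"
    by (rule norm_mlin_le)
       (auto simp: norm_mlin_nonneg mult.assoc intro!: mult_left_mono norm_mapp_le)
  show "norm (a *\<^sub>R p) = \<bar>a\<bar> * norm p"
  proof (cases "a = 0")
    case True
    then show ?thesis using *[of a p] norm_mlin_nonneg[of "a *\<^sub>R p"] by simp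
  next
    case False
    have "inverse a *\<^sub>R (a *\<^sub>R p) = p" using False by (intro mlin_eqI) simp
    then have "norm p \<le> \<bar>inverse a\<bar> * norm (a *\<^sub>R p)" using *[of "inverse a" "a *\<^sub>R p"] by simp
    then have "\<bar>a\<bar> * norm p \<le> norm (a *\<^sub>R p)" using False by (simp add: field_simps)
    then show ?thesis using *[of a p] by simp
  qed
qed (auto simp: dist_mlin_def sgn_mlin_def uniformity_mlin_def open_mlin_def
        intro!: mlin_eqI simp: algebra_simps)

end

text \<open>A value \<open>y\<close> as an element of L^0. Functions into the target space enter the
  recursion on the order only through \<open>mconst\<close>, so that they and all their derivatives
  have the same type.\<close>

definition mconst :: "'b::real_normed_vector \<Rightarrow> ('a::real_normed_vector, 'b) mlin" where
  "mconst y = Mlin (\<lambda>vs. if vs = [] then y else 0)"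

lemma mapp_mconst [simp]: "mapp (mconst y) vs = (if vs = [] then y else 0)"
  unfolding mconst_def
  by (subst mapp_Mlin[where B = "norm y"])
     (auto simp: multilin_def module_hom_zero intro!: mult_nonneg_nonneg prod_norm_nonneg)

lemma bounded_linear_mconst: "bounded_linear mconst"
  by (rule bounded_linear_intro[where K = 1])
     (auto intro!: mlin_eqI norm_mlin_le mult_nonneg_nonneg prod_norm_nonneg)

lemma bounded_linear_mapp: "bounded_linear (\<lambda>p. mapp p vs)"
  by (rule bounded_linear_intro[where K = "prod_list (map norm vs)"]) (auto simp: norm_mapp_le)

definition shift :: "'a::real_normed_vector \<Rightarrow> ('a, 'b::real_normed_vector) mlin \<Rightarrow> ('a, 'b) mlin" where
  "shift u p = Mlin (\<lambda>vs. mapp p (u # vs))"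

lemma mapp_shift [simp]: "mapp (shift u p) vs = mapp p (u # vs)"
  unfolding shift_def
  by (subst mapp_Mlin[where B = "norm p * norm u"])
     (use norm_mapp_le[of p "u # _"] linear_mapp[of p "u # _"] in \<open>auto simp: multilin_def mult.assoc\<close>)

lemma norm_shift_le: "norm (shift u p) \<le> norm u * norm p"
  by (rule norm_mlin_le) (use norm_mapp_le[of p "u # _"] in \<open>auto simp: mult_ac\<close>)

lemma bounded_bilinear_shift: "bounded_bilinear shift"
proof
  fix p :: "('a, 'b) mlin" and u v :: 'a and r
  show "shift (u + v) p = shift u p + shift v p"
    by (rule mlin_eqI) (use linear_add[OF linear_mapp[of p "[]"]] in simp)
  show "shift (r *\<^sub>R u) p = r *\<^sub>R shift u p"
    by (rule mlin_eqI) (use linear_scale[OF linear_mapp[of p "[]"]] in simp)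
qed (auto intro!: mlin_eqI exI[of _ 1] norm_shift_le)

text \<open>Inverse of \<^const>\<open>shift\<close>: identifies \<open>L(X, L\<^sup>n(X; Y))\<close> with \<open>L\<^sup>n\<^sup>+\<^sup>1(X; Y)\<close>.\<close>

definition unshift :: "('a::real_normed_vector \<Rightarrow> ('a, 'b::real_normed_vector) mlin) \<Rightarrow> ('a, 'b) mlin" where
  "unshift T = Mlin (\<lambda>vs. case vs of [] \<Rightarrow> 0 | u # us \<Rightarrow> mapp (T u) us)"

lemma mapp_unshift_case:
  assumes "bounded_linear T"
  shows "mapp (unshift T) vs = (case vs of [] \<Rightarrow> 0 | u # us \<Rightarrow> mapp (T u) us)"
proof -
  interpret T: bounded_linear T by fact
  obtain B where B: "0 \<le> B" "\<And>u. norm (T u) \<le> norm u * B"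
    using T.nonneg_bounded by auto
  have "linear (\<lambda>v. case us @ v # ws of [] \<Rightarrow> 0 | u # us \<Rightarrow> mapp (T u) us)" for us ws
  proof (cases us)
    case Nil
    then show ?thesis by (auto intro!: linearI simp: T.add T.scaleR)
  next
    case (Cons a us')
    then show ?thesis by (simp add: linear_mapp)
  qed
  moreover have "norm (case vs of [] \<Rightarrow> 0 | u # us \<Rightarrow> mapp (T u) us) \<le> B * prod_list (map norm vs)" for vs
  proof (cases vs)
    case (Cons a us)
    have "norm (mapp (T a) us) \<le> norm (T a) * prod_list (map norm us)" by (rule norm_mapp_le)
    also have "\<dots> \<le> (norm a * B) * prod_list (map norm us)"
      by (intro mult_right_mono B prod_norm_nonneg)
    finally show ?thesis using Cons by (simp add: mult_ac)
  qed (use B in auto)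
  ultimately show ?thesis
    unfolding unshift_def by (subst mapp_Mlin) (auto simp: multilin_def)
qed

lemma mapp_unshift:
  assumes "bounded_linear T"
  shows "mapp (unshift T) [] = 0" "mapp (unshift T) (u # us) = mapp (T u) us"
  by (simp_all add: mapp_unshift_case[OF assms])

lemma shift_unshift: "bounded_linear T \<Longrightarrow> shift u (unshift T) = T u"
  by (rule mlin_eqI) (simp add: mapp_unshift)

lemma norm_unshift_le:
  assumes "bounded_linear T" "0 \<le> B" "\<And>u. norm (T u) \<le> B * norm u"
  shows "norm (unshift T) \<le> B"
proof (rule norm_mlin_le)
  fix vs
  show "norm (mapp (unshift T) vs) \<le> B * prod_list (map norm vs)"
  proof (cases vs)
    case (Cons a us)
    have "norm (mapp (T a) us) \<le> norm (T a) * prod_list (map norm us)" by (rule norm_mapp_le)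
    also have "\<dots> \<le> (B * norm a) * prod_list (map norm us)"
      by (intro mult_right_mono assms prod_norm_nonneg)
    finally show ?thesis using Cons assms(1) by (simp add: mult_ac mapp_unshift)
  qed (use assms in \<open>simp add: mapp_unshift\<close>)
qed fact

lemma unshift_shift:
  assumes "mapp p [] = 0"
  shows "unshift (\<lambda>u. shift u p) = p"
proof (rule mlin_eqI)
  fix vs
  show "mapp (unshift (\<lambda>u. shift u p)) vs = mapp p vs"
    using assms by (cases vs) (simp_all add: mapp_unshift bounded_bilinear.bounded_linear_left[OF bounded_bilinear_shift])
qed

text \<open>The product rule and the chain rule produce derivatives of the form
  \<open>unshift (T p q)\<close> with \<open>T\<close> bilinear in \<open>p\<close> and
  \<open>q\<close>. That this is bounded bilinear again keeps both inductions on the order inside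
  one class of expressions.\<close>

lemma bounded_bilinear_unshift:
  assumes lin: "\<And>p q. bounded_linear (T p q)"
    and add1: "\<And>p p' q u. T (p + p') q u = T p q u + T p' q u"
    and add2: "\<And>p q q' u. T p (q + q') u = T p q u + T p q' u"
    and sc1: "\<And>r p q u. T (r *\<^sub>R p) q u = r *\<^sub>R T p q u"
    and sc2: "\<And>r p q u. T p (r *\<^sub>R q) u = r *\<^sub>R T p q u"
    and bd: "\<And>p q u. norm (T p q u) \<le> C * norm p * norm q * norm u"
  shows "bounded_bilinear (\<lambda>p q. unshift (T p q))"
proof
  fix p p' q q' r
  show "unshift (T (p + p') q) = unshift (T p q) + unshift (T p' q)"
    by (rule mlin_eqI, case_tac vs) (simp_all add: mapp_unshift lin add1)
  show "unshift (T p (q + q')) = unshift (T p q) + unshift (T p q')"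
    by (rule mlin_eqI, case_tac vs) (simp_all add: mapp_unshift lin add2)
  show "unshift (T (r *\<^sub>R p) q) = r *\<^sub>R unshift (T p q)"
    by (rule mlin_eqI, case_tac vs) (simp_all add: mapp_unshift lin sc1)
  show "unshift (T p (r *\<^sub>R q)) = r *\<^sub>R unshift (T p q)"
    by (rule mlin_eqI, case_tac vs) (simp_all add: mapp_unshift lin sc2)
next
  have "norm (unshift (T p q)) \<le> norm p * norm q * max C 0" for p q
  proof (rule norm_unshift_le[OF lin])
    fix u
    have "norm (T p q u) \<le> C * (norm p * norm q * norm u)" using bd by (simp add: mult.assoc)
    also have "\<dots> \<le> max C 0 * (norm p * norm q * norm u)" by (intro mult_right_mono) auto
    finally show "norm (T p q u) \<le> norm p * norm q * max C 0 * norm u" by (simp add: mult_ac)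
  qed auto
  then show "\<exists>K. \<forall>p q. norm (unshift (T p q)) \<le> norm p * norm q * K" by blast
qed

section \<open>Maps of class C^k into the space of multilinear maps\<close>

definition has_mder :: "('a::real_normed_vector \<Rightarrow> ('a, 'b::real_normed_vector) mlin) \<Rightarrow>
    ('a, 'b) mlin \<Rightarrow> 'a \<Rightarrow> bool" where
  "has_mder F p x \<longleftrightarrow> mapp p [] = 0 \<and> (F has_derivative (\<lambda>u. shift u p)) (at x)"

definition mder :: "('a::real_normed_vector \<Rightarrow> ('a, 'b::real_normed_vector) mlin) \<Rightarrow>
    'a \<Rightarrow> ('a, 'b) mlin" where
  "mder F x = (THE p. has_mder F p x)"

text \<open>The derivative determines \<open>shift u p\<close> for all \<open>u\<close>, which says
  nothing about the value of \<open>p\<close> on the empty list; the clause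
  \<open>mapp p [] = 0\<close> of \<open>has_mder\<close> settles that value.\<close>

lemma has_mder_unique:
  assumes "has_mder F p x" "has_mder F q x"
  shows "p = q"
proof -
  have "(F has_derivative (\<lambda>u. shift u p)) (at x)" "(F has_derivative (\<lambda>u. shift u q)) (at x)"
    using assms by (simp_all only: has_mder_def)
  then have *: "(\<lambda>u. shift u p) = (\<lambda>u. shift u q)"
    by (rule has_derivative_unique)
  have "p = unshift (\<lambda>u. shift u p)"
    using assms(1) by (intro unshift_shift[symmetric]) (simp only: has_mder_def)
  also have "\<dots> = unshift (\<lambda>u. shift u q)" by (simp only: *)
  also have "\<dots> = q"
    using assms(2) by (intro unshift_shift) (simp only: has_mder_def)
  finally show ?thesis .
qed

lemma mder_eq: "has_mder F p x \<Longrightarrow> mder F x = p"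
  unfolding mder_def by (rule the_equality) (auto intro: has_mder_unique)

text \<open>The derivative \<open>mder F\<close> has the type of \<open>F\<close>, hence the
  recursion. Differentiability refers to full neighbourhoods, so \<open>S\<close> is meant to be
  open; only the continuity at order 0 is relative to \<open>S\<close>.\<close>

primrec Ck :: "nat \<Rightarrow> 'a::real_normed_vector set \<Rightarrow> ('a \<Rightarrow> ('a, 'b::real_normed_vector) mlin) \<Rightarrow> bool" where
  "Ck 0 S F \<longleftrightarrow> continuous_on S F"
| "Ck (Suc n) S F \<longleftrightarrow> (\<forall>x\<in>S. has_mder F (mder F x) x) \<and> Ck n S (mder F)"

lemma has_mder_cong_open:
  assumes "open S" "x \<in> S" "\<And>y. y \<in> S \<Longrightarrow> F y = G y"
  shows "has_mder F p x = has_mder G p x"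
  unfolding has_mder_def
  using has_derivative_transform_within_open[of F _ x UNIV S G]
    has_derivative_transform_within_open[of G _ x UNIV S F] assms by auto

lemma Ck_cong:
  assumes "open S" "\<And>y. y \<in> S \<Longrightarrow> F y = G y"
  shows "Ck n S F = Ck n S G"
  using assms(2)
proof (induction n arbitrary: F G)
  case 0
  then show ?case by (auto cong: continuous_on_cong)
next
  case (Suc n)
  have *: "has_mder F p x = has_mder G p x" if "x \<in> S" for p x
    using has_mder_cong_open[OF assms(1) that Suc.prems] .
  then have **: "mder F x = mder G x" if "x \<in> S" for x
    using that by (simp add: mder_def)
  show ?case using Suc.IH[of "mder F" "mder G"] * ** by auto
qed

lemma Ck_SucI:
  assumes "open S" "\<And>x. x \<in> S \<Longrightarrow> has_mder F (G x) x" "Ck n S G"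
  shows "Ck (Suc n) S F"
proof -
  have "mder F x = G x" if "x \<in> S" for x
    using assms(2)[OF that] by (rule mder_eq)
  then show ?thesis
    using assms Ck_cong[OF assms(1), of "mder F" G n] by auto
qed

lemma Ck_has_derivative:
  "Ck (Suc n) S F \<Longrightarrow> x \<in> S \<Longrightarrow> (F has_derivative (\<lambda>u. shift u (mder F x))) (at x)"
  by (simp add: has_mder_def)

lemma Ck_SucD: "Ck (Suc n) S F \<Longrightarrow> Ck n S F"
proof (induction n arbitrary: F)
  case 0
  then show ?case
    by (auto simp: has_mder_def intro!: continuous_at_imp_continuous_on intro: has_derivative_continuous)
next
  case (Suc n)
  from Suc.prems have "Ck (Suc n) S (mder F)" by simp
  then have "Ck n S (mder F)" by (rule Suc.IH)
  with Suc.prems show ?case by simp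
qed

lemma Ck_subset: "Ck n S F \<Longrightarrow> T \<subseteq> S \<Longrightarrow> Ck n T F"
  by (induction n arbitrary: F) (auto intro: continuous_on_subset)

lemma Ck_local:
  assumes "\<And>x. x \<in> S \<Longrightarrow> \<exists>T. open T \<and> x \<in> T \<and> Ck n T F"
  shows "Ck n S F"
  using assms
proof (induction n arbitrary: F)
  case 0
  have "isCont F x" if "x \<in> S" for x
    using 0[OF that] by (auto simp: continuous_on_eq_continuous_at)
  then show ?case by (simp add: continuous_at_imp_continuous_on)
next
  case (Suc n)
  have "\<exists>T. open T \<and> x \<in> T \<and> Ck n T (mder F)" if "x \<in> S" for x
    using Suc.prems[OF that] by auto
  then show ?case using Suc.IH[of "mder F"] Suc.prems by auto
qed

lemma Ck_add:
  assumes "open S" "Ck n S F" "Ck n S G"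
  shows "Ck n S (\<lambda>x. F x + G x)"
  using assms(2,3)
proof (induction n arbitrary: F G)
  case 0
  then show ?case by (auto intro: continuous_intros)
next
  case (Suc n)
  have "Ck n S (\<lambda>x. mder F x + mder G x)" using Suc by simp
  moreover have "has_mder (\<lambda>x. F x + G x) (mder F x + mder G x) x" if "x \<in> S" for x
    using Suc.prems that has_derivative_add[of F _ "at x" G]
    by (auto simp: has_mder_def bounded_bilinear.add_right[OF bounded_bilinear_shift])
  ultimately show ?case by (intro Ck_SucI[OF assms(1)])
qed

text \<open>The derivative of B(P, Q) is B(P, dQ) + B(dP, Q), a sum of two expressions of the same
  kind for the bilinear maps \<open>B2\<close> and \<open>B1\<close>. The induction therefore runs
  over all \<open>B\<close> simultaneously.\<close>

lemma Ck_bilinear: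
  fixes B :: "('a::real_normed_vector, 'b::real_normed_vector) mlin \<Rightarrow>
      ('a, 'c::real_normed_vector) mlin \<Rightarrow> ('a, 'd::real_normed_vector) mlin"
  assumes "open S" "bounded_bilinear B" "Ck n S P" "Ck n S Q"
  shows "Ck n S (\<lambda>x. B (P x) (Q x))"
  using assms(2-4)
proof (induction n arbitrary: B P Q)
  case 0
  then show ?case using bounded_bilinear.continuous_on[of B S P Q] by simp
next
  case (Suc n)
  interpret B: bounded_bilinear B by fact
  interpret shift: bounded_bilinear "shift :: 'a \<Rightarrow> ('a, 'b) mlin \<Rightarrow> _" by (rule bounded_bilinear_shift)
  interpret shift': bounded_bilinear "shift :: 'a \<Rightarrow> ('a, 'c) mlin \<Rightarrow> _" by (rule bounded_bilinear_shift)
  obtain C where C: "0 < C" "\<And>a b. norm (B a b) \<le> norm a * norm b * C" using B.pos_bounded by blast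
  have l1: "bounded_linear (\<lambda>u. B (shift u p) q)" for p q
    using bounded_linear_compose[OF B.bounded_linear_left shift.bounded_linear_left] .
  have l2: "bounded_linear (\<lambda>u. B p (shift u q))" for p q
    using bounded_linear_compose[OF B.bounded_linear_right shift'.bounded_linear_left] .
  \<comment> \<open>Here \<open>p\<close> stands for dP: the direction \<open>u\<close> fills its
    first argument and becomes the first argument of the result.\<close>
  define B1 where "B1 = (\<lambda>p q. unshift (\<lambda>u. B (shift u p) q))"
  define B2 where "B2 = (\<lambda>p q. unshift (\<lambda>u. B p (shift u q)))"
  have "bounded_bilinear B1"
    unfolding B1_def
  proof (rule bounded_bilinear_unshift[where C = C])
    show "norm (B (shift u p) q) \<le> C * norm p * norm q * norm u" for u p q
    proof -
      have "norm (B (shift u p) q) \<le> (norm u * norm p) * norm q * C"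
        by (rule order.trans[OF C(2)]) (intro mult_right_mono norm_shift_le norm_ge_zero less_imp_le[OF C(1)])
      then show ?thesis by (simp add: mult_ac)
    qed
  qed (simp_all add: l1 B.add_left B.add_right B.scaleR_left B.scaleR_right shift.add_right shift.scaleR_right)
  moreover have "bounded_bilinear B2"
    unfolding B2_def
  proof (rule bounded_bilinear_unshift[where C = C])
    show "norm (B p (shift u q)) \<le> C * norm p * norm q * norm u" for u p q
    proof -
      have "norm (B p (shift u q)) \<le> norm p * (norm u * norm q) * C"
        by (rule order.trans[OF C(2)])
           (intro mult_right_mono mult_left_mono norm_shift_le norm_ge_zero less_imp_le[OF C(1)])
      then show ?thesis by (simp add: mult_ac)
    qed
  qed (simp_all add: l2 B.add_left B.add_right B.scaleR_left B.scaleR_right shift'.add_right shift'.scaleR_right)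
  moreover have "Ck n S P" "Ck n S Q" using Suc.prems(2,3) by (auto intro: Ck_SucD simp del: Ck.simps)
  moreover have "Ck n S (mder P)" "Ck n S (mder Q)" using Suc.prems(2,3) by auto
  ultimately have "Ck n S (\<lambda>x. B2 (P x) (mder Q x) + B1 (mder P x) (Q x))"
    by (intro Ck_add[OF assms(1)] Suc.IH)
  moreover have "has_mder (\<lambda>x. B (P x) (Q x)) (B2 (P x) (mder Q x) + B1 (mder P x) (Q x)) x" if "x \<in> S" for x
  proof -
    have "((\<lambda>x. B (P x) (Q x)) has_derivative
        (\<lambda>u. B (P x) (shift u (mder Q x)) + B (shift u (mder P x)) (Q x))) (at x)"
      using Suc.prems that by (intro B.FDERIV) (simp_all add: has_mder_def)
    then show ?thesis
      by (simp add: has_mder_def B1_def B2_def bounded_bilinear.add_right[OF bounded_bilinear_shift]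
          shift_unshift[OF l1] shift_unshift[OF l2] mapp_unshift(1)[OF l1] mapp_unshift(1)[OF l2])
  qed
  ultimately show ?case by (intro Ck_SucI[OF assms(1)])
qed

lemma Ck_const: "Ck n S (\<lambda>x. p)"
proof (induction n arbitrary: p)
  case (Suc n)
  have *: "has_mder (\<lambda>x. p) 0 x" for x
    by (auto simp: has_mder_def bounded_bilinear.zero_right[OF bounded_bilinear_shift])
  then have "mder (\<lambda>x. p) = (\<lambda>x. 0)"
    by (auto intro: mder_eq)
  then show ?case using * Suc by simp
qed (simp)

text \<open>The inner map goes from the space to itself, so that \<open>F\<close> and F o g take
  values in the same type. The derivative of the composite is a bounded bilinear expression in dF o
  g and dg; the first is smooth by induction, the whole by \<open>Ck_bilinear\<close>.\<close>

lemma Ck_compose: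
  fixes F :: "'a::real_normed_vector \<Rightarrow> ('a, 'b::real_normed_vector) mlin" and g :: "'a \<Rightarrow> 'a"
  assumes "open S" "Ck n T F" "Ck n S (\<lambda>x. mconst (g x))" "g ` S \<subseteq> T"
  shows "Ck n S (\<lambda>x. F (g x))"
  using assms(2,3)
proof (induction n arbitrary: F)
  case 0
  have "continuous_on S (\<lambda>x. mapp (mconst (g x) :: ('a, 'a) mlin) [])"
    using 0 by (intro bounded_linear.continuous_on[OF bounded_linear_mapp]) auto
  then have "continuous_on S g" by simp
  moreover have "continuous_on T F" using 0 by simp
  ultimately show ?case using assms(4) by (auto intro: continuous_on_compose2)
next
  case (Suc n)
  let ?G = "mder (\<lambda>x. mconst (g x) :: ('a, 'a) mlin)"
  interpret shift: bounded_bilinear "shift :: 'a \<Rightarrow> ('a, 'b) mlin \<Rightarrow> _" by (rule bounded_bilinear_shift)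
  \<comment> \<open>\<open>q\<close> is dg(x) and \<open>p\<close> is dF(g x):
    \<open>mapp q [u]\<close> is the direction in which \<open>p\<close> is evaluated.\<close>
  define B where "B = (\<lambda>p (q :: ('a, 'a) mlin). unshift (\<lambda>u. shift (mapp q [u]) p :: ('a, 'b) mlin))"
  have lq: "bounded_linear (\<lambda>u. mapp q [u])" for q :: "('a, 'a) mlin"
  proof (rule bounded_linear_intro[where K = "norm q"])
    have l: "linear (\<lambda>u. mapp q [u])" using linear_mapp[of q "[]" "[]"] by simp
    show "mapp q [x + y] = mapp q [x] + mapp q [y]" for x y by (rule linear_add[OF l])
    show "mapp q [r *\<^sub>R x] = r *\<^sub>R mapp q [x]" for r x by (rule linear_scale[OF l])
    show "norm (mapp q [u]) \<le> norm u * norm q" for u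
      using norm_mapp_le[of q "[u]"] by (simp add: mult.commute)
  qed
  have l: "bounded_linear (\<lambda>u. shift (mapp q [u]) p)" for p :: "('a, 'b) mlin" and q :: "('a, 'a) mlin"
    using bounded_linear_compose[OF shift.bounded_linear_left lq] .
  have "bounded_bilinear B"
    unfolding B_def
  proof (rule bounded_bilinear_unshift[where C = 1])
    fix p :: "('a, 'b) mlin" and q :: "('a, 'a) mlin" and u
    have "norm (shift (mapp q [u]) p) \<le> norm (mapp q [u]) * norm p" by (rule norm_shift_le)
    also have "\<dots> \<le> (norm q * norm u) * norm p"
      using norm_mapp_le[of q "[u]"] by (intro mult_right_mono) auto
    finally show "norm (shift (mapp q [u]) p) \<le> 1 * norm p * norm q * norm u" by (simp add: mult_ac)
  qed (simp_all add: l shift.add_left shift.add_right shift.scaleR_left shift.scaleR_right)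
  moreover have "Ck n S (\<lambda>x. mder F (g x))"
    using Suc.prems(1) by (intro Suc.IH Ck_SucD[OF Suc.prems(2)]) simp
  moreover have "Ck n S ?G" using Suc.prems by auto
  ultimately have "Ck n S (\<lambda>x. B (mder F (g x)) (?G x))"
    using Ck_bilinear[OF assms(1)] by blast
  moreover have "has_mder (\<lambda>x. F (g x)) (B (mder F (g x)) (?G x)) x" if "x \<in> S" for x
  proof -
    have "((\<lambda>x. mconst (g x) :: ('a, 'a) mlin) has_derivative (\<lambda>u. shift u (?G x))) (at x)"
      using Ck_has_derivative[OF Suc.prems(2) that] .
    from bounded_linear.has_derivative[OF bounded_linear_mapp[of "[]"] this]
    have "(g has_derivative (\<lambda>u. mapp (?G x) [u])) (at x)" by simp
    moreover have "(F has_derivative (\<lambda>u. shift u (mder F (g x)))) (at (g x))"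
    proof -
      have "g x \<in> T" using that assms(4) by blast
      then show ?thesis by (rule Ck_has_derivative[OF Suc.prems(1)])
    qed
    ultimately have "((\<lambda>x. F (g x)) has_derivative (\<lambda>u. shift (mapp (?G x) [u]) (mder F (g x)))) (at x)"
      by (rule has_derivative_compose)
    then show ?thesis
      by (simp add: has_mder_def B_def shift_unshift[OF l] mapp_unshift(1)[OF l])
  qed
  ultimately show ?case by (intro Ck_SucI[OF assms(1)])
qed

text \<open>The outer function lives on the reals and not on the space of \<open>h\<close>, so
  \<open>Ck_compose\<close> does not cover it. With its derivatives given as a sequence \<theta> and
  the induction general in \<open>i\<close>, the product rule for \<theta>'(h) dh suffices.\<close>

lemma Ck_compose_real:
  fixes \<theta> :: "nat \<Rightarrow> real \<Rightarrow> real" and h :: "'a::real_normed_vector \<Rightarrow> real"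
  assumes "open S" and \<theta>: "\<And>i t. (\<theta> i has_real_derivative \<theta> (Suc i) t) (at t)"
    and "Ck n S (\<lambda>x. mconst (h x))"
  shows "Ck n S (\<lambda>x. mconst (\<theta> i (h x)))"
  using assms(3)
proof (induction n arbitrary: i)
  case 0
  have "continuous_on S (\<lambda>x. mapp (mconst (h x) :: ('a, real) mlin) [])"
    using 0 by (intro bounded_linear.continuous_on[OF bounded_linear_mapp]) auto
  then have "continuous_on S h" by simp
  moreover have "continuous_on UNIV (\<theta> i)"
    by (auto intro!: continuous_at_imp_continuous_on DERIV_isCont[OF \<theta>])
  ultimately have "continuous_on S (\<lambda>x. \<theta> i (h x))" by (intro continuous_on_compose2[of UNIV "\<theta> i" S h]) auto
  then show ?case by (auto intro: bounded_linear.continuous_on[OF bounded_linear_mconst])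
next
  case (Suc n)
  let ?H = "mder (\<lambda>x. mconst (h x) :: ('a, real) mlin)"
  have bb: "bounded_bilinear (\<lambda>(p :: ('a, real) mlin) (q :: ('a, real) mlin). mapp p [] *\<^sub>R q)"
    using bounded_bilinear.comp1[OF bounded_bilinear_scaleR bounded_linear_mapp] .
  have "Ck n S (\<lambda>x. mconst (\<theta> (Suc i) (h x)) :: ('a, real) mlin)"
    by (rule Suc.IH[OF Ck_SucD[OF Suc.prems]])
  from Ck_bilinear[OF assms(1) bb this, of ?H]
  have "Ck n S (\<lambda>x. \<theta> (Suc i) (h x) *\<^sub>R ?H x)" using Suc.prems by simp
  moreover have "has_mder (\<lambda>x. mconst (\<theta> i (h x))) (\<theta> (Suc i) (h x) *\<^sub>R ?H x) x" if "x \<in> S" for x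
  proof -
    have H: "((\<lambda>x. mconst (h x) :: ('a, real) mlin) has_derivative (\<lambda>u. shift u (?H x))) (at x)"
      and H0: "mapp (?H x) [] = 0"
      using Suc.prems that by (auto simp: has_mder_def)
    have "((\<lambda>x. mapp (mconst (h x) :: ('a, real) mlin) vs) has_derivative (\<lambda>u. mapp (shift u (?H x)) vs)) (at x)" for vs
      using bounded_linear.has_derivative[OF bounded_linear_mapp H] .
    note * = this
    have h: "(h has_derivative (\<lambda>u. mapp (?H x) [u])) (at x)"
      using *[of "[]"] by simp
    \<comment> \<open>The map is nonzero only on the empty list, so its derivative is concentrated
      on lists of length 1. The comparison with a multiple of \<open>?H x\<close> has to hold on
      lists of every length.\<close>
    have z': "mapp (?H x) (u # a # vs) = 0" for u a vs
    proof -
      have "((\<lambda>x. 0 :: real) has_derivative (\<lambda>u. mapp (?H x) (u # a # vs))) (at x)"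
        using *[of "a # vs"] by simp
      from has_derivative_unique[OF this has_derivative_const] show ?thesis by (rule fun_cong)
    qed
    have "((\<lambda>x. \<theta> i (h x)) has_derivative (\<lambda>u. mapp (?H x) [u] * \<theta> (Suc i) (h x))) (at x)"
      using has_derivative_compose[OF h \<theta>[of i "h x", unfolded has_field_derivative_def]]
      by (simp add: mult.commute)
    from bounded_linear.has_derivative[OF bounded_linear_mconst this]
    have "((\<lambda>x. mconst (\<theta> i (h x)) :: ('a, real) mlin) has_derivative
        (\<lambda>u. mconst (mapp (?H x) [u] * \<theta> (Suc i) (h x)))) (at x)" .
    moreover have "(mconst (mapp (?H x) [u] * \<theta> (Suc i) (h x)) :: ('a, real) mlin) = shift u (\<theta> (Suc i) (h x) *\<^sub>R ?H x)" for u
      by (rule mlin_eqI, case_tac vs) (auto simp: z')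
    ultimately show ?thesis using H0 by (simp add: has_mder_def)
  qed
  ultimately show ?case by (intro Ck_SucI[OF assms(1)])
qed

section \<open>Equivalence with the given notion of smoothness\<close>

lemma Ck_funpow: "Ck (i + j) S F \<Longrightarrow> Ck j S ((mder ^^ i) F)"
  by (induction i arbitrary: F) (simp_all add: funpow_Suc_right del: funpow.simps(2))

lemma Ck_imp_C_smooth_on:
  assumes "\<And>n. enat n \<le> k \<Longrightarrow> Ck n S (\<lambda>x. mconst (f x))"
  shows "C_smooth_on k S f"
proof -
  define F where "F = (\<lambda>n. (mder ^^ n) (\<lambda>x. mconst (f x)))"
  have F: "Ck j S (F i)" if "enat (i + j) \<le> k" for i j
    unfolding F_def using assms[OF that] by (rule Ck_funpow)
  \<comment> \<open>The order of the derivative is read off from the length of the argument list,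
    which gives one family for all orders.\<close>
  let ?D = "\<lambda>x vs. mapp (F (length vs) x) vs"
  have "?D x [] = f x" for x by (simp add: F_def)
  moreover have "bounded_multilinear n (?D x)" for n x
  proof -
    have "linear (\<lambda>v. ?D x (us @ v # ws))" for us ws
      using linear_mapp[of "F (Suc (length us + length ws)) x" us ws] by simp
    moreover have "\<exists>B. \<forall>vs. length vs = n \<longrightarrow> norm (?D x vs) \<le> B * prod_list (map norm vs)"
      by (intro exI[of _ "norm (F n x)"]) (auto simp: norm_mapp_le)
    ultimately show ?thesis unfolding bounded_multilinear_def by blast
  qed
  moreover have "\<forall>\<^sub>F y in at x within S. \<forall>vs. length vs = n \<longrightarrow>
      norm (?D y vs - ?D x vs) \<le> e * prod_list (map norm vs)"
    if "x \<in> S" "enat n \<le> k" "e > 0" for x n e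
  proof -
    have "continuous_on S (F n)" using F[of n 0] that by simp
    then have "\<forall>\<^sub>F y in at x within S. dist (F n y) (F n x) < e"
      using that by (intro tendstoD) (auto simp: continuous_on_def)
    then show ?thesis
    proof eventually_elim
      case (elim y)
      show ?case
      proof (intro allI impI)
        fix vs :: "'a list" assume "length vs = n"
        then have "norm (?D y vs - ?D x vs) = norm (mapp (F n y - F n x) vs)" by simp
        also have "\<dots> \<le> norm (F n y - F n x) * prod_list (map norm vs)" by (rule norm_mapp_le)
        also have "\<dots> \<le> e * prod_list (map norm vs)"
          using elim by (intro mult_right_mono prod_norm_nonneg) (simp add: dist_norm)
        finally show "norm (?D y vs - ?D x vs) \<le> e * prod_list (map norm vs)" .
      qed
    qed
  qed
  moreover have "\<forall>\<^sub>F y in at x within S. \<forall>vs. length vs = n \<longrightarrow>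
      norm (?D y vs - ?D x vs - ?D x ((y - x) # vs)) \<le> e * norm (y - x) * prod_list (map norm vs)"
    if "x \<in> S" "enat n < k" "e > 0" for x n e
  proof -
    have "Ck (Suc 0) S (F n)" using F[of n "Suc 0"] that by (simp add: Suc_ile_eq)
    from Ck_has_derivative[OF this \<open>x \<in> S\<close>]
    have "(F n has_derivative (\<lambda>u. shift u (F (Suc n) x))) (at x within S)"
      by (simp add: F_def has_derivative_at_withinI)
    then have "\<forall>\<^sub>F y in at x within S. norm (F n y - F n x - shift (y - x) (F (Suc n) x)) \<le> e * norm (y - x)"
      using \<open>e > 0\<close> unfolding has_derivative_within_alt2 by blast
    then show ?thesis
    proof eventually_elim
      case (elim y)
      show ?case
      proof (intro allI impI)
        fix vs :: "'a list" assume "length vs = n"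
        then have "norm (?D y vs - ?D x vs - ?D x ((y - x) # vs))
            = norm (mapp (F n y - F n x - shift (y - x) (F (Suc n) x)) vs)" by simp
        also have "\<dots> \<le> norm (F n y - F n x - shift (y - x) (F (Suc n) x)) * prod_list (map norm vs)"
          by (rule norm_mapp_le)
        also have "\<dots> \<le> e * norm (y - x) * prod_list (map norm vs)"
          using elim by (intro mult_right_mono prod_norm_nonneg) 
        finally show "norm (?D y vs - ?D x vs - ?D x ((y - x) # vs)) \<le> e * norm (y - x) * prod_list (map norm vs)" .
      qed
    qed
  qed
  ultimately show ?thesis unfolding C_smooth_on_def by (intro exI[of _ ?D]) blast
qed

text \<open>\<open>D x\<close> is multilinear and bounded for each admissible length separately, so
  in general it is no element of \<open>mlin\<close>. Cutting it off to lists of length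
  \<open>n\<close> makes it one, and the estimates that are uniform in \<open>vs\<close> become
  estimates of the operator norm.\<close>

lemma C_smooth_on_imp_Ck:
  assumes "open S" "C_smooth_on k S f" "enat n \<le> k"
  shows "Ck n S (\<lambda>x. mconst (f x))"
proof -
  from assms(2)[unfolded C_smooth_on_def] obtain D where D: "\<forall>x\<in>S. D x [] = f x \<and>
      (\<forall>n. enat n \<le> k \<longrightarrow> bounded_multilinear n (D x)) \<and>
      (\<forall>n. enat n \<le> k \<longrightarrow> (\<forall>e>0. \<forall>\<^sub>F y in at x within S. \<forall>vs. length vs = n \<longrightarrow>
         norm (D y vs - D x vs) \<le> e * prod_list (map norm vs))) \<and>
      (\<forall>n. enat n < k \<longrightarrow> (\<forall>e>0. \<forall>\<^sub>F y in at x within S. \<forall>vs. length vs = n \<longrightarrow>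
         norm (D y vs - D x vs - D x ((y - x) # vs)) \<le> e * norm (y - x) * prod_list (map norm vs)))" ..
  then have D0: "\<And>x. x \<in> S \<Longrightarrow> D x [] = f x"
    and Dm: "\<And>x n. x \<in> S \<Longrightarrow> enat n \<le> k \<Longrightarrow> bounded_multilinear n (D x)"
    and Dc: "\<And>x n e. x \<in> S \<Longrightarrow> enat n \<le> k \<Longrightarrow> e > 0 \<Longrightarrow> \<forall>\<^sub>F y in at x within S. \<forall>vs. length vs = n \<longrightarrow>
               norm (D y vs - D x vs) \<le> e * prod_list (map norm vs)"
    and Dd: "\<And>x n e. x \<in> S \<Longrightarrow> enat n < k \<Longrightarrow> e > 0 \<Longrightarrow> \<forall>\<^sub>F y in at x within S. \<forall>vs. length vs = n \<longrightarrow>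
               norm (D y vs - D x vs - D x ((y - x) # vs)) \<le> e * norm (y - x) * prod_list (map norm vs)"
    by (simp_all del: split_paired_All)
  define F where "F = (\<lambda>n x. Mlin (\<lambda>vs. if length vs = n then D x vs else 0))"
  have mF: "mapp (F n x) vs = (if length vs = n then D x vs else 0)" if x: "x \<in> S" "enat n \<le> k" for n x vs
  proof -
    have bm: "bounded_multilinear n (D x)" using Dm x by blast
    then obtain B where B: "\<And>vs. length vs = n \<Longrightarrow> norm (D x vs) \<le> B * prod_list (map norm vs)"
      unfolding bounded_multilinear_def by auto
    have "multilin (\<lambda>vs. if length vs = n then D x vs else 0)"
      unfolding multilin_def
    proof (intro allI)
      fix us ws :: "'a list"
      show "linear (\<lambda>v. if length (us @ v # ws) = n then D x (us @ v # ws) else 0)"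
        using bm by (cases "Suc (length us + length ws) = n") (auto simp: bounded_multilinear_def module_hom_zero)
    qed
    moreover have "norm (if length vs = n then D x vs else 0) \<le> max B 0 * prod_list (map norm vs)" for vs
      using B[of vs] mult_right_mono[OF max.cobounded1[of B 0] prod_norm_nonneg[of vs]]
      by (auto intro!: mult_nonneg_nonneg prod_norm_nonneg)
    ultimately have "mapp (Mlin (\<lambda>vs. if length vs = n then D x vs else 0)) = (\<lambda>vs. if length vs = n then D x vs else 0)"
      by (rule mapp_Mlin)
    then show ?thesis by (simp add: F_def)
  qed
  have "Ck j S (F i)" if "enat (i + j) \<le> k" for i j
    using that
  proof (induction j arbitrary: i)
    case 0
    have "(F i \<longlongrightarrow> F i x) (at x within S)" if x: "x \<in> S" for x
    proof (rule tendstoI)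
      fix e :: real assume "e > 0"
      have i: "enat i \<le> k" using 0 by simp
      have "\<forall>\<^sub>F y in at x within S. \<forall>vs. length vs = i \<longrightarrow> norm (D y vs - D x vs) \<le> (e / 2) * prod_list (map norm vs)"
        using \<open>e > 0\<close> by (intro Dc x i) auto
      moreover have "\<forall>\<^sub>F y in at x within S. y \<in> S" by (simp add: eventually_at_filter)
      ultimately show "\<forall>\<^sub>F y in at x within S. dist (F i y) (F i x) < e"
      proof eventually_elim
        case (elim y)
        have "norm (F i y - F i x) \<le> e / 2"
          by (rule norm_mlin_le)
             (use elim \<open>e > 0\<close> in \<open>auto simp: mF x i intro!: mult_nonneg_nonneg prod_norm_nonneg\<close>)
        then show ?case using \<open>e > 0\<close> by (simp add: dist_norm)
      qed
    qed
    then show ?case by (simp add: continuous_on_def)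
  next
    case (Suc j)
    have i: "enat i \<le> k" "enat (Suc i) \<le> k" "enat i < k"
      using order_trans[OF _ Suc.prems, of "enat (Suc i)"] order_trans[OF _ Suc.prems, of "enat i"]
      by (simp_all add: Suc_ile_eq)
    have "has_mder (F i) (F (Suc i) x) x" if x: "x \<in> S" for x
    proof -
      have "\<forall>\<^sub>F y in at x within S. norm (F i y - F i x - shift (y - x) (F (Suc i) x)) \<le> e * norm (y - x)"
        if "e > 0" for e
      proof -
        have "\<forall>\<^sub>F y in at x within S. y \<in> S" by (simp add: eventually_at_filter)
        with Dd[OF x i(3) that] show ?thesis
        proof eventually_elim
          case (elim y)
          show ?case
            by (rule norm_mlin_le)
               (use elim \<open>e > 0\<close> in \<open>auto simp: mF x i intro!: mult_nonneg_nonneg prod_norm_nonneg\<close>)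
        qed
      qed
      then have "(F i has_derivative (\<lambda>u. shift u (F (Suc i) x))) (at x within S)"
        unfolding has_derivative_within_alt2
        using bounded_bilinear.bounded_linear_left[OF bounded_bilinear_shift] by blast
      then show ?thesis
        using at_within_open[OF x assms(1)] by (simp add: has_mder_def mF x i)
    qed
    moreover have "Ck j S (F (Suc i))" using Suc by simp
    ultimately show ?case by (intro Ck_SucI[OF assms(1)])
  qed
  from this[of 0 n] have "Ck n S (F 0)" using assms(3) by simp
  moreover have "F 0 x = mconst (f x)" if "x \<in> S" for x
    by (rule mlin_eqI) (auto simp: mF[OF that] D0[OF that] zero_enat_def[symmetric])
  ultimately show ?thesis using Ck_cong[OF assms(1), of "F 0" "\<lambda>x. mconst (f x)" n] by simp
qed

section \<open>Calculus of smooth maps\<close>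

lemma C_smooth_on_mono:
  assumes "C_smooth_on k S f" "j \<le> k"
  shows "C_smooth_on j S f"
proof -
  have "enat n \<le> j \<Longrightarrow> enat n \<le> k" "enat n < j \<Longrightarrow> enat n < k" for n
    using assms(2) by (auto intro: order_trans order_less_le_trans)
  with assms(1) show ?thesis
    unfolding C_smooth_on_def
    apply (elim exE)
    subgoal for D by (rule exI[of _ D]) simp
    done
qed

lemma C_smooth_on_subset:
  assumes "open S" "C_smooth_on k S f" "T \<subseteq> S"
  shows "C_smooth_on k T f"
  using C_smooth_on_imp_Ck[OF assms(1,2)] assms(3) by (intro Ck_imp_C_smooth_on) (blast intro: Ck_subset)

lemma C_smooth_on_cong:
  assumes "open S" "C_smooth_on k S f" "\<And>x. x \<in> S \<Longrightarrow> f x = g x"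
  shows "C_smooth_on k S g"
proof (rule Ck_imp_C_smooth_on)
  fix n assume "enat n \<le> k"
  from C_smooth_on_imp_Ck[OF assms(1,2) this] show "Ck n S (\<lambda>x. mconst (g x))"
    using Ck_cong[OF assms(1), of "\<lambda>x. mconst (f x)" "\<lambda>x. mconst (g x)" n] assms(3) by simp
qed

lemma C_smooth_on_local:
  assumes "\<And>x. x \<in> S \<Longrightarrow> \<exists>T. open T \<and> x \<in> T \<and> C_smooth_on k T f"
  shows "C_smooth_on k S f"
proof (rule Ck_imp_C_smooth_on, rule Ck_local)
  fix n x assume n: "enat n \<le> k" and "x \<in> S"
  with assms obtain T where T: "open T" "x \<in> T" "C_smooth_on k T f" by blast
  with C_smooth_on_imp_Ck[OF T(1,3) n]
  show "\<exists>T. open T \<and> x \<in> T \<and> Ck n T (\<lambda>x. mconst (f x))" by (intro exI[of _ T]) simp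
qed

lemma C_smooth_on_const: "C_smooth_on k S (\<lambda>x. a)"
  by (rule Ck_imp_C_smooth_on) (rule Ck_const)

lemma C_smooth_on_add:
  assumes "open S" "C_smooth_on k S f" "C_smooth_on k S g"
  shows "C_smooth_on k S (\<lambda>x. f x + g x)"
proof (rule Ck_imp_C_smooth_on)
  fix n assume n: "enat n \<le> k"
  show "Ck n S (\<lambda>x. mconst (f x + g x))"
    using Ck_add[OF assms(1) C_smooth_on_imp_Ck[OF assms(1,2) n] C_smooth_on_imp_Ck[OF assms(1,3) n]]
    by (simp add: linear_add[OF bounded_linear.linear[OF bounded_linear_mconst]])
qed

lemma C_smooth_on_mult:
  fixes f g :: "'a::real_normed_vector \<Rightarrow> real"
  assumes "open S" "C_smooth_on k S f" "C_smooth_on k S g"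
  shows "C_smooth_on k S (\<lambda>x. f x * g x)"
proof (rule Ck_imp_C_smooth_on)
  fix n assume n: "enat n \<le> k"
  have bb: "bounded_bilinear (\<lambda>(p :: ('a, real) mlin) (q :: ('a, real) mlin). mapp p [] *\<^sub>R q)"
    using bounded_bilinear.comp1[OF bounded_bilinear_scaleR bounded_linear_mapp] .
  have "(mconst (f x * g x) :: ('a, real) mlin) = f x *\<^sub>R mconst (g x)" for x
    by (rule mlin_eqI) simp
  then show "Ck n S (\<lambda>x. mconst (f x * g x))"
    using Ck_bilinear[OF assms(1) bb C_smooth_on_imp_Ck[OF assms(1,2) n] C_smooth_on_imp_Ck[OF assms(1,3) n]]
    by simp
qed

lemma C_smooth_on_compose:
  fixes g :: "'a::real_normed_vector \<Rightarrow> 'a" and f :: "'a \<Rightarrow> 'b::real_normed_vector"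
  assumes "open S" "open T" "C_smooth_on k T f" "C_smooth_on k S g" "g ` S \<subseteq> T"
  shows "C_smooth_on k S (\<lambda>x. f (g x))"
proof (rule Ck_imp_C_smooth_on)
  fix n assume n: "enat n \<le> k"
  show "Ck n S (\<lambda>x. mconst (f (g x)))"
    by (rule Ck_compose[OF assms(1) C_smooth_on_imp_Ck[OF assms(2,3) n] C_smooth_on_imp_Ck[OF assms(1,4) n] assms(5)])
qed

lemma C_smooth_on_compose_real:
  fixes h :: "'a::real_normed_vector \<Rightarrow> real"
  assumes "open S" "\<And>i t. (\<theta> i has_real_derivative \<theta> (Suc i) t) (at t)" "C_smooth_on k S h"
  shows "C_smooth_on k S (\<lambda>x. \<theta> i (h x))"
proof (rule Ck_imp_C_smooth_on)
  fix n assume n: "enat n \<le> k"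
  show "Ck n S (\<lambda>x. mconst (\<theta> i (h x)))"
    by (rule Ck_compose_real[where \<theta> = \<theta>, OF assms(1) _ C_smooth_on_imp_Ck[OF assms(1,3) n]]) (rule assms(2))
qed

lemma C_smooth_on_derivative:
  assumes "open S" "C_smooth_on k S f" "1 \<le> k"
  obtains G where "continuous_on S G" "\<And>x. x \<in> S \<Longrightarrow> (f has_derivative (\<lambda>u. mapp (G x) [u])) (at x)"
proof
  let ?F = "\<lambda>x. mconst (f x)"
  have *: "Ck (Suc 0) S ?F" using C_smooth_on_imp_Ck[OF assms(1,2), of 1] assms(3) by (simp add: one_enat_def)
  then show "continuous_on S (mder ?F)" by simp
  fix x assume "x \<in> S"
  from bounded_linear.has_derivative[OF bounded_linear_mapp[of "[]"] Ck_has_derivative[OF * this]]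
  show "(f has_derivative (\<lambda>u. mapp (mder ?F x) [u])) (at x)" by simp
qed

section \<open>A smooth step function\<close>

text \<open>The classical exp(-1/x), extended by 0, times x^(-m): with the powers included,
  derivatives are linear combinations of members of the family.\<close>

definition flat :: "nat \<Rightarrow> real \<Rightarrow> real" where
  "flat m x = (if x \<le> 0 then 0 else exp (- inverse x) * inverse x ^ m)"

lemma flat_nonneg: "0 \<le> flat m x"
  by (simp add: flat_def)

lemma flat_derivative:
  "(flat m has_real_derivative flat (Suc (Suc m)) x - real m * flat (Suc m) x) (at x)"
proof (cases x "0 :: real" rule: linorder_cases)
  case less
  have "((\<lambda>x. 0 :: real) has_real_derivative 0) (at x)" by simp
  then have "(flat m has_real_derivative 0) (at x)"
    by (rule has_field_derivative_transform_within_open[of _ _ _ "{..<0}"]) (use less in \<open>auto simp: flat_def\<close>)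
  then show ?thesis using less by (simp add: flat_def)
next
  case greater
  have "((\<lambda>x. exp (- inverse x) * inverse x ^ m) has_real_derivative
      exp (- inverse x) * inverse x ^ Suc (Suc m) - real m * (exp (- inverse x) * inverse x ^ Suc m)) (at x)"
  proof -
    have i: "(inverse has_real_derivative - (inverse x ^ 2)) (at x)"
      using DERIV_inverse[of x] greater by (simp add: numeral_2_eq_2)
    have "((\<lambda>x. inverse x ^ m) has_real_derivative - (real m * inverse x ^ Suc m)) (at x)"
      by (rule DERIV_cong[OF DERIV_power[OF i, of m]]) (cases m, simp_all add: power2_eq_square)
    moreover have "((\<lambda>x. exp (- inverse x)) has_real_derivative exp (- inverse x) * inverse x ^ 2) (at x)"
      using DERIV_chain2[OF DERIV_exp DERIV_minus[OF i]] by simp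
    ultimately show ?thesis
      by (rule DERIV_cong[OF DERIV_mult[rotated]]) (simp add: power2_eq_square algebra_simps)
  qed
  then have "(flat m has_real_derivative
      exp (- inverse x) * inverse x ^ Suc (Suc m) - real m * (exp (- inverse x) * inverse x ^ Suc m)) (at x)"
    by (rule has_field_derivative_transform_within_open[of _ _ _ "{0<..}"]) (use greater in \<open>auto simp: flat_def\<close>)
  then show ?thesis using greater by (simp add: flat_def)
next
  \<comment> \<open>At 0 the difference quotient from the right is y^(-m-1) exp(-1/y), and the
    exponential beats every power; from the left it is 0.\<close>
  case equal
  have "((\<lambda>y. inverse y ^ Suc m / exp (inverse y)) \<longlongrightarrow> (0 :: real)) (at_right 0)"
    by (rule filterlim_compose[OF tendsto_power_div_exp_0 filterlim_inverse_at_top_right])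
  then have "((\<lambda>y. flat m y / y) \<longlongrightarrow> 0) (at_right 0)"
    by (rule Lim_transform_eventually)
       (auto simp: eventually_at_filter flat_def exp_minus field_simps intro!: always_eventually)
  moreover have "((\<lambda>y. flat m y / y) \<longlongrightarrow> 0) (at_left 0)"
    by (rule Lim_transform_eventually[OF tendsto_const])
       (auto simp: eventually_at_filter flat_def intro!: always_eventually)
  ultimately have "((\<lambda>y. flat m y / y) \<longlongrightarrow> 0) (at 0)"
    by (simp add: filterlim_at_split)
  then show ?thesis using equal by (simp add: has_field_derivative_iff flat_def)
qed

text \<open>Denominator of the step function \<open>flat 0 x / (flat 0 x + flat 0 (1 - x))\<close>.
  It never vanishes, since \<open>x\<close> or \<open>1 - x\<close> is positive.\<close>

definition step_denom :: "real \<Rightarrow> real" where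
  "step_denom x = flat 0 x + flat 0 (1 - x)"

lemma step_denom_pos: "0 < step_denom x"
  by (cases "0 < x") (auto simp: step_denom_def flat_def add_pos_nonneg add_pos_pos)

text \<open>Closure under differentiation yields all derivatives of the smooth step at once.\<close>

inductive step_algebra :: "(real \<Rightarrow> real) \<Rightarrow> bool" where
  flat: "step_algebra (flat i)"
| reflect: "step_algebra (\<lambda>x. flat i (1 - x))"
| denom: "step_algebra (\<lambda>x. inverse (step_denom x))"
| const: "step_algebra (\<lambda>x. c)"
| add: "step_algebra f \<Longrightarrow> step_algebra g \<Longrightarrow> step_algebra (\<lambda>x. f x + g x)"
| mult: "step_algebra f \<Longrightarrow> step_algebra g \<Longrightarrow> step_algebra (\<lambda>x. f x * g x)"

lemma flat_reflect_derivative: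
  "((\<lambda>x. flat m (1 - x)) has_real_derivative
     - 1 * flat (Suc (Suc m)) (1 - x) + real m * flat (Suc m) (1 - x)) (at x)"
proof -
  have "((\<lambda>x. 1 - x) has_real_derivative - 1) (at x)"
    by (auto intro!: derivative_eq_intros)
  from DERIV_chain2[OF flat_derivative[of m "1 - x"] this] show ?thesis
    by (simp add: algebra_simps)
qed

lemma step_algebra_derivative:
  "step_algebra f \<Longrightarrow> \<exists>f'. step_algebra f' \<and> (\<forall>x. (f has_real_derivative f' x) (at x))"
proof (induction rule: step_algebra.induct)
  case (flat i)
  have "step_algebra (\<lambda>x. flat (Suc (Suc i)) x + (- real i) * flat (Suc i) x)"
    by (intro step_algebra.intros)
  then show ?case using flat_derivative[of i] by (intro exI conjI) auto
next
  case (reflect i)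
  have "step_algebra (\<lambda>x. - 1 * flat (Suc (Suc i)) (1 - x) + real i * flat (Suc i) (1 - x))"
    by (intro step_algebra.intros)
  then show ?case using flat_reflect_derivative[of i] by (intro exI conjI) auto
next
  case denom
  let ?d = "\<lambda>x. flat (Suc (Suc 0)) x + - 1 * flat (Suc (Suc 0)) (1 - x)"
  have "step_algebra (\<lambda>x. - 1 * ?d x * (inverse (step_denom x) * inverse (step_denom x)))"
    by (intro step_algebra.intros)
  moreover have "((\<lambda>x. inverse (step_denom x)) has_real_derivative
      - 1 * ?d x * (inverse (step_denom x) * inverse (step_denom x))) (at x)" for x
  proof -
    have "(step_denom has_real_derivative ?d x) (at x)"
      unfolding step_denom_def using DERIV_add[OF flat_derivative[of 0 x] flat_reflect_derivative[of 0 x]] by simp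
    from DERIV_inverse'[OF this] step_denom_pos[of x] show ?thesis
      by (simp add: algebra_simps)
  qed
  ultimately show ?case by (intro exI conjI) auto
next
  case (const c)
  show ?case by (intro exI[of _ "\<lambda>x. 0"] conjI step_algebra.const) auto
next
  case (add f g)
  then obtain f' g' where "step_algebra f'" "step_algebra g'"
    "\<forall>x. (f has_real_derivative f' x) (at x)" "\<forall>x. (g has_real_derivative g' x) (at x)" by blast
  then show ?case
    by (intro exI[of _ "\<lambda>x. f' x + g' x"]) (auto intro: step_algebra.add DERIV_add)
next
  case (mult f g)
  then obtain f' g' where "step_algebra f'" "step_algebra g'"
    "\<forall>x. (f has_real_derivative f' x) (at x)" "\<forall>x. (g has_real_derivative g' x) (at x)" by blast
  with mult show ?case
    by (intro exI[of _ "\<lambda>x. f' x * g x + g' x * f x"]) (auto intro!: step_algebra.add step_algebra.mult DERIV_mult)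
qed

text \<open>Iterating a choice of derivatives inside \<open>step_algebra\<close> gives the sequence
  \<theta>. The first derivative is bounded on the unit interval by compactness and vanishes off it,
  where the step is locally constant.\<close>

lemma smooth_step:
  obtains \<theta> :: "nat \<Rightarrow> real \<Rightarrow> real" and B
  where "\<And>i t. (\<theta> i has_real_derivative \<theta> (Suc i) t) (at t)"
    "\<And>t. 0 \<le> \<theta> 0 t" "\<And>t. \<theta> 0 t \<le> 1" "\<And>t. t \<le> 0 \<Longrightarrow> \<theta> 0 t = 0" "\<And>t. 1 \<le> t \<Longrightarrow> \<theta> 0 t = 1"
    "\<And>t. \<bar>\<theta> (Suc 0) t\<bar> \<le> B"
proof -
  obtain nx where nx: "\<And>f. step_algebra f \<Longrightarrow> step_algebra (nx f)"
    "\<And>f x. step_algebra f \<Longrightarrow> (f has_real_derivative nx f x) (at x)"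
    using step_algebra_derivative by metis
  define \<theta> where "\<theta> = (\<lambda>i. (nx ^^ i) (\<lambda>x. flat 0 x * inverse (step_denom x)))"
  have alg: "step_algebra (\<theta> i)" for i
    by (induction i) (auto simp: \<theta>_def intro: step_algebra.intros nx)
  have deriv: "(\<theta> i has_real_derivative \<theta> (Suc i) t) (at t)" for i t
    using nx(2)[OF alg[of i]] by (simp add: \<theta>_def)
  have \<theta>0: "\<theta> 0 t = flat 0 t / step_denom t" for t by (simp add: \<theta>_def divide_inverse)
  have lo: "\<theta> 0 t = 0" if "t \<le> 0" for t using that by (simp add: \<theta>0 flat_def)
  have hi: "\<theta> 0 t = 1" if "1 \<le> t" for t using that by (simp add: \<theta>0 flat_def step_denom_def)
  have "continuous_on {0..1} (\<theta> (Suc 0))"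
    by (auto intro!: continuous_at_imp_continuous_on DERIV_isCont[OF deriv])
  then have "bounded (\<theta> (Suc 0) ` {0..1})"
    by (intro compact_imp_bounded compact_continuous_image) auto
  then obtain B where B: "\<forall>t\<in>{0..1}. \<bar>\<theta> (Suc 0) t\<bar> \<le> B"
    unfolding bounded_iff by auto
  have "\<bar>\<theta> (Suc 0) t\<bar> \<le> max B 0" for t
  proof -
    consider "t < 0" | "t \<in> {0..1}" | "t > 1" by fastforce
    then show ?thesis
    proof cases
      case 1
      have "\<theta> (Suc 0) t = 0"
        by (rule DERIV_local_const[OF deriv, of "- t"]) (use 1 in \<open>auto simp: lo abs_if split: if_splits\<close>)
      then show ?thesis by simp
    next
      case 3
      have "\<theta> (Suc 0) t = 0"
        by (rule DERIV_local_const[OF deriv, of "t - 1"]) (use 3 in \<open>auto simp: hi abs_if split: if_splits\<close>)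
      then show ?thesis by simp
    qed (use B in fastforce)
  qed
  moreover have "0 \<le> \<theta> 0 t" "\<theta> 0 t \<le> 1" for t
    using step_denom_pos[of t] flat_nonneg[of 0 t] flat_nonneg[of 0 "1 - t"]
    by (auto simp: \<theta>0 step_denom_def divide_le_eq)
  ultimately show thesis using that[of \<theta> "max B 0"] deriv lo hi by blast
qed

section \<open>Charts and differentials\<close>

declare split_paired_All [simp del] split_paired_Ex [simp del]

text \<open>\<open>m\<close> is the smoothness of the functions to be constructed. It is kept apart
  from the smoothness \<open>l\<close> of the charts, because the model space may allow
  less.\<close>

locale uniform_finsler =
  fixes l m :: enat and K :: real
    and \<A> :: "('m::t2_space, 'x::banach) chart set"
    and N :: "'m \<times> ('m, 'x) tangent \<Rightarrow> real"
  assumes m_ge_1: "1 \<le> m" and m_le: "m \<le> l" and K_ge_1: "1 \<le> K"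
    and uniform: "uniform_finsler_manifold l K \<A> N"
begin

abbreviation T :: "'m \<Rightarrow> ('m, 'x) tangent set" where "T \<equiv> tangent_space \<A>"

lemma l_ge_1: "1 \<le> l"
  using m_ge_1 m_le by (rule order_trans)

lemma atlas: "C_atlas l \<A>"
  using uniform by (simp add: uniform_finsler_manifold_def paracompact_manifold_def)

lemma topological_chartD:
  assumes "c \<in> \<A>"
  shows "open (fst c)" "open (snd c ` fst c)" "inj_on (snd c) (fst c)"
    "continuous_on (fst c) (snd c)" "continuous_on (snd c ` fst c) (chart_inv c)"
proof -
  have "topological_chart c" using atlas assms by (simp add: C_atlas_def)
  then obtain \<psi> where *: "open (fst c)" "open (snd c ` fst c)" "homeomorphism (fst c) (snd c ` fst c) (snd c) \<psi>"
    by (auto simp: topological_chart_def)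
  then show "open (fst c)" "open (snd c ` fst c)" "continuous_on (fst c) (snd c)"
    by (auto simp: homeomorphism_def)
  show inj: "inj_on (snd c) (fst c)"
    by (rule inj_on_inverseI[where g = \<psi>]) (use *(3) in \<open>simp add: homeomorphism_def\<close>)
  have "\<psi> x = chart_inv c x" if "x \<in> snd c ` fst c" for x
    using *(3) that inj by (auto simp: homeomorphism_def chart_inv_def)
  moreover have "continuous_on (snd c ` fst c) \<psi>" using *(3) by (simp add: homeomorphism_def)
  ultimately show "continuous_on (snd c ` fst c) (chart_inv c)"
    by (simp cong: continuous_on_cong)
qed

lemma chart_inv_chart [simp]: "c \<in> \<A> \<Longrightarrow> p \<in> fst c \<Longrightarrow> chart_inv c (snd c p) = p"
  by (simp add: chart_inv_def topological_chartD(3))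

lemma chart_inv_in: "x \<in> snd c ` fst c \<Longrightarrow> chart_inv c x \<in> fst c"
  by (simp add: chart_inv_def inv_into_into)

lemma chart_chart_inv [simp]: "x \<in> snd c ` fst c \<Longrightarrow> snd c (chart_inv c x) = x"
  by (simp add: chart_inv_def f_inv_into_f)

lemma chart_image_Int:
  assumes "c \<in> \<A>"
  shows "snd c ` (fst c \<inter> S) = snd c ` fst c \<inter> chart_inv c -` S"
  using assms by auto

lemma open_chart_image:
  assumes "c \<in> \<A>" "open S"
  shows "open (snd c ` (fst c \<inter> S))"
  unfolding chart_image_Int[OF assms(1)]
  using topological_chartD[OF assms(1)] assms(2) by (intro continuous_open_preimage) auto

lemma charts_atD: "c \<in> charts_at \<A> p \<Longrightarrow> c \<in> \<A>" "c \<in> charts_at \<A> p \<Longrightarrow> p \<in> fst c"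
  by (simp_all add: charts_at_def)

lemma transition_eq: "c \<in> \<A> \<Longrightarrow> p \<in> fst c \<Longrightarrow> transition c d (snd c p) = snd d p"
  by (simp add: transition_def)

lemma transition_smooth:
  assumes "c \<in> \<A>" "d \<in> \<A>"
  shows "C_smooth_on l (snd c ` (fst c \<inter> fst d)) (transition c d)"
  using atlas assms by (simp add: C_atlas_def compatible_charts_def)

lemma open_transition_domain: "c \<in> \<A> \<Longrightarrow> d \<in> \<A> \<Longrightarrow> open (snd c ` (fst c \<inter> fst d))"
  by (simp add: open_chart_image topological_chartD)

section \<open>Tangent vectors in coordinates\<close>

definition dtransition :: "('m, 'x) chart \<Rightarrow> ('m, 'x) chart \<Rightarrow> 'm \<Rightarrow> 'x \<Rightarrow> 'x" where
  "dtransition c d p = frechet_derivative (transition c d) (at (snd c p))"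

lemma transition_has_derivative:
  assumes "c \<in> charts_at \<A> p" "d \<in> charts_at \<A> p"
  shows "(transition c d has_derivative dtransition c d p) (at (snd c p))"
proof -
  note cd = charts_atD[OF assms(1)] charts_atD[OF assms(2)]
  obtain G where "\<And>x. x \<in> snd c ` (fst c \<inter> fst d) \<Longrightarrow>
      (transition c d has_derivative (\<lambda>u. mapp (G x) [u])) (at x)"
    using C_smooth_on_derivative[OF open_transition_domain transition_smooth l_ge_1] cd by metis
  then have "transition c d differentiable at (snd c p)"
    using cd by (auto simp: differentiable_def)
  then show ?thesis by (simp add: dtransition_def frechet_derivative_works)
qed

lemma dtransition_bounded_linear:
  "c \<in> charts_at \<A> p \<Longrightarrow> d \<in> charts_at \<A> p \<Longrightarrow> bounded_linear (dtransition c d p)"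
  using transition_has_derivative has_derivative_bounded_linear by blast

text \<open>Chain rule for e c^(-1) = (e d^(-1)) o (d c^(-1)), valid near \<open>p\<close>. This
  cocycle identity makes the coordinate families that represent tangent vectors consistent.\<close>

lemma dtransition_compose:
  assumes "c \<in> charts_at \<A> p" "d \<in> charts_at \<A> p" "e \<in> charts_at \<A> p"
  shows "dtransition d e p (dtransition c d p w) = dtransition c e p w"
proof -
  note cde = charts_atD[OF assms(1)] charts_atD[OF assms(2)] charts_atD[OF assms(3)]
  have "(transition d e has_derivative dtransition d e p) (at (transition c d (snd c p)))"
    using transition_has_derivative[OF assms(2,3)] cde by (simp add: transition_eq)
  from has_derivative_compose[OF transition_has_derivative[OF assms(1,2)] this]
  have "((\<lambda>x. transition d e (transition c d x)) has_derivative (\<lambda>w. dtransition d e p (dtransition c d p w))) (at (snd c p))" .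
  then have "(transition c e has_derivative (\<lambda>w. dtransition d e p (dtransition c d p w))) (at (snd c p))"
  proof (rule has_derivative_transform_within_open)
    show "open (snd c ` (fst c \<inter> fst d))" "snd c p \<in> snd c ` (fst c \<inter> fst d)"
      using open_transition_domain cde by auto
    show "transition d e (transition c d x) = transition c e x" if "x \<in> snd c ` (fst c \<inter> fst d)" for x
      using that cde by (auto simp: transition_eq)
  qed
  from has_derivative_unique[OF this transition_has_derivative[OF assms(1,3)]]
  show ?thesis by metis
qed

lemma dtransition_self:
  assumes "c \<in> charts_at \<A> p"
  shows "dtransition c c p w = w"
proof -
  note c = charts_atD[OF assms]
  have "((\<lambda>x. x) has_derivative (\<lambda>w. w)) (at (snd c p))" by (rule has_derivative_ident)
  then have "(transition c c has_derivative (\<lambda>w. w)) (at (snd c p))"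
    by (rule has_derivative_transform_within_open[OF _ topological_chartD(2)[OF c(1)]])
       (use c in \<open>auto simp: transition_eq\<close>)
  from has_derivative_unique[OF this transition_has_derivative[OF assms assms]]
  show ?thesis by metis
qed

lemma tangent_space_iff:
  "v \<in> T p \<longleftrightarrow> (\<forall>c. c \<notin> charts_at \<A> p \<longrightarrow> v c = 0) \<and>
     (\<forall>c\<in>charts_at \<A> p. \<forall>d\<in>charts_at \<A> p. v d = dtransition c d p (v c))"
  by (simp add: tangent_space_def dtransition_def)

text \<open>By the cocycle identity, the transformation law from one reference chart to all others
  implies it between any two.\<close>

lemma tangent_spaceI:
  assumes c: "c \<in> charts_at \<A> p" and "\<And>d. d \<notin> charts_at \<A> p \<Longrightarrow> v d = 0"
    and v: "\<And>d. d \<in> charts_at \<A> p \<Longrightarrow> v d = dtransition c d p (v c)"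
  shows "v \<in> T p"
  unfolding tangent_space_iff
proof (intro conjI allI impI ballI)
  fix d e assume d: "d \<in> charts_at \<A> p" and e: "e \<in> charts_at \<A> p"
  have "dtransition d e p (v d) = dtransition d e p (dtransition c d p (v c))" by (simp only: v[OF d])
  also have "\<dots> = dtransition c e p (v c)" by (rule dtransition_compose[OF c d e])
  also have "\<dots> = v e" by (rule v[OF e, symmetric])
  finally show "v e = dtransition d e p (v d)" ..
qed (rule assms(2))

lemma tangent_vector_apply:
  "d \<in> charts_at \<A> p \<Longrightarrow> tangent_vector \<A> c p w d = dtransition c d p w"
  by (simp add: tangent_vector_def dtransition_def)

lemma tangent_vector_self: "c \<in> charts_at \<A> p \<Longrightarrow> tangent_vector \<A> c p w c = w"
  by (simp add: tangent_vector_apply dtransition_self)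

lemma tangent_vector_in: "c \<in> charts_at \<A> p \<Longrightarrow> tangent_vector \<A> c p w \<in> T p"
  by (rule tangent_spaceI) (auto simp: tangent_vector_apply dtransition_self, simp add: tangent_vector_def)

lemma tangent_vector_coord:
  assumes v: "v \<in> T p" and c: "c \<in> charts_at \<A> p"
  shows "tangent_vector \<A> c p (v c) = v"
proof
  fix d
  show "tangent_vector \<A> c p (v c) d = v d"
  proof (cases "d \<in> charts_at \<A> p")
    case True
    then have "v d = dtransition c d p (v c)" using v c unfolding tangent_space_iff by blast
    then show ?thesis using True by (simp only: tangent_vector_apply)
  next
    case False
    then show ?thesis using v unfolding tangent_space_iff by (simp add: tangent_vector_def)
  qed
qed

lemma N_nonneg: "v \<in> T p \<Longrightarrow> 0 \<le> N (p, v)"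
  using uniform by (auto simp: uniform_finsler_manifold_def finsler_P1_def norm_on_tangent_space_def)

text \<open>All metric estimates run through these charts. For a general member of the maximal
  atlas, the constants comparing \<open>N\<close> with the norm may depend on the point.\<close>

definition uniform_charts :: "('m, 'x) chart set" where
  "uniform_charts = {c \<in> \<A>. \<forall>x\<in>fst c. \<forall>v\<in>T x. 1 / K * N (x, v) \<le> norm (v c) \<and> norm (v c) \<le> K * N (x, v)}"

lemma uniform_chart_atlas: "c \<in> uniform_charts \<Longrightarrow> c \<in> \<A>"
  by (simp add: uniform_charts_def)

lemma uniform_chart_upper: "c \<in> uniform_charts \<Longrightarrow> p \<in> fst c \<Longrightarrow> v \<in> T p \<Longrightarrow> norm (v c) \<le> K * N (p, v)"
  by (simp add: uniform_charts_def)

lemma uniform_chart_lower: "c \<in> uniform_charts \<Longrightarrow> p \<in> fst c \<Longrightarrow> v \<in> T p \<Longrightarrow> N (p, v) \<le> K * norm (v c)"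
  using K_ge_1 by (auto simp: uniform_charts_def field_simps)

lemma uniform_chart_cover: "\<exists>c\<in>uniform_charts. p \<in> fst c"
  using uniform by (fastforce simp: uniform_finsler_manifold_def uniform_charts_def charts_at_def)

text \<open>The passage through \<open>N\<close> costs a factor \<open>K\<close> in each of the two
  charts.\<close>

lemma uniform_chart_dtransition_bound:
  assumes "c \<in> uniform_charts" "d \<in> uniform_charts" "p \<in> fst c" "p \<in> fst d"
  shows "norm (dtransition c d p w) \<le> K\<^sup>2 * norm w"
proof -
  have cd: "c \<in> charts_at \<A> p" "d \<in> charts_at \<A> p" using assms uniform_chart_atlas by (auto simp: charts_at_def)
  let ?v = "tangent_vector \<A> c p w"
  have "norm (dtransition c d p w) \<le> K * N (p, ?v)"
    using uniform_chart_upper[OF assms(2,4) tangent_vector_in[OF cd(1)]] cd by (simp add: tangent_vector_apply)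
  also have "\<dots> \<le> K * (K * norm w)"
    using uniform_chart_lower[OF assms(1,3) tangent_vector_in[OF cd(1)]] K_ge_1 cd
    by (intro mult_left_mono) (auto simp: tangent_vector_self)
  finally show ?thesis by (simp add: power2_eq_square mult.assoc)
qed

section \<open>Functions smooth near a point and their differentials\<close>

definition smooth_at :: "'m \<Rightarrow> ('m \<Rightarrow> real) \<Rightarrow> bool" where
  "smooth_at p g \<longleftrightarrow> (\<exists>S. open S \<and> p \<in> S \<and> (\<forall>c\<in>\<A>. C_smooth_on m (snd c ` (fst c \<inter> S)) (g \<circ> chart_inv c)))"

text \<open>\<open>\<delta>\<close> represents \<open>dg(p)\<close>; only its values on tangent vectors at \<open>p\<close> matter.\<close>

definition smooth_differential :: "('m \<Rightarrow> real) \<Rightarrow> 'm \<Rightarrow> (('m, 'x) tangent \<Rightarrow> real) \<Rightarrow> bool" where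
  "smooth_differential g p \<delta> \<longleftrightarrow> smooth_at p g \<and>
     (\<forall>c\<in>charts_at \<A> p. ((g \<circ> chart_inv c) has_derivative (\<lambda>w. \<delta> (tangent_vector \<A> c p w))) (at (snd c p)))"

text \<open>Sums, products and composites all require shrinking to a common neighbourhood. It is
  taken in the manifold, so that one neighbourhood works for all charts.\<close>

lemma smooth_at_combine:
  assumes "smooth_at p g" "smooth_at p h"
    and "\<And>S c. open S \<Longrightarrow> c \<in> \<A> \<Longrightarrow> open (snd c ` (fst c \<inter> S)) \<Longrightarrow>
      C_smooth_on m (snd c ` (fst c \<inter> S)) (g \<circ> chart_inv c) \<Longrightarrow>
      C_smooth_on m (snd c ` (fst c \<inter> S)) (h \<circ> chart_inv c) \<Longrightarrow>
      C_smooth_on m (snd c ` (fst c \<inter> S)) (k \<circ> chart_inv c)"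
  shows "smooth_at p k"
proof -
  from assms(1,2) obtain S S' where S: "open S" "p \<in> S" "open S'" "p \<in> S'"
    and sm: "\<And>c. c \<in> \<A> \<Longrightarrow> C_smooth_on m (snd c ` (fst c \<inter> S)) (g \<circ> chart_inv c)"
      "\<And>c. c \<in> \<A> \<Longrightarrow> C_smooth_on m (snd c ` (fst c \<inter> S')) (h \<circ> chart_inv c)"
    by (auto simp: smooth_at_def)
  have "C_smooth_on m (snd c ` (fst c \<inter> (S \<inter> S'))) (k \<circ> chart_inv c)" if c: "c \<in> \<A>" for c
  proof (rule assms(3)[OF _ c])
    show "open (S \<inter> S')" using S by auto
    then show "open (snd c ` (fst c \<inter> (S \<inter> S')))" by (rule open_chart_image[OF c])
    show "C_smooth_on m (snd c ` (fst c \<inter> (S \<inter> S'))) (g \<circ> chart_inv c)"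
      by (rule C_smooth_on_subset[OF open_chart_image[OF c S(1)] sm(1)[OF c]]) auto
    show "C_smooth_on m (snd c ` (fst c \<inter> (S \<inter> S'))) (h \<circ> chart_inv c)"
      by (rule C_smooth_on_subset[OF open_chart_image[OF c S(3)] sm(2)[OF c]]) auto
  qed
  then show ?thesis unfolding smooth_at_def using S by (intro exI[of _ "S \<inter> S'"]) auto
qed

lemma smooth_differential_has_derivative:
  "smooth_differential g p \<delta> \<Longrightarrow> c \<in> charts_at \<A> p \<Longrightarrow>
     ((\<lambda>x. g (chart_inv c x)) has_derivative (\<lambda>w. \<delta> (tangent_vector \<A> c p w))) (at (snd c p))"
  by (simp add: smooth_differential_def comp_def)

lemma smooth_differential_const: "smooth_differential (\<lambda>_. a) p (\<lambda>_. 0)"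
  unfolding smooth_differential_def smooth_at_def comp_def
  by (auto intro!: exI[of _ UNIV] C_smooth_on_const)

lemma smooth_differential_add:
  assumes "smooth_differential g p \<delta>" "smooth_differential h p \<eta>"
  shows "smooth_differential (\<lambda>x. g x + h x) p (\<lambda>v. \<delta> v + \<eta> v)"
proof -
  have "smooth_at p (\<lambda>x. g x + h x)"
    by (rule smooth_at_combine[of _ g h]) (use assms in \<open>auto simp: smooth_differential_def comp_def intro!: C_smooth_on_add\<close>)
  moreover have "(((\<lambda>x. g x + h x) \<circ> chart_inv c) has_derivative
      (\<lambda>w. \<delta> (tangent_vector \<A> c p w) + \<eta> (tangent_vector \<A> c p w))) (at (snd c p))"
    if "c \<in> charts_at \<A> p" for c
    using has_derivative_add[OF smooth_differential_has_derivative[OF assms(1) that] smooth_differential_has_derivative[OF assms(2) that]]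
    by (simp add: comp_def)
  ultimately show ?thesis by (simp add: smooth_differential_def)
qed

lemma smooth_differential_mult:
  assumes "smooth_differential g p \<delta>" "smooth_differential h p \<eta>"
  shows "smooth_differential (\<lambda>x. g x * h x) p (\<lambda>v. g p * \<eta> v + \<delta> v * h p)"
proof -
  have "smooth_at p (\<lambda>x. g x * h x)"
    by (rule smooth_at_combine[of _ g h]) (use assms in \<open>auto simp: smooth_differential_def comp_def intro!: C_smooth_on_mult\<close>)
  moreover have "(((\<lambda>x. g x * h x) \<circ> chart_inv c) has_derivative
      (\<lambda>w. g p * \<eta> (tangent_vector \<A> c p w) + \<delta> (tangent_vector \<A> c p w) * h p)) (at (snd c p))"
    if "c \<in> charts_at \<A> p" for c
    using has_derivative_mult[OF smooth_differential_has_derivative[OF assms(1) that] smooth_differential_has_derivative[OF assms(2) that]]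
    by (simp add: comp_def charts_atD[OF that])
  ultimately show ?thesis by (simp add: smooth_differential_def)
qed

lemma smooth_differential_sum:
  assumes "\<And>i. i \<in> I \<Longrightarrow> smooth_differential (g i) p (\<delta> i)" "finite I"
  shows "smooth_differential (\<lambda>x. \<Sum>i\<in>I. g i x) p (\<lambda>v. \<Sum>i\<in>I. \<delta> i v)"
  using assms(2,1) by (induction I) (auto intro: smooth_differential_const smooth_differential_add)

lemma smooth_differential_compose_real:
  assumes \<theta>: "\<And>i t. (\<theta> i has_real_derivative \<theta> (Suc i) t) (at t)" and g: "smooth_differential g p \<delta>"
  shows "smooth_differential (\<lambda>x. \<theta> i (g x)) p (\<lambda>v. \<theta> (Suc i) (g p) * \<delta> v)"
proof -
  have "smooth_at p (\<lambda>x. \<theta> i (g x))"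
  proof (rule smooth_at_combine[of _ g g])
    fix S c
    assume "open (snd c ` (fst c \<inter> S))" "C_smooth_on m (snd c ` (fst c \<inter> S)) (g \<circ> chart_inv c)"
    from C_smooth_on_compose_real[where \<theta> = \<theta> and i = i, OF this(1) \<theta> this(2)]
    show "C_smooth_on m (snd c ` (fst c \<inter> S)) ((\<lambda>x. \<theta> i (g x)) \<circ> chart_inv c)" by (simp add: comp_def)
  qed (use g in \<open>auto simp: smooth_differential_def\<close>)
  moreover have "(((\<lambda>x. \<theta> i (g x)) \<circ> chart_inv c) has_derivative
      (\<lambda>w. \<theta> (Suc i) (g p) * \<delta> (tangent_vector \<A> c p w))) (at (snd c p))"
    if "c \<in> charts_at \<A> p" for c
  proof -
    have "((g \<circ> chart_inv c) has_derivative (\<lambda>w. \<delta> (tangent_vector \<A> c p w))) (at (snd c p))"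
      using g that by (simp add: smooth_differential_def)
    from has_derivative_compose[OF this \<theta>[of i, unfolded has_field_derivative_def]] that
    show ?thesis by (simp add: comp_def charts_at_def)
  qed
  ultimately show ?thesis by (simp add: smooth_differential_def)
qed

lemma smooth_differential_cong:
  assumes "smooth_differential g p \<delta>" "open S" "p \<in> S" "\<And>q. q \<in> S \<Longrightarrow> g q = h q"
  shows "smooth_differential h p \<delta>"
proof -
  obtain S' where S': "open S'" "p \<in> S'"
    and sm: "\<And>c. c \<in> \<A> \<Longrightarrow> C_smooth_on m (snd c ` (fst c \<inter> S')) (g \<circ> chart_inv c)"
    using assms(1) by (auto simp: smooth_differential_def smooth_at_def)
  have o: "open (S \<inter> S')" using assms S' by auto
  have eq: "(g \<circ> chart_inv c) x = (h \<circ> chart_inv c) x" if "c \<in> \<A>" "x \<in> snd c ` (fst c \<inter> (S \<inter> S'))" for c x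
    using that assms(4) by auto
  have "smooth_at p h"
    unfolding smooth_at_def
  proof (intro exI[of _ "S \<inter> S'"] conjI ballI)
    fix c assume c: "c \<in> \<A>"
    have "C_smooth_on m (snd c ` (fst c \<inter> (S \<inter> S'))) (g \<circ> chart_inv c)"
      by (rule C_smooth_on_subset[OF open_chart_image[OF c S'(1)] sm[OF c]]) auto
    then show "C_smooth_on m (snd c ` (fst c \<inter> (S \<inter> S'))) (h \<circ> chart_inv c)"
      by (rule C_smooth_on_cong[OF open_chart_image[OF c o]]) (rule eq[OF c])
  qed (use o assms S' in auto)
  moreover have "((h \<circ> chart_inv c) has_derivative (\<lambda>w. \<delta> (tangent_vector \<A> c p w))) (at (snd c p))"
    if c: "c \<in> charts_at \<A> p" for c
  proof -
    have "((g \<circ> chart_inv c) has_derivative (\<lambda>w. \<delta> (tangent_vector \<A> c p w))) (at (snd c p))"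
      using assms(1) c by (simp add: smooth_differential_def)
    then show ?thesis
      by (rule has_derivative_transform_within_open[OF _ open_chart_image[OF charts_atD(1)[OF c] o]])
         (use c assms S' eq in \<open>auto simp: charts_at_def\<close>)
  qed
  ultimately show ?thesis by (simp add: smooth_differential_def)
qed

text \<open>In a chart \<open>d\<close> the function is \<open>h\<close> after a transition map of
  class C^l; here m \<le> l enters. The differential is \<open>D (v c)\<close>, because the
  transition derivative turns the \<open>d\<close>-coordinate of \<open>v\<close> into its
  \<open>c\<close>-coordinate.\<close>

lemma smooth_differential_chart:
  assumes h: "C_smooth_on m UNIV h" and D: "(h has_derivative D) (at (snd c p))" and c: "c \<in> \<A>" "p \<in> fst c"
  shows "smooth_differential (\<lambda>q. h (snd c q)) p (\<lambda>v. D (v c))"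
proof -
  have cp: "c \<in> charts_at \<A> p" using c by (simp add: charts_at_def)
  have eq: "((\<lambda>q. h (snd c q)) \<circ> chart_inv d) = (\<lambda>x. h (transition d c x))" for d
    by (simp add: fun_eq_iff transition_def)
  have "C_smooth_on m (snd d ` (fst d \<inter> fst c)) (\<lambda>x. h (transition d c x))" if d: "d \<in> \<A>" for d
    by (rule C_smooth_on_compose[OF open_transition_domain[OF d c(1)] open_UNIV h
          C_smooth_on_mono[OF transition_smooth[OF d c(1)] m_le]]) simp
  then have "smooth_at p (\<lambda>q. h (snd c q))"
    unfolding smooth_at_def eq using topological_chartD(1)[OF c(1)] c(2) by blast
  moreover have "((\<lambda>x. h (transition d c x)) has_derivative (\<lambda>w. D (tangent_vector \<A> d p w c))) (at (snd d p))"
    if d: "d \<in> charts_at \<A> p" for d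
    using has_derivative_compose[OF transition_has_derivative[OF d cp], of h D] D d
    by (simp add: transition_eq charts_atD tangent_vector_apply cp)
  ultimately show ?thesis by (simp add: smooth_differential_def eq)
qed

lemma C_smooth_mapI:
  assumes "\<And>p. smooth_at p g"
  shows "C_smooth_map m \<A> g"
  unfolding C_smooth_map_def
proof
  fix c assume c: "c \<in> \<A>"
  show "C_smooth_on m (snd c ` fst c) (g \<circ> chart_inv c)"
  proof (rule C_smooth_on_local)
    fix x assume "x \<in> snd c ` fst c"
    then obtain p where p: "p \<in> fst c" "x = snd c p" by auto
    from assms[of p] obtain S where "open S" "p \<in> S" "C_smooth_on m (snd c ` (fst c \<inter> S)) (g \<circ> chart_inv c)"
      using c by (auto simp: smooth_at_def)
    then show "\<exists>T. open T \<and> x \<in> T \<and> C_smooth_on m T (g \<circ> chart_inv c)"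
      using open_chart_image[OF c, of S] p by blast
  qed
qed

lemma charts_at_nonempty: "\<exists>c. c \<in> charts_at \<A> p"
  using atlas unfolding C_atlas_def charts_at_def by blast

text \<open>The chart picked by \<open>SOME\<close> is immaterial: in every chart around
  \<open>p\<close> the coordinate derivative, applied to the coordinate of \<open>v\<close>, gives
  \<open>\<delta> v\<close>.\<close>

lemma differential_eq:
  assumes "smooth_differential g p \<delta>" "v \<in> T p"
  shows "differential \<A> g p v = \<delta> v"
proof -
  define c where "c = (SOME c. c \<in> charts_at \<A> p)"
  have c: "c \<in> charts_at \<A> p" unfolding c_def using charts_at_nonempty by (rule someI_ex)
  then have "((g \<circ> chart_inv c) has_derivative (\<lambda>w. \<delta> (tangent_vector \<A> c p w))) (at (snd c p))"
    using assms(1) by (simp add: smooth_differential_def)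
  then have "frechet_derivative (g \<circ> chart_inv c) (at (snd c p)) = (\<lambda>w. \<delta> (tangent_vector \<A> c p w))"
    by (rule frechet_derivative_at[symmetric])
  then show ?thesis
    by (simp only: differential_def c_def[symmetric] Let_def tangent_vector_coord[OF assms(2) c])
qed

text \<open>A substitute for bounds on \<open>differential_norm\<close> that is easier to handle: it
  bundles smoothness near \<open>p\<close> with the estimate, and depends only on \<open>g\<close>
  near \<open>p\<close>, so it can be verified piece by piece.\<close>

definition differential_le :: "('m \<Rightarrow> real) \<Rightarrow> 'm \<Rightarrow> real \<Rightarrow> bool" where
  "differential_le g p b \<longleftrightarrow> (\<exists>\<delta>. smooth_differential g p \<delta> \<and> (\<forall>v\<in>T p. \<bar>\<delta> v\<bar> \<le> b * N (p, v)))"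

lemma differential_le_differential_norm:
  assumes "differential_le g p b" "0 \<le> b"
  shows "differential_norm \<A> N g p \<le> ereal b"
proof -
  obtain \<delta> where \<delta>: "smooth_differential g p \<delta>" "\<And>v. v \<in> T p \<Longrightarrow> \<bar>\<delta> v\<bar> \<le> b * N (p, v)"
    using assms(1) by (auto simp: differential_le_def)
  show ?thesis
    unfolding differential_norm_def
  proof (rule Sup_least, clarify)
    fix v assume v: "v \<in> T p" "N (p, v) \<le> 1"
    have "\<bar>\<delta> v\<bar> \<le> b * N (p, v)" using \<delta> v by blast
    also have "\<dots> \<le> b * 1" using v assms(2) by (intro mult_left_mono) auto
    finally show "ereal \<bar>differential \<A> g p v\<bar> \<le> ereal b" by (simp add: differential_eq[OF \<delta>(1) v(1)])
  qed
qed

section \<open>Paths and Lipschitz constants\<close>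

text \<open>The tangent topology is final for the maps \<open>bundle_param\<close>, hence continuity
  of \<open>N\<close> pulls back to joint continuity in the coordinates of point and vector.
  Nonnegativity of \<open>N\<close> makes the restricted codomain harmless.\<close>

lemma continuous_on_N_bundle_param:
  assumes c: "c \<in> \<A>"
  shows "continuous_on (snd c ` fst c \<times> UNIV) (\<lambda>z. N (bundle_param \<A> c z))"
proof -
  let ?B = "snd c ` fst c \<times> (UNIV :: 'x set)"
  have param_in: "bundle_param \<A> d z \<in> tangent_bundle \<A>" if "d \<in> \<A>" "z \<in> snd d ` fst d \<times> UNIV" for d z
    using that by (auto simp: bundle_param_def tangent_bundle_def charts_at_def intro!: tangent_vector_in)
  \<comment> \<open>The carrier of a topology is its largest open set; as the whole bundle is open,
    it is the carrier.\<close>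
  have "openin (tangent_topology \<A>) (tangent_bundle \<A>)"
    unfolding openin_tangent_topology
  proof (intro conjI ballI)
    fix d assume d: "d \<in> \<A>"
    have "(snd d ` fst d \<times> UNIV) \<inter> bundle_param \<A> d -` tangent_bundle \<A> = snd d ` fst d \<times> UNIV"
      using param_in[OF d] by blast
    then show "open ((snd d ` fst d \<times> UNIV) \<inter> bundle_param \<A> d -` tangent_bundle \<A>)"
      using topological_chartD(2)[OF d] by (simp add: open_Times)
  qed simp
  then have top: "topspace (tangent_topology \<A>) = tangent_bundle \<A>"
    using openin_tangent_topology openin_topspace by (metis openin_subset subset_antisym)
  have cont: "continuous_map (tangent_topology \<A>) (top_of_set {0..}) N"
    using uniform by (simp add: uniform_finsler_manifold_def)
  show ?thesis
    unfolding continuous_on_open_vimage[OF open_Times[OF topological_chartD(2)[OF c] open_UNIV]]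
  proof (intro allI impI)
    fix V :: "real set" assume V: "open V"
    let ?W = "{z \<in> tangent_bundle \<A>. N z \<in> {0..} \<inter> V}"
    have "openin (top_of_set {0..}) ({0..} \<inter> V)" using V by (rule openin_open_Int)
    then have "openin (tangent_topology \<A>) ?W"
      using cont unfolding continuous_map_def top by blast
    then have "open (?B \<inter> bundle_param \<A> c -` ?W)"
      using c unfolding openin_tangent_topology by blast
    moreover have "?B \<inter> bundle_param \<A> c -` ?W = (\<lambda>z. N (bundle_param \<A> c z)) -` V \<inter> ?B"
    proof -
      have "0 \<le> N (bundle_param \<A> c z)" if "z \<in> ?B" for z
        using param_in[OF c that] N_nonneg by (auto simp: tangent_bundle_def)
      then show ?thesis using param_in[OF c] by auto
    qed
    ultimately show "open ((\<lambda>z. N (bundle_param \<A> c z)) -` V \<inter> ?B)" by simp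
  qed
qed

lemma bundle_param_coord:
  assumes "c \<in> charts_at \<A> p" "v \<in> T p"
  shows "bundle_param \<A> c (snd c p, v c) = (p, v)"
  using assms by (simp add: bundle_param_def charts_atD tangent_vector_coord)

lemma velocity_has_vector_derivative:
  assumes "a < b" "C1_path_on \<A> {a..b} \<gamma>" "t \<in> {a..b}" "c \<in> charts_at \<A> (\<gamma> t)"
  shows "((snd c \<circ> \<gamma>) has_vector_derivative velocity \<A> a b \<gamma> t c) (at t within {a..b})"
proof -
  note c = charts_atD[OF assms(4)]
  obtain \<delta> where "((snd c \<circ> \<gamma>) has_vector_derivative \<delta>) (at t within {a..b})"
    using assms(2,3) c unfolding C1_path_on_def by (metis IntI vimageI)
  moreover from this have "velocity \<A> a b \<gamma> t c = \<delta>"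
    using assms vector_derivative_within_cbox[of a b t "snd c \<circ> \<gamma>" \<delta>] by (simp add: velocity_def)
  ultimately show ?thesis by simp
qed

lemma path_near:
  assumes "continuous_on {a..b} \<gamma>" "t \<in> {a..b}" "open S" "\<gamma> t \<in> S"
  shows "\<forall>\<^sub>F s in at t within {a..b}. \<gamma> s \<in> S"
  using assms topological_tendstoD[of \<gamma> "\<gamma> t" "at t within {a..b}" S] by (simp add: continuous_on_def)

text \<open>Near \<open>t\<close> the path stays in the domain of \<open>c\<close>, so its
  \<open>d\<close>-coordinates are the transition map applied to its \<open>c\<close>-coordinates,
  and the chain rule is the transformation law.\<close>

lemma velocity_in:
  fixes \<gamma> :: "real \<Rightarrow> 'm"
  assumes "a < b" "C1_path_on \<A> {a..b} \<gamma>" "t \<in> {a..b}"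
  shows "velocity \<A> a b \<gamma> t \<in> T (\<gamma> t)"
proof -
  let ?v = "velocity \<A> a b \<gamma> t"
  obtain c where c: "c \<in> charts_at \<A> (\<gamma> t)" using charts_at_nonempty by blast
  show ?thesis
  proof (rule tangent_spaceI[OF c])
    fix d assume d: "d \<in> charts_at \<A> (\<gamma> t)"
    note cd = charts_atD[OF c] charts_atD[OF d]
    have "(transition c d has_derivative dtransition c d (\<gamma> t)) (at ((snd c \<circ> \<gamma>) t))"
      using transition_has_derivative[OF c d] by simp
    from has_derivative_compose[OF velocity_has_vector_derivative[OF assms c, unfolded has_vector_derivative_def] this]
    have "((\<lambda>s. transition c d ((snd c \<circ> \<gamma>) s)) has_derivative (\<lambda>s. dtransition c d (\<gamma> t) (s *\<^sub>R ?v c))) (at t within {a..b})" .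
    then have "((snd d \<circ> \<gamma>) has_derivative (\<lambda>s. dtransition c d (\<gamma> t) (s *\<^sub>R ?v c))) (at t within {a..b})"
    proof (rule has_derivative_transform_eventually)
      have "\<forall>\<^sub>F s in at t within {a..b}. \<gamma> s \<in> fst c"
        using assms cd topological_chartD(1) by (intro path_near) (auto simp: C1_path_on_def)
      then show "\<forall>\<^sub>F s in at t within {a..b}. transition c d ((snd c \<circ> \<gamma>) s) = (snd d \<circ> \<gamma>) s"
        by eventually_elim (simp add: transition_eq cd)
    qed (use assms cd in \<open>auto simp: transition_eq\<close>)
    then have "((snd d \<circ> \<gamma>) has_vector_derivative dtransition c d (\<gamma> t) (?v c)) (at t within {a..b})"
      using linear_scale[OF bounded_linear.linear[OF dtransition_bounded_linear[OF c d]]]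
      by (simp add: has_vector_derivative_def)
    then show "?v d = dtransition c d (\<gamma> t) (?v c)"
      using vector_derivative_unique_within_closed_interval[OF assms(1), of t "snd d \<circ> \<gamma>"]
        velocity_has_vector_derivative[OF assms d] assms(3) by simp
  qed (simp add: velocity_def)
qed

text \<open>Locally the speed is \<open>N\<close> in bundle coordinates, evaluated at the position
  and at the continuous derivative furnished by \<open>C1_path_on\<close>. The integrability of the
  speed on each piece of a path comes from here.\<close>

lemma continuous_on_speed:
  fixes \<gamma> :: "real \<Rightarrow> 'm"
  assumes "a < b" "C1_path_on \<A> {a..b} \<gamma>"
  shows "continuous_on {a..b} (\<lambda>t. N (\<gamma> t, velocity \<A> a b \<gamma> t))"
  unfolding continuous_on_eq_continuous_within
proof
  fix t assume t: "t \<in> {a..b}"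
  obtain c where c: "c \<in> charts_at \<A> (\<gamma> t)" using charts_at_nonempty by blast
  note cA = charts_atD[OF c]
  let ?J = "{a..b} \<inter> \<gamma> -` fst c" and ?w = "velocity \<A> a b \<gamma>"
  have cont: "continuous_on {a..b} \<gamma>" using assms(2) by (simp add: C1_path_on_def)
  obtain \<delta> where \<delta>: "continuous_on ?J \<delta>"
    "\<And>s. s \<in> ?J \<Longrightarrow> ((snd c \<circ> \<gamma>) has_vector_derivative \<delta> s) (at s within {a..b})"
    using assms(2) cA unfolding C1_path_on_def by blast
  have w: "?w s c = \<delta> s" if "s \<in> ?J" for s
    using vector_derivative_unique_within_closed_interval[OF assms(1), of s "snd c \<circ> \<gamma>"]
      velocity_has_vector_derivative[OF assms, of s c] \<delta>(2)[OF that] that cA by (simp add: charts_at_def)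
  have "continuous_on ?J (\<lambda>s. N (bundle_param \<A> c (snd c (\<gamma> s), \<delta> s)))"
  proof (rule continuous_on_compose2[OF continuous_on_N_bundle_param[OF cA(1)]])
    show "continuous_on ?J (\<lambda>s. (snd c (\<gamma> s), \<delta> s))"
      using cont by (intro continuous_on_Pair \<delta> continuous_on_compose2[OF topological_chartD(4)[OF cA(1)]])
        (auto intro: continuous_on_subset)
  qed auto
  moreover have "N (bundle_param \<A> c (snd c (\<gamma> s), \<delta> s)) = N (\<gamma> s, ?w s)" if "s \<in> ?J" for s
    using that bundle_param_coord[of c "\<gamma> s" "?w s"] velocity_in[OF assms, of s] w[OF that] cA
    by (simp add: charts_at_def)
  ultimately have J: "continuous_on ?J (\<lambda>s. N (\<gamma> s, ?w s))"
    by (rule continuous_on_eq)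
  obtain A where A: "open A" "A \<inter> {a..b} = \<gamma> -` fst c \<inter> {a..b}"
    using cont topological_chartD(1)[OF cA(1)] unfolding continuous_on_open_invariant by blast
  \<comment> \<open>\<open>?J\<close> is a relative neighbourhood of \<open>t\<close> in the
    interval.\<close>
  have "at t within {a..b} = at t within ?J"
  proof (rule at_within_nhd[OF _ A(1)])
    show "t \<in> A" "{a..b} \<inter> A - {t} = ?J \<inter> A - {t}" using A(2) t cA by blast+
  qed
  then show "continuous (at t within {a..b}) (\<lambda>s. N (\<gamma> s, ?w s))"
    using J t cA by (simp add: continuous_on_eq_continuous_within)
qed

lemma at_within_Icc_interior: "a < t \<Longrightarrow> t < b \<Longrightarrow> at t within {a..b} = at (t :: real)"
  by (rule at_within_interior) simp

text \<open>Mean value inequality: the derivative of \<open>g\<close> along the path is at most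
  \<open>C\<close> times the speed, which is the derivative of \<open>C\<close> times the length
  covered so far.\<close>

lemma C1_path_growth:
  fixes \<gamma> :: "real \<Rightarrow> 'm"
  assumes "a < b" "C1_path_on \<A> {a..b} \<gamma>" and g: "\<And>p. differential_le g p C" and "0 \<le> C"
  shows "\<bar>g (\<gamma> b) - g (\<gamma> a)\<bar> \<le> C * integral {a..b} (\<lambda>t. N (\<gamma> t, velocity \<A> a b \<gamma> t))"
proof -
  let ?n = "\<lambda>t. N (\<gamma> t, velocity \<A> a b \<gamma> t)"
  have "\<exists>\<delta>. smooth_differential g p \<delta> \<and> (\<forall>v\<in>T p. \<bar>\<delta> v\<bar> \<le> C * N (p, v))" for p
    using g[of p] by (simp add: differential_le_def)
  then obtain \<delta> where \<delta>: "\<And>p. smooth_differential g p (\<delta> p)" "\<And>p v. v \<in> T p \<Longrightarrow> \<bar>\<delta> p v\<bar> \<le> C * N (p, v)"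
    by metis
  have deriv: "((\<lambda>t. g (\<gamma> t)) has_vector_derivative \<delta> (\<gamma> t) (velocity \<A> a b \<gamma> t)) (at t within {a..b})"
    if t: "t \<in> {a..b}" for t
  proof -
    obtain c where c: "c \<in> charts_at \<A> (\<gamma> t)" using charts_at_nonempty by blast
    note cA = charts_atD[OF c]
    let ?v = "velocity \<A> a b \<gamma> t" and ?\<delta> = "\<lambda>w. \<delta> (\<gamma> t) (tangent_vector \<A> c (\<gamma> t) w)"
    have d: "((\<lambda>x. g (chart_inv c x)) has_derivative ?\<delta>) (at ((snd c \<circ> \<gamma>) t))"
      using smooth_differential_has_derivative[OF \<delta>(1) c] by simp
    from has_derivative_compose[OF velocity_has_vector_derivative[OF assms(1,2) t c, unfolded has_vector_derivative_def] d]
    have "((\<lambda>s. g (chart_inv c ((snd c \<circ> \<gamma>) s))) has_derivative (\<lambda>s. ?\<delta> (s *\<^sub>R ?v c))) (at t within {a..b})" .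
    then have "((\<lambda>s. g (\<gamma> s)) has_derivative (\<lambda>s. ?\<delta> (s *\<^sub>R ?v c))) (at t within {a..b})"
    proof (rule has_derivative_transform_eventually)
      have "\<forall>\<^sub>F s in at t within {a..b}. \<gamma> s \<in> fst c"
        using assms cA t topological_chartD(1) by (intro path_near) (auto simp: C1_path_on_def)
      then show "\<forall>\<^sub>F s in at t within {a..b}. g (chart_inv c ((snd c \<circ> \<gamma>) s)) = g (\<gamma> s)"
        by eventually_elim (simp add: cA)
    qed (use t cA in auto)
    moreover have "?\<delta> (s *\<^sub>R ?v c) = s *\<^sub>R \<delta> (\<gamma> t) ?v" for s
      using linear_scale[OF bounded_linear.linear[OF has_derivative_bounded_linear[OF d]], of s "?v c"]
        tangent_vector_coord[OF velocity_in[OF assms(1,2) t] c] by simp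
    ultimately show ?thesis by (simp add: has_vector_derivative_def)
  qed
  have cont: "continuous_on {a..b} ?n" by (rule continuous_on_speed[OF assms(1,2)])
  let ?\<phi> = "\<lambda>u. C * integral {a..u} ?n"
  have \<phi>: "(?\<phi> has_vector_derivative C * ?n t) (at t within {a..b})" if "t \<in> {a..b}" for t
    using has_vector_derivative_mult_right[OF integral_has_vector_derivative[OF cont that]] .
  have "norm (g (\<gamma> b) - g (\<gamma> a)) \<le> ?\<phi> b - ?\<phi> a"
  proof (rule differentiable_bound_general[OF assms(1)])
    show "continuous_on {a..b} (\<lambda>t. g (\<gamma> t))" "continuous_on {a..b} ?\<phi>"
      unfolding continuous_on_eq_continuous_within
      by (intro ballI has_vector_derivative_continuous[OF deriv] has_vector_derivative_continuous[OF \<phi>], assumption)+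
    fix t assume t: "a < t" "t < b"
    show "((\<lambda>t. g (\<gamma> t)) has_vector_derivative \<delta> (\<gamma> t) (velocity \<A> a b \<gamma> t)) (at t)"
      "(?\<phi> has_vector_derivative C * ?n t) (at t)"
      using deriv[of t] \<phi>[of t] t by (simp_all add: at_within_Icc_interior)
    show "norm (\<delta> (\<gamma> t) (velocity \<A> a b \<gamma> t)) \<le> C * ?n t"
      using \<delta>(2)[OF velocity_in[OF assms(1,2), of t]] t by simp
  qed
  then show ?thesis by simp
qed

text \<open>Both claims come from one induction over the pieces, since the sign of the length, too,
  is obtained by splitting the integral at the break points.\<close>

lemma piecewise_C1_path_growth:
  fixes \<gamma> :: "real \<Rightarrow> 'm"
  assumes "piecewise_C1_path \<A> a b \<gamma>" and g: "\<And>p. differential_le g p C" and "0 \<le> C"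
  shows "0 \<le> path_length_finsler \<A> N a b \<gamma>"
    and "\<bar>g (\<gamma> b) - g (\<gamma> a)\<bar> \<le> C * path_length_finsler \<A> N a b \<gamma>"
proof -
  let ?n = "\<lambda>t. N (\<gamma> t, velocity \<A> a b \<gamma> t)"
  from assms(1) obtain k s where s: "s 0 = a" "s k = b"
    and lt: "\<And>i. i < k \<Longrightarrow> s i < s (Suc i)" and C1: "\<And>i. i < k \<Longrightarrow> C1_path_on \<A> {s i..s (Suc i)} \<gamma>"
    by (auto simp: piecewise_C1_path_def)
  have upper: "s i \<le> b" if "i \<le> k" for i
    using that by (induction i rule: inc_induct) (use lt s in \<open>auto intro: less_imp_le order_trans\<close>)
  have "\<exists>I. (?n has_integral I) {a..s i} \<and> 0 \<le> I \<and> \<bar>g (\<gamma> (s i)) - g (\<gamma> a)\<bar> \<le> C * I \<and> a \<le> s i" if "i \<le> k" for i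
    using that
  proof (induction i)
    case 0
    show ?case using has_integral_refl(2)[of ?n a] s by (intro exI[of _ 0]) auto
  next
    case (Suc i)
    then obtain I where I: "(?n has_integral I) {a..s i}" "0 \<le> I" "\<bar>g (\<gamma> (s i)) - g (\<gamma> a)\<bar> \<le> C * I" "a \<le> s i"
      by auto
    have i: "i < k" using Suc by simp
    let ?m = "\<lambda>t. N (\<gamma> t, velocity \<A> (s i) (s (Suc i)) \<gamma> t)"
    let ?I = "integral {s i..s (Suc i)} ?m"
    have "(?m has_integral ?I) {s i..s (Suc i)}"
      using continuous_on_speed[OF lt[OF i] C1[OF i]] integrable_continuous_interval by blast
    then have "(?n has_integral ?I) {s i..s (Suc i)}"
    \<comment> \<open>At interior points of a piece, derivatives within the piece and within the
      whole interval are both two-sided. The two velocities can differ only at the two ends of the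
      piece.\<close>
    proof (rule has_integral_spike_finite[rotated 2, of _ _ _ "{s i, s (Suc i)}"])
      fix t assume "t \<in> {s i..s (Suc i)} - {s i, s (Suc i)}"
      then have t: "s i < t" "t < s (Suc i)" by auto
      have "a < t" "t < b" using t I(4) upper[of "Suc i"] i by auto
      then show "?n t = ?m t"
        using at_within_Icc_interior[of a t b] at_within_Icc_interior[OF t] by (simp add: velocity_def cong: if_cong)
    qed simp
    with I(1) have "(?n has_integral (I + ?I)) {a..s (Suc i)}"
      using I(4) lt[OF i] by (intro has_integral_combine[of a "s i" "s (Suc i)"]) auto
    moreover have "0 \<le> ?I"
      using velocity_in[OF lt[OF i] C1[OF i]] by (intro integral_nonneg integrable_continuous_interval
          continuous_on_speed[OF lt[OF i] C1[OF i]] N_nonneg)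
    moreover have "\<bar>g (\<gamma> (s (Suc i))) - g (\<gamma> a)\<bar> \<le> C * (I + ?I)"
      using I(3) C1_path_growth[OF lt[OF i] C1[OF i] g \<open>0 \<le> C\<close>] by (simp add: distrib_left)
    ultimately show ?case using I lt[OF i] by (intro exI[of _ "I + ?I"]) auto
  qed
  from this[of k] obtain I where I: "(?n has_integral I) {a..b}" "0 \<le> I" "\<bar>g (\<gamma> b) - g (\<gamma> a)\<bar> \<le> C * I"
    using s by auto
  then have "path_length_finsler \<A> N a b \<gamma> = I"
    by (simp add: path_length_finsler_def integral_unique)
  with I show "0 \<le> path_length_finsler \<A> N a b \<gamma>"
    "\<bar>g (\<gamma> b) - g (\<gamma> a)\<bar> \<le> C * path_length_finsler \<A> N a b \<gamma>" by auto
qed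

lemma differential_le_const: "0 \<le> b \<Longrightarrow> differential_le (\<lambda>_. a) p b"
  unfolding differential_le_def using smooth_differential_const N_nonneg by (intro exI[of _ "\<lambda>_. 0"]) auto

lemma finsler_dist_nonneg: "0 \<le> finsler_dist \<A> N p q"
  unfolding finsler_dist_def
proof (rule Inf_greatest, clarify)
  fix a b \<gamma> assume "piecewise_C1_path \<A> a b \<gamma>"
  then show "0 \<le> ereal (path_length_finsler \<A> N a b \<gamma>)"
    \<comment> \<open>A constant function has differential bound 0 and so gives access to the sign
      of the length.\<close>
    using piecewise_C1_path_growth(1)[OF _ differential_le_const[of 0 0]] by simp
qed

section \<open>Differential bounds, Lipschitz constants and chart distances\<close>

lemma finsler_lipschitz_constI:
  assumes g: "\<And>p. differential_le g p C" and C: "0 \<le> C"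
  shows "finsler_lipschitz_const \<A> N C g"
  unfolding finsler_lipschitz_const_def
proof (intro conjI allI impI C)
  fix p q assume fin: "finsler_dist \<A> N p q < \<infinity>"
  define d where "d = real_of_ereal (finsler_dist \<A> N p q)"
  have d: "finsler_dist \<A> N p q = ereal d" "0 \<le> d"
    using fin finsler_dist_nonneg[of p q] by (cases "finsler_dist \<A> N p q"; simp add: d_def)+
  have "\<bar>g p - g q\<bar> \<le> C * d + e" if "e > 0" for e
  proof -
    \<comment> \<open>The denominator \<open>C + 1\<close> also covers C = 0.\<close>
    have pos: "0 < e / (C + 1)" using that C by simp
    then have "finsler_dist \<A> N p q < ereal (d + e / (C + 1))" using d by simp
    then obtain a b \<gamma> where \<gamma>: "piecewise_C1_path \<A> a b \<gamma>" "\<gamma> a = p" "\<gamma> b = q"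
      and len: "path_length_finsler \<A> N a b \<gamma> < d + e / (C + 1)"
      unfolding finsler_dist_def Inf_less_iff by auto
    have "\<bar>g p - g q\<bar> \<le> C * path_length_finsler \<A> N a b \<gamma>"
      using piecewise_C1_path_growth(2)[OF \<gamma>(1) g C] \<gamma> by (simp add: abs_minus_commute)
    also have "\<dots> \<le> C * (d + e / (C + 1))" using len C by (intro mult_left_mono) auto
    also have "\<dots> \<le> C * d + e" using that C by (simp add: field_simps)
    finally show ?thesis .
  qed
  then show "\<bar>g p - g q\<bar> \<le> C * real_of_ereal (finsler_dist \<A> N p q)"
    unfolding d_def by (rule field_le_epsilon)
qed

lemma finsler_LipI:
  assumes "\<And>p. differential_le g p C" "0 \<le> C"
  shows "finsler_lipschitz \<A> N g" "finsler_Lip \<A> N g \<le> C"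
proof -
  note * = finsler_lipschitz_constI[OF assms]
  then show "finsler_lipschitz \<A> N g" by (auto simp: finsler_lipschitz_def)
  show "finsler_Lip \<A> N g \<le> C"
    unfolding finsler_Lip_def
    by (rule cInf_lower) (use * in \<open>auto simp: finsler_lipschitz_const_def intro!: bdd_belowI[of _ 0]\<close>)
qed


text \<open>The ball keeps the segment inside the chart. In another chart \<open>d\<close> its
  velocity is the continuous derivative of the transition map, applied to the constant vector
  \<open>u\<close>.\<close>

lemma straight_path:
  assumes c: "c \<in> \<A>" and B: "ball (snd c p) r \<subseteq> snd c ` fst c" "p \<in> fst c"
    and q: "q \<in> fst c" "dist (snd c p) (snd c q) < r"
    and u_def: "u = snd c q - snd c p" and \<gamma>_def: "\<gamma> = (\<lambda>t. chart_inv c (snd c p + t *\<^sub>R u))"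
  shows "C1_path_on \<A> {0..1} \<gamma>" "\<gamma> 0 = p" "\<gamma> 1 = q"
    "t \<in> {0..1} \<Longrightarrow> \<gamma> t \<in> fst c" "t \<in> {0..1} \<Longrightarrow> velocity \<A> 0 1 \<gamma> t c = u"
proof -
  let ?x = "\<lambda>t. snd c p + t *\<^sub>R u"
  have x: "?x t \<in> snd c ` fst c" if "t \<in> {0..1}" for t
  proof -
    have "norm (t *\<^sub>R u) \<le> norm u" using mult_right_mono[of t 1 "norm u"] that by simp
    also have "\<dots> < r" using q by (simp add: u_def dist_norm norm_minus_commute)
    finally have "?x t \<in> ball (snd c p) r" by (simp add: dist_norm)
    then show ?thesis using B by blast
  qed
  then show in_c: "\<gamma> t \<in> fst c" if "t \<in> {0..1}" for t
    unfolding \<gamma>_def using that by (intro chart_inv_in x)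
  show \<gamma>01: "\<gamma> 0 = p" "\<gamma> 1 = q" using c B q by (simp_all add: \<gamma>_def u_def)
  have coord: "snd c (\<gamma> t) = ?x t" if "t \<in> {0..1}" for t
    using x[OF that] by (simp add: \<gamma>_def)
  have cont: "continuous_on {0..1} \<gamma>"
    unfolding \<gamma>_def using x
    by (intro continuous_on_compose2[OF topological_chartD(5)[OF c]]) (auto intro!: continuous_intros)
  have "\<exists>\<delta>. continuous_on ({0..1} \<inter> \<gamma> -` fst d) \<delta> \<and>
      (\<forall>t\<in>{0..1} \<inter> \<gamma> -` fst d. ((snd d \<circ> \<gamma>) has_vector_derivative \<delta> t) (at t within {0..1}))"
    if d: "d \<in> \<A>" for d
  proof -
    let ?S = "snd c ` (fst c \<inter> fst d)" and ?J = "{0..1} \<inter> \<gamma> -` fst d"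
    obtain G where G: "continuous_on ?S G"
      "\<And>x. x \<in> ?S \<Longrightarrow> (transition c d has_derivative (\<lambda>u. mapp (G x) [u])) (at x)"
      using C_smooth_on_derivative[OF open_transition_domain[OF c d] transition_smooth[OF c d] l_ge_1] by metis
    have xS: "?x t \<in> ?S" if "t \<in> ?J" for t
      using that in_c[of t] coord[of t] by (metis IntE IntI image_eqI vimageE)
    have "continuous_on ?J (\<lambda>t. G (?x t))"
      using xS by (intro continuous_on_compose2[OF G(1)]) (auto intro!: continuous_intros)
    then have "continuous_on ?J (\<lambda>t. mapp (G (?x t)) [u])"
      by (rule bounded_linear.continuous_on[OF bounded_linear_mapp])
    moreover have "((snd d \<circ> \<gamma>) has_vector_derivative mapp (G (?x t)) [u]) (at t within {0..1})" if t: "t \<in> ?J" for t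
    proof -
      have "(?x has_derivative (\<lambda>s. s *\<^sub>R u)) (at t within {0..1})"
        by (auto intro!: derivative_eq_intros)
      from has_derivative_compose[OF this G(2)[OF xS[OF t]]]
      have "((\<lambda>t. transition c d (?x t)) has_derivative (\<lambda>s. mapp (G (?x t)) [s *\<^sub>R u])) (at t within {0..1})" .
      then have "((snd d \<circ> \<gamma>) has_derivative (\<lambda>s. mapp (G (?x t)) [s *\<^sub>R u])) (at t within {0..1})"
        by (rule has_derivative_transform[rotated 2])
           (use t in \<open>auto simp: transition_def \<gamma>_def\<close>)
      then show ?thesis
        using linear_scale[OF linear_mapp[of "G (?x t)" "[]" "[]"]] by (simp add: has_vector_derivative_def)
    qed
    ultimately show ?thesis by blast
  qed
  then show C1: "C1_path_on \<A> {0..1} \<gamma>" using cont by (simp add: C1_path_on_def)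
  show "velocity \<A> 0 1 \<gamma> t c = u" if t: "t \<in> {0..1}"
  proof -
    have "(?x has_derivative (\<lambda>s. s *\<^sub>R u)) (at t within {0..1})"
      by (auto intro!: derivative_eq_intros)
    then have "((snd c \<circ> \<gamma>) has_derivative (\<lambda>s. s *\<^sub>R u)) (at t within {0..1})"
      by (rule has_derivative_transform[rotated 2]) (use t coord in auto)
    then have "((snd c \<circ> \<gamma>) has_vector_derivative u) (at t within {0..1})"
      by (simp add: has_vector_derivative_def)
    moreover have "((snd c \<circ> \<gamma>) has_vector_derivative velocity \<A> 0 1 \<gamma> t c) (at t within {0..1})"
      by (rule velocity_has_vector_derivative[OF _ C1 t]) (use in_c[OF t] c in \<open>auto simp: charts_at_def\<close>)
    ultimately show ?thesis
      using vector_derivative_unique_within_closed_interval[of 0 1 t "snd c \<circ> \<gamma>"] t by simp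
  qed
qed

text \<open>The segment from \<open>p\<close> to \<open>q\<close> has constant coordinate velocity,
  hence speed at most \<open>K * norm u\<close> in a uniform chart.\<close>

lemma finsler_dist_le_chart:
  assumes c: "c \<in> uniform_charts" and B: "ball (snd c p) r \<subseteq> snd c ` fst c" "p \<in> fst c"
    and q: "q \<in> fst c" "dist (snd c p) (snd c q) < r"
  shows "finsler_dist \<A> N p q \<le> ereal (K * dist (snd c p) (snd c q))"
proof -
  define u where "u = snd c q - snd c p"
  define \<gamma> where "\<gamma> = (\<lambda>t. chart_inv c (snd c p + t *\<^sub>R u))"
  note \<gamma> = straight_path[OF uniform_chart_atlas[OF c] B q u_def \<gamma>_def]
  let ?n = "\<lambda>t. N (\<gamma> t, velocity \<A> 0 1 \<gamma> t)"
  have "?n t \<le> K * norm u" if t: "t \<in> {0..1}" for t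
    using uniform_chart_lower[OF c \<gamma>(4)[OF t] velocity_in[OF zero_less_one \<gamma>(1) t]] \<gamma>(5)[OF t] by simp
  then have "integral {0..1} ?n \<le> integral {0..1} (\<lambda>t :: real. K * norm u)"
    by (intro integral_le integrable_continuous_interval continuous_on_speed[OF zero_less_one \<gamma>(1)]) auto
  then have len: "path_length_finsler \<A> N 0 1 \<gamma> \<le> K * dist (snd c p) (snd c q)"
    by (simp add: path_length_finsler_def u_def dist_norm norm_minus_commute)
  have "piecewise_C1_path \<A> 0 1 \<gamma>"
    unfolding piecewise_C1_path_def
    by (intro conjI exI[of _ "Suc 0"] exI[of _ "\<lambda>i. real i"]) (use \<gamma>(1) in auto)
  then have "finsler_dist \<A> N p q \<le> ereal (path_length_finsler \<A> N 0 1 \<gamma>)"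
    unfolding finsler_dist_def using \<gamma>(2,3) by (intro Inf_lower) blast
  also have "\<dots> \<le> ereal (K * dist (snd c p) (snd c q))" using len by simp
  finally show ?thesis .
qed

text \<open>
  This pointwise condition passes to suprema of locally finite families, and on chart balls it still
  implies a Lipschitz estimate with the same constant.
\<close>

definition calm :: "real \<Rightarrow> ('m \<Rightarrow> real) \<Rightarrow> bool" where
  "calm a u \<longleftrightarrow> (\<forall>c\<in>uniform_charts. \<forall>p\<in>fst c. \<forall>\<^sub>F q in nhds p. \<bar>u q - u p\<bar> \<le> a * dist (snd c q) (snd c p))"

lemma chart_ball:
  assumes "c \<in> \<A>" "p \<in> fst c"
  obtains r where "0 < r" "ball (snd c p) r \<subseteq> snd c ` fst c"
  using topological_chartD(2)[OF assms(1)] assms(2) openE[of "snd c ` fst c" "snd c p"] by blast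

lemma eventually_chart_dist:
  assumes "c \<in> \<A>" "p \<in> fst c" "0 < e"
  shows "\<forall>\<^sub>F q in nhds p. q \<in> fst c \<and> dist (snd c q) (snd c p) < e"
proof -
  have "open (fst c \<inter> snd c -` ball (snd c p) e)"
    by (rule continuous_open_preimage[OF topological_chartD(4,1)[OF assms(1)]]) simp
  then have "\<forall>\<^sub>F q in nhds p. q \<in> fst c \<inter> snd c -` ball (snd c p) e"
    using assms by (intro eventually_nhds_in_open) auto
  then show ?thesis by eventually_elim (auto simp: dist_commute)
qed

text \<open>Close to \<open>p\<close>, segments show that the Finsler distance is finite and at most
  \<open>K\<close> times the chart distance. This is the first of the two factors
  \<open>K\<close>.\<close>

lemma finsler_lipschitz_const_calm:
  assumes f: "finsler_lipschitz_const \<A> N L f"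
  shows "calm (L * K) f"
  unfolding calm_def
proof (intro ballI)
  fix c p assume c: "c \<in> uniform_charts" and p: "p \<in> fst c"
  obtain r where r: "0 < r" "ball (snd c p) r \<subseteq> snd c ` fst c"
    using chart_ball[OF uniform_chart_atlas[OF c] p] .
  have L: "0 \<le> L" using f by (simp add: finsler_lipschitz_const_def)
  from eventually_chart_dist[OF uniform_chart_atlas[OF c] p r(1)]
  show "\<forall>\<^sub>F q in nhds p. \<bar>f q - f p\<bar> \<le> L * K * dist (snd c q) (snd c p)"
  proof eventually_elim
    case (elim q)
    let ?d = "finsler_dist \<A> N p q"
    have d: "?d \<le> ereal (K * dist (snd c p) (snd c q))"
      using elim by (intro finsler_dist_le_chart[OF c r(2) p]) (auto simp: dist_commute)
    then have fin: "?d < \<infinity>" by (rule le_less_trans) simp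
    with d finsler_dist_nonneg[of p q] have "real_of_ereal ?d \<le> K * dist (snd c p) (snd c q)"
      by (cases ?d) auto
    then have "L * real_of_ereal ?d \<le> L * (K * dist (snd c p) (snd c q))" by (rule mult_left_mono[OF _ L])
    moreover have "\<bar>f p - f q\<bar> \<le> L * real_of_ereal ?d" using f fin by (simp add: finsler_lipschitz_const_def)
    ultimately show ?case by (simp add: abs_minus_commute dist_commute mult.assoc)
  qed
qed

lemma finsler_lipschitz_const_Lip:
  assumes "finsler_lipschitz \<A> N f"
  shows "finsler_lipschitz_const \<A> N (finsler_Lip \<A> N f) f"
proof -
  let ?S = "{L. finsler_lipschitz_const \<A> N L f}"
  have ne: "?S \<noteq> {}" using assms by (auto simp: finsler_lipschitz_def)
  have "0 \<le> Inf ?S" by (rule cInf_greatest[OF ne]) (simp add: finsler_lipschitz_const_def)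
  moreover have "\<bar>f p - f q\<bar> \<le> Inf ?S * real_of_ereal (finsler_dist \<A> N p q)"
    if fin: "finsler_dist \<A> N p q < \<infinity>" for p q
  \<comment> \<open>At distance 0 any Lipschitz constant forces f p = f q; otherwise one divides by
    the distance.\<close>
  proof (cases "real_of_ereal (finsler_dist \<A> N p q) = 0")
    case True
    obtain L where "finsler_lipschitz_const \<A> N L f" using ne by auto
    then have "\<bar>f p - f q\<bar> \<le> L * real_of_ereal (finsler_dist \<A> N p q)"
      using fin by (simp add: finsler_lipschitz_const_def)
    then show ?thesis using True by simp
  next
    case False
    let ?d = "real_of_ereal (finsler_dist \<A> N p q)"
    have d: "0 < ?d" using False finsler_dist_nonneg[of p q] by (simp add: less_le real_of_ereal_pos)
    have "\<bar>f p - f q\<bar> / ?d \<le> Inf ?S"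
      by (rule cInf_greatest[OF ne]) (use d fin in \<open>auto simp: finsler_lipschitz_const_def divide_le_eq\<close>)
    then show ?thesis using d by (simp add: divide_le_eq)
  qed
  ultimately show ?thesis by (simp add: finsler_lipschitz_const_def finsler_Lip_def)
qed

lemma calm_continuous:
  assumes "calm a u"
  shows "continuous_on UNIV u"
proof (rule continuous_at_imp_continuous_on, rule ballI)
  fix p
  obtain c where c: "c \<in> uniform_charts" "p \<in> fst c" using uniform_chart_cover by blast
  have "(u \<longlongrightarrow> u p) (nhds p)"
  proof (rule tendstoI)
    fix e :: real assume "0 < e"
    \<comment> \<open>\<open>\<bar>a\<bar> + 1\<close> is positive whatever the sign of
      \<open>a\<close>.\<close>
    then have "0 < e / (\<bar>a\<bar> + 1)" by simp
    from eventually_chart_dist[OF uniform_chart_atlas[OF c(1)] c(2) this]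
    have "\<forall>\<^sub>F q in nhds p. dist (snd c q) (snd c p) < e / (\<bar>a\<bar> + 1)" by (rule eventually_mono) simp
    moreover have "\<forall>\<^sub>F q in nhds p. \<bar>u q - u p\<bar> \<le> a * dist (snd c q) (snd c p)"
      using assms c by (simp add: calm_def)
    ultimately show "\<forall>\<^sub>F q in nhds p. dist (u q) (u p) < e"
    proof eventually_elim
      case (elim q)
      have "a * dist (snd c q) (snd c p) \<le> \<bar>a\<bar> * dist (snd c q) (snd c p)"
        by (intro mult_right_mono) auto
      also have "\<dots> \<le> \<bar>a\<bar> * (e / (\<bar>a\<bar> + 1))" using elim by (intro mult_left_mono) auto
      also have "\<dots> < e" using \<open>0 < e\<close> by (simp add: field_simps)
      finally show ?case using elim by (simp add: dist_real_def)
    qed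
  qed
  then have "(u \<longlongrightarrow> u p) (at p)" by (rule tendsto_mono[rotated]) (simp add: at_within_def)
  then show "isCont u p" by (simp add: isCont_def)
qed

end

section \<open>Local approximation\<close>

text \<open>McShane's extension: the lower envelope of the upward cones of slope \<open>L\<close>
  over the graph of \<open>u\<close>. It keeps the constant, so passing from a ball to the whole
  model space costs no factor.\<close>

lemma lipschitz_extension:
  fixes u :: "'a::metric_space \<Rightarrow> real"
  assumes u: "L-lipschitz_on S u" and "S \<noteq> {}"
  obtains F where "L-lipschitz_on UNIV F" "\<And>x. x \<in> S \<Longrightarrow> F x = u x"
proof -
  have L: "0 \<le> L" using u by (rule lipschitz_on_nonneg)
  define F where "F x = (INF y\<in>S. u y + L * dist x y)" for x
  have lower: "u z - L * dist x z \<le> u y + L * dist x y" if "y \<in> S" "z \<in> S" for x y z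
  proof -
    have "u z - u y \<le> L * dist z y" using lipschitz_onD[OF u that(2,1)] by (simp add: dist_real_def)
    also have "\<dots> \<le> L * (dist x z + dist x y)"
      using L dist_triangle[of z y x] by (intro mult_left_mono) (auto simp: dist_commute)
    finally show ?thesis by (simp add: distrib_left)
  qed
  have bdd: "bdd_below ((\<lambda>y. u y + L * dist x y) ` S)" for x
  proof -
    obtain z where "z \<in> S" using assms(2) by auto
    then show ?thesis using lower[of _ z x] by (intro bdd_belowI2[of _ "u z - L * dist x z"]) auto
  qed
  have le: "F x \<le> F x' + L * dist x x'" for x x'
  proof -
    have "F x - L * dist x x' \<le> F x'"
      unfolding F_def[of x']
    proof (rule cINF_greatest[OF assms(2)])
      fix y assume y: "y \<in> S"
      have "F x \<le> u y + L * dist x y" unfolding F_def by (rule cINF_lower[OF bdd y])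
      also have "\<dots> \<le> u y + L * (dist x x' + dist x' y)"
        using L dist_triangle[of x y x'] by (intro add_left_mono mult_left_mono) auto
      finally show "F x - L * dist x x' \<le> u y + L * dist x' y" by (simp add: distrib_left)
    qed
    then show ?thesis by simp
  qed
  show thesis
  proof
    show "L-lipschitz_on UNIV F"
    proof (rule lipschitz_onI[OF _ L])
      fix x y show "dist (F x) (F y) \<le> L * dist x y"
        using le[of x y] le[of y x] by (simp add: dist_real_def dist_commute abs_le_iff)
    qed
    show "F x = u x" if "x \<in> S" for x
    proof (rule antisym)
      show "F x \<le> u x" unfolding F_def using cINF_lower[OF bdd that, of x] by simp
      show "u x \<le> F x"
        unfolding F_def by (rule cINF_greatest[OF assms(2)]) (use lower[OF _ that, of _ x] in simp)
    qed
  qed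
qed

text \<open>Dividing by the distance shows that the infimum defining \<open>Lip\<close> is attained.
  This turns the bound on \<open>Lip h\<close> in \<open>property_star\<close> into an estimate for
  \<open>h\<close>.\<close>

lemma lipschitz_on_Lip:
  fixes h :: "'a::metric_space \<Rightarrow> 'b::metric_space"
  assumes "L-lipschitz_on UNIV h"
  shows "(Lip h)-lipschitz_on UNIV h" "Lip h \<le> L"
proof -
  let ?S = "{L. L-lipschitz_on UNIV h}"
  have ne: "?S \<noteq> {}" using assms by auto
  show "Lip h \<le> L"
    unfolding Lip_def by (rule cInf_lower) (use assms lipschitz_on_nonneg in \<open>auto intro!: bdd_belowI[of _ 0]\<close>)
  show "(Lip h)-lipschitz_on UNIV h"
  proof (rule lipschitz_onI)
    show "0 \<le> Lip h"
      unfolding Lip_def by (rule cInf_greatest[OF ne]) (use lipschitz_on_nonneg in auto)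
    fix x y
    show "dist (h x) (h y) \<le> Lip h * dist x y"
    proof (cases "x = y")
      case False
      have "dist (h x) (h y) / dist x y \<le> Lip h"
        unfolding Lip_def
        by (rule cInf_greatest[OF ne]) (use False lipschitz_onD in \<open>fastforce simp: divide_le_eq\<close>)
      then show ?thesis using False by (simp add: divide_le_eq)
    qed simp
  qed
qed

lemma property_star_approx:
  fixes F :: "'x::banach \<Rightarrow> real"
  assumes "property_star TYPE('x) k C0" "L-lipschitz_on UNIV F" "0 < e"
  obtains h :: "'x \<Rightarrow> real" where "C_smooth_on k UNIV h" "\<And>x. \<bar>F x - h x\<bar> < e" "(C0 * L)-lipschitz_on UNIV h"
proof -
  have C0: "1 \<le> C0" using assms(1) by (simp add: property_star_def)
  from assms obtain h M where h: "M-lipschitz_on UNIV h" "C_smooth_on k UNIV h" "\<forall>x. \<bar>F x - h x\<bar> < e"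
    "Lip h \<le> C0 * Lip F"
    unfolding property_star_def by blast
  have "C0 * Lip F \<le> C0 * L" using lipschitz_on_Lip(2)[OF assms(2)] C0 by (intro mult_left_mono) auto
  with h(4) have "Lip h \<le> C0 * L" by linarith
  then have "(C0 * L)-lipschitz_on UNIV h"
    using lipschitz_on_Lip(1)[OF h(1)] by (rule lipschitz_on_mono[rotated 2]) simp
  with h that show thesis by blast
qed

lemma lipschitz_derivative_bound:
  fixes h :: "'a::real_normed_vector \<Rightarrow> 'b::real_normed_vector"
  assumes D: "(h has_derivative D) (at x)" and h: "L-lipschitz_on UNIV h"
  shows "norm (D v) \<le> L * norm v"
proof (rule field_le_epsilon)
  fix e :: real assume "0 < e"
  define e' where "e' = e / (norm v + 1)"
  have e': "0 < e'" using \<open>0 < e\<close> by (simp add: e'_def add_nonneg_pos)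
  then obtain d where d: "0 < d" "\<And>y. norm (y - x) < d \<Longrightarrow> norm (h y - h x - D (y - x)) \<le> e' * norm (y - x)"
    using D unfolding has_derivative_at_alt by blast
  \<comment> \<open>Small enough for \<open>t *\<^sub>R v\<close> to lie where the linear
    approximation is valid; the summand 1 covers v = 0.\<close>
  define t where "t = d / (2 * (norm v + 1))"
  have t: "0 < t" using d by (simp add: t_def add_nonneg_pos)
  have "norm (t *\<^sub>R v) < d"
  proof -
    have "norm (t *\<^sub>R v) = t * norm v" using t by simp
    also have "\<dots> = d * (norm v / (2 * (norm v + 1)))" by (simp add: t_def)
    also have "\<dots> < d * 1" using d(1) by (intro mult_strict_left_mono) (simp_all add: divide_less_eq add_nonneg_pos)
    finally show ?thesis by simp
  qed
  then have "norm (h (x + t *\<^sub>R v) - h x - D (t *\<^sub>R v)) \<le> e' * norm (t *\<^sub>R v)"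
    using d(2)[of "x + t *\<^sub>R v"] by simp
  moreover have "norm (h (x + t *\<^sub>R v) - h x) \<le> L * norm (t *\<^sub>R v)"
    using lipschitz_onD[OF h, of "x + t *\<^sub>R v" x] by (simp add: dist_norm)
  ultimately have "norm (D (t *\<^sub>R v)) \<le> (L + e') * norm (t *\<^sub>R v)"
    using norm_triangle_ineq4[of "h (x + t *\<^sub>R v) - h x" "h (x + t *\<^sub>R v) - h x - D (t *\<^sub>R v)"]
    by (simp add: distrib_right)
  moreover have "D (t *\<^sub>R v) = t *\<^sub>R D v"
    using linear_scale[OF bounded_linear.linear[OF has_derivative_bounded_linear[OF D]]] .
  ultimately have "t * norm (D v) \<le> t * ((L + e') * norm v)" using t by (simp add: mult_ac)
  then have "norm (D v) \<le> (L + e') * norm v" using t by simp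
  also have "e' * norm v \<le> e" using \<open>0 < e\<close> by (simp add: e'_def divide_le_eq add_nonneg_pos)
  then have "(L + e') * norm v \<le> L * norm v + e" by (simp add: distrib_right)
  finally show "norm (D v) \<le> L * norm v + e" .
qed

text \<open>Suprema are nonexpansive for the uniform distance, which is how calmness passes to
  functions built as suprema.\<close>

lemma cSUP_diff_le:
  fixes f g :: "'i \<Rightarrow> real"
  assumes "\<And>i. \<bar>f i - g i\<bar> \<le> e" "bdd_above (range f)" "bdd_above (range g)"
  shows "\<bar>(SUP i. f i) - (SUP i. g i)\<bar> \<le> e"
proof -
  have "(SUP i. f i) \<le> (SUP i. g i) + e"
  proof (rule cSUP_least)
    fix i
    have "g i \<le> (SUP i. g i)" by (rule cSUP_upper[OF UNIV_I assms(3)])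
    then show "f i \<le> (SUP i. g i) + e" using assms(1)[of i] by linarith
  qed simp
  moreover have "(SUP i. g i) \<le> (SUP i. f i) + e"
  proof (rule cSUP_least)
    fix i
    have "f i \<le> (SUP i. f i)" by (rule cSUP_upper[OF UNIV_I assms(2)])
    then show "g i \<le> (SUP i. f i) + e" using assms(1)[of i] by linarith
  qed simp
  ultimately show ?thesis by linarith
qed

text \<open>Each q different from \<open>p\<close> has a neighbourhood whose closure omits
  \<open>p\<close>. In a locally finite refinement of these neighbourhoods and \<open>U\<close>,
  only finitely many members not contained in \<open>U\<close> come near \<open>p\<close>;
  \<open>S\<close> arises by removing their closures. The union of all members not contained in
  \<open>U\<close> is open, disjoint from \<open>S\<close>, and contains the complement of
  \<open>U\<close>.\<close>

lemma paracompact_regular: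
  fixes U :: "'a::t2_space set"
  assumes P: "paracompact_space (euclidean :: 'a topology)" and U: "open U" "p \<in> U"
  obtains S where "open S" "p \<in> S" "closure S \<subseteq> U"
proof -
  let ?\<U> = "insert U {A. open A \<and> p \<notin> closure A}"
  have "\<Union>?\<U> = UNIV"
  proof -
    have "q \<in> \<Union>?\<U>" for q
    proof (cases "q = p")
      case False
      then obtain A B where "open A" "open B" "q \<in> A" "p \<in> B" "A \<inter> B = {}"
        using hausdorff[of q p] by blast
      then have "p \<notin> closure A" by (auto simp: closure_iff_nhds_not_empty)
      with \<open>open A\<close> \<open>q \<in> A\<close> show ?thesis by blast
    qed (use U in auto)
    then show ?thesis by blast
  qed
  moreover have "\<forall>A\<in>?\<U>. openin euclidean A" using U by auto
  ultimately obtain \<V> where \<V>: "\<forall>V\<in>\<V>. openin euclidean V \<and> (\<exists>A\<in>?\<U>. V \<subseteq> A)"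
      "\<Union>\<V> = topspace euclidean" "locally_finite_in euclidean \<V>"
    using P unfolding paracompact_space_def by (metis (no_types, lifting) topspace_euclidean)
  let ?\<W> = "{V \<in> \<V>. \<not> V \<subseteq> U}"
  obtain S0 where S0: "open S0" "p \<in> S0" "finite {V \<in> \<V>. V \<inter> S0 \<noteq> {}}"
    using \<V>(3) unfolding locally_finite_in_def by auto
  let ?F = "{V \<in> ?\<W>. V \<inter> S0 \<noteq> {}}"
  define S where "S = S0 - (\<Union>V\<in>?F. closure V)"
  have fin: "finite ?F" by (rule finite_subset[OF _ S0(3)]) auto
  have "p \<notin> closure V" if "V \<in> ?\<W>" for V
    using \<V>(1) that closure_mono by (metis (no_types, lifting) insertE mem_Collect_eq subsetD)
  then have "p \<in> S" using S0 by (auto simp: S_def)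
  moreover have "open S" unfolding S_def using S0(1) fin by (intro open_Diff closed_UN) auto
  moreover have "closure S \<subseteq> U"
  proof
    fix q assume q: "q \<in> closure S"
    show "q \<in> U"
    proof (rule ccontr)
      assume "q \<notin> U"
      have "q \<in> \<Union>\<V>" using \<V>(2) by simp
      then obtain V where V: "V \<in> \<V>" "q \<in> V" by blast
      with \<open>q \<notin> U\<close> have "V \<in> ?\<W>" by auto
      have "V \<inter> S = {}"
      proof (cases "V \<inter> S0 = {}")
        case False
        then have "V \<in> ?F" using \<open>V \<in> ?\<W>\<close> by blast
        then show ?thesis using closure_subset[of V] by (auto simp: S_def)
      qed (auto simp: S_def)
      moreover have "open V" using \<V>(1) V by auto
      ultimately show False using q V open_Int_closure_eq_empty by blast
    qed
  qed
  ultimately show thesis using that by blast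
qed

locale uniform_finsler_star = uniform_finsler l m K \<A> N
  for l m :: enat and K :: real and \<A> :: "('m::t2_space, 'x::banach) chart set"
    and N :: "'m \<times> ('m, 'x) tangent \<Rightarrow> real" +
  fixes k :: enat and C0 :: real
  assumes star: "property_star TYPE('x) k C0" and m_le_k: "m \<le> k"
begin

lemma C0_ge_1: "1 \<le> C0"
  using star by (simp add: property_star_def)

text \<open>Balls are convex. Along a segment the pointwise estimates, all with the constant
  \<open>a\<close>, are chained from left to right: every point admits a later one reached with
  slope at most \<open>a\<close>.\<close>

lemma calm_lipschitz_on_ball:
  assumes u: "calm a u" and a: "0 \<le> a" and c: "c \<in> uniform_charts" and B: "ball x r \<subseteq> snd c ` fst c"
  shows "a-lipschitz_on (ball x r) (\<lambda>y. u (chart_inv c y))"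
proof (rule lipschitz_onI[OF _ a])
  fix y z assume yz: "y \<in> ball x r" "z \<in> ball x r"
  let ?y = "\<lambda>t. y + t *\<^sub>R (z - y)"
  let ?\<sigma> = "\<lambda>t. chart_inv c (?y t)"
  have cA: "c \<in> \<A>" using c by (rule uniform_chart_atlas)
  have seg: "?y t \<in> snd c ` fst c" if "t \<in> {0..1}" for t
  proof -
    have "(1 - t) *\<^sub>R y + t *\<^sub>R z \<in> ball x r"
      using that yz convex_ball[of x r] unfolding convex_alt by auto
    then show ?thesis using B by (auto simp: algebra_simps)
  qed
  have cont: "continuous_on {0..1} ?\<sigma>"
    using seg by (intro continuous_on_compose2[OF topological_chartD(5)[OF cA]]) (auto intro!: continuous_intros)
  have "dist (u (?\<sigma> 1)) (u (?\<sigma> 0)) \<le> a * norm (z - y) * (1 - 0)"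
  proof (rule locally_lipschitz_imp_lipschitz_aux)
    show "continuous_on {0..1} (\<lambda>t. u (?\<sigma> t))"
      using continuous_on_compose2[OF calm_continuous[OF u] cont] by simp
    fix t :: real assume t: "t \<in> {0..<1}"
    have t': "?\<sigma> t \<in> fst c" using t by (intro chart_inv_in seg) auto
    have "\<forall>\<^sub>F q in nhds (?\<sigma> t). \<bar>u q - u (?\<sigma> t)\<bar> \<le> a * dist (snd c q) (snd c (?\<sigma> t))"
      using u c t' by (simp add: calm_def)
    moreover have "(?\<sigma> \<longlongrightarrow> ?\<sigma> t) (at t within {0..1})"
      using cont t by (auto simp: continuous_on_def)
    ultimately have "\<forall>\<^sub>F s in at t within {0..1}. \<bar>u (?\<sigma> s) - u (?\<sigma> t)\<bar> \<le> a * dist (snd c (?\<sigma> s)) (snd c (?\<sigma> t))"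
      by (rule eventually_compose_filterlim)
    then obtain d where d: "0 < d" "\<And>s. s \<in> {0..1} \<Longrightarrow> s \<noteq> t \<Longrightarrow> dist s t < d \<Longrightarrow>
        \<bar>u (?\<sigma> s) - u (?\<sigma> t)\<bar> \<le> a * dist (snd c (?\<sigma> s)) (snd c (?\<sigma> t))"
      unfolding eventually_at by blast
    \<comment> \<open>A point to the right of \<open>t\<close>, in the range of the estimate and
      still in the unit interval.\<close>
    define s where "s = min 1 (t + d / 2)"
    have s: "t < s" "s \<le> 1" "dist s t < d" using t d(1) by (auto simp: s_def dist_real_def)
    have "\<bar>u (?\<sigma> s) - u (?\<sigma> t)\<bar> \<le> a * dist (?y s) (?y t)"
      using d(2)[of s] s t seg[of s] seg[of t] by simp
    also have "dist (?y s) (?y t) = norm ((s - t) *\<^sub>R (z - y))" by (simp add: dist_norm algebra_simps)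
    also have "\<dots> = (s - t) * norm (z - y)" using s by simp
    finally show "\<exists>s\<in>{t<..1}. dist (u (?\<sigma> s)) (u (?\<sigma> t)) \<le> a * norm (z - y) * (s - t)"
      using s by (intro bexI[of _ s]) (auto simp: dist_real_def mult_ac)
  qed simp
  then show "dist (u (chart_inv c y)) (u (chart_inv c z)) \<le> a * dist y z"
    by (simp add: dist_norm norm_minus_commute)
qed

definition chart_ball_in :: "('m, 'x) chart \<Rightarrow> 'x \<Rightarrow> real \<Rightarrow> 'm set" where
  "chart_ball_in c x r = {p \<in> fst c. snd c p \<in> ball x r}"

definition good_ball :: "('m, 'x) chart \<Rightarrow> 'x \<Rightarrow> real \<Rightarrow> bool" where
  "good_ball c x r \<longleftrightarrow> c \<in> uniform_charts \<and> 0 < r \<and> ball x r \<subseteq> snd c ` fst c"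

text \<open>\<open>C0 * a\<close> is the Lipschitz constant in the chart and \<open>K\<close>
  converts the chart norm to \<open>N\<close>; for a = L K this gives C0 K^2 L. The differential is
  controlled on the whole chart domain, closeness to \<open>u\<close> is claimed over the
  ball.\<close>

lemma chart_approx:
  assumes c: "good_ball c x r" and u: "calm a u" "0 \<le> a" and e: "0 < e"
  obtains h where "\<And>p. p \<in> fst c \<Longrightarrow> differential_le h p (C0 * a * K)" "\<And>p. p \<in> chart_ball_in c x r \<Longrightarrow> \<bar>h p - u p\<bar> < e"
proof -
  have cK: "c \<in> uniform_charts" and cA: "c \<in> \<A>" and r: "0 < r" "ball x r \<subseteq> snd c ` fst c"
    using c uniform_chart_atlas by (auto simp: good_ball_def)
  \<comment> \<open>\<open>property_star\<close> concerns functions on all of the model space, so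
    the coordinate expression of \<open>u\<close> is extended from the ball.\<close>
  obtain F where F: "a-lipschitz_on UNIV F" "\<And>y. y \<in> ball x r \<Longrightarrow> F y = u (chart_inv c y)"
    using lipschitz_extension[OF calm_lipschitz_on_ball[OF u cK r(2)]] r(1) by (metis centre_in_ball empty_iff)
  obtain h :: "'x \<Rightarrow> real" where h: "C_smooth_on k UNIV h" "\<And>y. \<bar>F y - h y\<bar> < e"
    "(C0 * a)-lipschitz_on UNIV h"
    by (rule property_star_approx[OF star F(1) e]) (rule that)
  have hm: "C_smooth_on m UNIV h" using C_smooth_on_mono[OF h(1) m_le_k] .
  show thesis
  proof
    fix p assume p: "p \<in> fst c"
    obtain G where "\<And>y. y \<in> UNIV \<Longrightarrow> (h has_derivative (\<lambda>u. mapp (G y) [u])) (at y)"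
      by (rule C_smooth_on_derivative[OF open_UNIV hm m_ge_1]) blast
    from this[OF UNIV_I] obtain D where D: "(h has_derivative D) (at (snd c p))" by blast
    have "\<bar>D (v c)\<bar> \<le> C0 * a * K * N (p, v)" if v: "v \<in> T p" for v
    proof -
      have "\<bar>D (v c)\<bar> \<le> C0 * a * norm (v c)" using lipschitz_derivative_bound[OF D h(3), of "v c"] by simp
      also have "\<dots> \<le> C0 * a * (K * N (p, v))"
        using uniform_chart_upper[OF cK p v] C0_ge_1 u(2) by (intro mult_left_mono) auto
      finally show ?thesis by (simp add: mult.assoc)
    qed
    with smooth_differential_chart[OF hm D cA p] show "differential_le (\<lambda>q. h (snd c q)) p (C0 * a * K)"
      unfolding differential_le_def by (intro exI[of _ "\<lambda>v. D (v c)"]) auto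
  next
    fix p assume "p \<in> chart_ball_in c x r"
    then have p: "p \<in> fst c" "snd c p \<in> ball x r" by (auto simp: chart_ball_in_def)
    then show "\<bar>h (snd c p) - u p\<bar> < e"
      using h(2)[of "snd c p"] F(2)[OF p(2)] cA by (simp add: abs_minus_commute)
  qed
qed

lemma differential_le_cong:
  assumes "differential_le g p b" "open S" "p \<in> S" "\<And>q. q \<in> S \<Longrightarrow> g q = h q"
  shows "differential_le h p b"
  using assms smooth_differential_cong unfolding differential_le_def by meson

text \<open>The pieces are open and disjoint, so the choices on different pieces do not interfere,
  and the accuracy may vary with the piece while the differential bound is common to all. Off the
  pieces the function is arbitrary.\<close>

lemma pieces_approx:
  fixes W :: "'i \<Rightarrow> 'm set"
  assumes W: "\<And>i. open (W i)" "\<And>i j p. p \<in> W i \<Longrightarrow> p \<in> W j \<Longrightarrow> i = j"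
    and good: "\<And>i. W i \<noteq> {} \<Longrightarrow> \<exists>c x r. good_ball c x r \<and> W i \<subseteq> chart_ball_in c x r"
    and u: "calm a u" "0 \<le> a" and e: "\<And>i. W i \<noteq> {} \<Longrightarrow> 0 < e i"
  obtains h where "\<And>i p. p \<in> W i \<Longrightarrow> differential_le h p (C0 * a * K)" "\<And>i p. p \<in> W i \<Longrightarrow> \<bar>h p - u p\<bar> < e i"
proof -
  have "\<exists>h. \<forall>p\<in>W i. differential_le h p (C0 * a * K) \<and> \<bar>h p - u p\<bar> < e i" for i
  proof (cases "W i = {}")
    case False
    then obtain c x r where c: "good_ball c x r" "W i \<subseteq> chart_ball_in c x r" using good by blast
    obtain h where "\<And>p. p \<in> fst c \<Longrightarrow> differential_le h p (C0 * a * K)"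
      "\<And>p. p \<in> chart_ball_in c x r \<Longrightarrow> \<bar>h p - u p\<bar> < e i"
      by (rule chart_approx[OF c(1) u e[OF False]]) (rule that)
    then show ?thesis using c(2) by (intro exI[of _ h]) (auto simp: chart_ball_in_def)
  qed simp
  then obtain h where h: "\<And>i p. p \<in> W i \<Longrightarrow> differential_le (h i) p (C0 * a * K) \<and> \<bar>h i p - u p\<bar> < e i" by metis
  define H where "H p = h (THE i. p \<in> W i) p" for p
  have H: "H p = h i p" if "p \<in> W i" for i p
  proof -
    have "(THE i. p \<in> W i) = i" using that W(2) by blast
    then show ?thesis by (simp add: H_def)
  qed
  show thesis
  proof
    fix i p assume p: "p \<in> W i"
    have "differential_le (h i) p (C0 * a * K)" using h[OF p] by blast
    then show "differential_le H p (C0 * a * K)"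
      by (rule differential_le_cong[OF _ W(1)[of i] p]) (simp add: H)
    show "\<bar>H p - u p\<bar> < e i" using h[OF p] p by (simp add: H)
  qed
qed

section \<open>Disjoint pieces and gluing\<close>

text \<open>
  The distance to the empty set is the junk value \<open>0\<close>, hence the case distinction; \<open>A = UNIV\<close> does occur,
  namely if the model space is trivial.
\<close>

definition inner_dist :: "'x set \<Rightarrow> 'x \<Rightarrow> real" where
  "inner_dist A y = (if A = UNIV then 1 else min 1 (infdist y (- A)))"

lemma inner_dist_bounds: "0 \<le> inner_dist A y" "inner_dist A y \<le> 1"
  by (auto simp: inner_dist_def infdist_nonneg)

lemma inner_dist_outside: "y \<notin> A \<Longrightarrow> inner_dist A y = 0"
  by (auto simp: inner_dist_def)

lemma inner_dist_pos:
  assumes "open A" "y \<in> A"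
  shows "0 < inner_dist A y"
proof (cases "A = UNIV")
  case False
  then have "infdist y (- A) \<noteq> 0"
    using assms in_closed_iff_infdist_zero[of "- A" y] by auto
  then show ?thesis using infdist_nonneg[of y "- A"] False by (simp add: inner_dist_def)
qed (simp add: inner_dist_def)

lemma inner_dist_lipschitz: "\<bar>inner_dist A y - inner_dist A z\<bar> \<le> dist y z"
  using infdist_triangle_abs[of y "- A" z] by (auto simp: inner_dist_def min_def)

text \<open>\<open>K\<^sup>2\<close> bounds the derivative of the transition map, and 1 absorbs the
  first-order remainder near \<open>p\<close>.\<close>

lemma transition_calm:
  assumes c: "c \<in> uniform_charts" "p \<in> fst c" and d: "d \<in> uniform_charts" "p \<in> fst d"
  shows "\<forall>\<^sub>F q in nhds p. dist (snd d q) (snd d p) \<le> (K\<^sup>2 + 1) * dist (snd c q) (snd c p)"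
proof -
  have cd: "c \<in> charts_at \<A> p" "d \<in> charts_at \<A> p" using c d uniform_chart_atlas by (auto simp: charts_at_def)
  obtain e where e: "0 < e" "\<And>y. norm (y - snd c p) < e \<Longrightarrow>
      norm (transition c d y - transition c d (snd c p) - dtransition c d p (y - snd c p)) \<le> 1 * norm (y - snd c p)"
    using transition_has_derivative[OF cd] unfolding has_derivative_at_alt by (metis zero_less_one)
  have "\<forall>\<^sub>F q in nhds p. q \<in> fst d" 
    by (rule eventually_nhds_in_open[OF topological_chartD(1)[OF uniform_chart_atlas[OF d(1)]] d(2)])
  with eventually_chart_dist[OF uniform_chart_atlas[OF c(1)] c(2) e(1)] show ?thesis
  proof eventually_elim
    case (elim q)
    let ?w = "snd c q - snd c p"
    have "norm (snd d q - snd d p - dtransition c d p ?w) \<le> 1 * norm ?w"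
      using e(2)[of "snd c q"] elim c uniform_chart_atlas by (simp add: dist_norm transition_eq)
    moreover have "norm (dtransition c d p ?w) \<le> K\<^sup>2 * norm ?w" by (rule uniform_chart_dtransition_bound) (use c d in auto)
    ultimately show ?case
      using norm_triangle_ineq[of "snd d q - snd d p - dtransition c d p ?w" "dtransition c d p ?w"]
      by (simp add: dist_norm distrib_right)
  qed
qed

lemma paracompact: "paracompact_space (euclidean :: 'm topology)"
  using uniform by (simp add: uniform_finsler_manifold_def paracompact_manifold_def)

lemma open_chart_ball_in: "c \<in> \<A> \<Longrightarrow> open (chart_ball_in c x r)"
proof -
  assume c: "c \<in> \<A>"
  have "chart_ball_in c x r = fst c \<inter> snd c -` ball x r" by (auto simp: chart_ball_in_def)
  then show ?thesis using continuous_open_preimage[OF topological_chartD(4,1)[OF c] open_ball] by simp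
qed

text \<open>Local finiteness comes from a refinement, so the property \<open>Q\<close> has to pass
  to subsets; it consists of an inclusion and a lower bound \<open>e\<close> for \<epsilon>. The
  closure of \<open>V\<close> is placed in the chart ball, by regularity, so that the chart of
  \<open>V\<close> also covers the boundary points of \<open>V\<close>.\<close>

lemma ball_cover:
  fixes \<epsilon> :: "'m \<Rightarrow> real"
  assumes \<epsilon>: "continuous_on UNIV \<epsilon>" "\<And>p. 0 < \<epsilon> p"
  obtains \<V> :: "'m set set" where "\<Union>\<V> = UNIV" "\<And>V. V \<in> \<V> \<Longrightarrow> open V"
    "\<And>p. \<exists>S. open S \<and> p \<in> S \<and> finite {V \<in> \<V>. V \<inter> S \<noteq> {}}"
    "\<And>V. V \<in> \<V> \<Longrightarrow> \<exists>c x r e. good_ball c x r \<and> closure V \<subseteq> chart_ball_in c x r \<and> 0 < e \<and> (\<forall>p\<in>V. e \<le> \<epsilon> p)"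
proof -
  define Q where "Q V \<longleftrightarrow> (\<exists>c x r e. good_ball c x r \<and> closure V \<subseteq> chart_ball_in c x r \<and> 0 < e \<and> (\<forall>p\<in>V. e \<le> \<epsilon> p))"
    for V :: "'m set"
  have "\<exists>V. open V \<and> Q V \<and> p \<in> V" for p
  proof -
    obtain c where c: "c \<in> uniform_charts" "p \<in> fst c" using uniform_chart_cover by blast
    obtain r where r: "0 < r" "ball (snd c p) r \<subseteq> snd c ` fst c" using chart_ball[OF uniform_chart_atlas[OF c(1)] c(2)] .
    have o: "open (chart_ball_in c (snd c p) r)" by (rule open_chart_ball_in[OF uniform_chart_atlas[OF c(1)]])
    have "p \<in> chart_ball_in c (snd c p) r" using c r by (simp add: chart_ball_in_def)
    then obtain S where S: "open S" "p \<in> S" "closure S \<subseteq> chart_ball_in c (snd c p) r"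
      by (rule paracompact_regular[OF paracompact o]) (rule that)
    define V where "V = S \<inter> \<epsilon> -` {\<epsilon> p / 2<..}"
    have "open V" unfolding V_def by (intro open_Int S(1) open_vimage[OF open_greaterThan \<epsilon>(1)])
    moreover have "p \<in> V" using S \<epsilon>(2)[of p] by (simp add: V_def)
    moreover have "closure V \<subseteq> chart_ball_in c (snd c p) r"
      using S(3) closure_mono[of V S] by (auto simp: V_def)
    then have "Q V"
      unfolding Q_def using c r \<epsilon>(2)[of p]
      by (intro exI[of _ c] exI[of _ "snd c p"] exI[of _ r] exI[of _ "\<epsilon> p / 2"]) (auto simp: good_ball_def V_def)
    ultimately show ?thesis by blast
  qed
  then have "\<Union>{V. open V \<and> Q V} = topspace euclidean" by auto
  then have "(\<forall>V\<in>{V. open V \<and> Q V}. openin euclidean V) \<and> \<Union>{V. open V \<and> Q V} = topspace euclidean" by simp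
  from mp[OF spec[OF paracompact[unfolded paracompact_space_def]] this] obtain \<V> where \<V>: "\<forall>V\<in>\<V>. openin euclidean V \<and> (\<exists>U\<in>{V. open V \<and> Q V}. V \<subseteq> U)"
      "\<Union>\<V> = topspace euclidean" "locally_finite_in euclidean \<V>"
    by (elim exE conjE) (rule that)
  have Q_sub: "Q V" if "Q U" and VU: "V \<subseteq> U" for U V
  proof -
    from that(1) obtain c x r e where "good_ball c x r" "closure U \<subseteq> chart_ball_in c x r" "0 < e" "\<forall>p\<in>U. e \<le> \<epsilon> p"
      unfolding Q_def by (elim exE conjE)
    then show ?thesis
      using VU closure_mono[OF VU] unfolding Q_def
      by (intro exI[of _ c] exI[of _ x] exI[of _ r] exI[of _ e]) auto
  qed
  show thesis
  proof
    show "\<Union>\<V> = UNIV" using \<V>(2) by simp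
    show "open V" if "V \<in> \<V>" for V using \<V>(1) that by simp
    show "\<exists>S. open S \<and> p \<in> S \<and> finite {V \<in> \<V>. V \<inter> S \<noteq> {}}" for p
      using \<V>(3) by (auto simp: locally_finite_in_def)
    show "\<exists>c x r e. good_ball c x r \<and> closure V \<subseteq> chart_ball_in c x r \<and> 0 < e \<and> (\<forall>p\<in>V. e \<le> \<epsilon> p)" if "V \<in> \<V>" for V
    proof -
      from bspec[OF \<V>(1) \<open>V \<in> \<V>\<close>] obtain U where "Q U" "V \<subseteq> U" by blast
      then have "Q V" by (rule Q_sub)
      then show ?thesis by (simp add: Q_def)
    qed
  qed
qed

text \<open>
  For a locally finite cover \<open>\<V>\<close> with functions \<open>\<rho>\<^sub>V\<close> positive exactly on \<open>V\<close>, and a well-ordering of \<open>\<V>\<close>,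
  put \<open>W\<^sub>n\<^sub>V = {\<rho>\<^sub>V > 1/(n+1)} \<inter> {sup \<rho>\<^sub>V\<^sub>' < 1/(n+1) over V' before V}\<close>: disjoint for fixed \<open>n\<close>, and a point
  lies in \<open>W\<^sub>n\<^sub>V\<close> for the first \<open>V\<close> containing it and large \<open>n\<close>.
\<close>

lemma disjoint_cover:
  fixes \<epsilon> :: "'m \<Rightarrow> real"
  assumes \<epsilon>: "continuous_on UNIV \<epsilon>" "\<And>p. 0 < \<epsilon> p"
  obtains u :: "nat \<Rightarrow> 'm \<Rightarrow> real" and W :: "nat \<Rightarrow> 'm set \<Rightarrow> 'm set" and e :: "'m set \<Rightarrow> real"
  where "\<And>n. calm (K\<^sup>2 + 1) (u n)" "\<And>n V. open (W n V)"
    "\<And>n V V' p. p \<in> W n V \<Longrightarrow> p \<in> W n V' \<Longrightarrow> V = V'"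
    "\<And>n p. 0 < u n p \<Longrightarrow> \<exists>V. p \<in> W n V"
    "\<And>n V. W n V \<noteq> {} \<Longrightarrow> \<exists>c x r. good_ball c x r \<and> W n V \<subseteq> chart_ball_in c x r"
    "\<And>n V. W n V \<noteq> {} \<Longrightarrow> 0 < e V" "\<And>n V p. p \<in> W n V \<Longrightarrow> e V \<le> \<epsilon> p"
    "\<And>p. \<exists>n. 1 / real (Suc n) \<le> u n p"
proof -
  obtain \<V> :: "'m set set" where cover: "\<Union>\<V> = UNIV" and open_V: "\<And>V. V \<in> \<V> \<Longrightarrow> open V"
    and locfin: "\<And>p. \<exists>S. open S \<and> p \<in> S \<and> finite {V \<in> \<V>. V \<inter> S \<noteq> {}}"
    and V: "\<And>V. V \<in> \<V> \<Longrightarrow> \<exists>c x r e. good_ball c x r \<and> closure V \<subseteq> chart_ball_in c x r \<and> 0 < e \<and> (\<forall>p\<in>V. e \<le> \<epsilon> p)"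
    by (rule ball_cover[OF \<epsilon>]) (rule that)
  define c where "c V = (SOME c. c \<in> uniform_charts \<and> closure V \<subseteq> fst c)" for V
  define e where "e V = (SOME e. 0 < e \<and> (\<forall>p\<in>V. e \<le> \<epsilon> p))" for V
  have c: "c V \<in> uniform_charts \<and> closure V \<subseteq> fst (c V)" if "V \<in> \<V>" for V
  proof -
    have "\<exists>c. c \<in> uniform_charts \<and> closure V \<subseteq> fst c"
      using V[OF that] unfolding good_ball_def chart_ball_in_def by blast
    then show ?thesis unfolding c_def by (rule someI_ex)
  qed
  have e: "0 < e V \<and> (\<forall>p\<in>V. e V \<le> \<epsilon> p)" if "V \<in> \<V>" for V
  proof -
    have "\<exists>e. 0 < e \<and> (\<forall>p\<in>V. e \<le> \<epsilon> p)" using V[OF that] by blast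
    then show ?thesis unfolding e_def by (rule someI_ex)
  qed
  have cK: "c V \<in> uniform_charts" and cA: "c V \<in> \<A>" and Vc: "closure V \<subseteq> fst (c V)" "V \<subseteq> fst (c V)" if "V \<in> \<V>" for V
    using c[OF that] uniform_chart_atlas closure_subset[of V] by auto
  \<comment> \<open>Distance to the complement, measured in the chart of \<open>V\<close> and
    extended by 0. The extension stays calm because the closure of \<open>V\<close> lies in the
    chart domain.\<close>
  define \<rho> where "\<rho> V p = (if V \<in> \<V> \<and> p \<in> fst (c V) then inner_dist (snd (c V) ` V) (snd (c V) p) else 0)" for V p
  have \<rho>01: "0 \<le> \<rho> V p" "\<rho> V p \<le> 1" for V p by (auto simp: \<rho>_def inner_dist_bounds)
  have \<rho>0: "\<rho> V p = 0" if "p \<notin> V \<or> V \<notin> \<V>" for V p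
  proof (cases "V \<in> \<V> \<and> p \<in> fst (c V)")
    case True
    then have "snd (c V) p \<notin> snd (c V) ` V"
      using that Vc[of V] inj_on_image_mem_iff[OF topological_chartD(3)[OF cA[of V]]] by auto
    then show ?thesis using True by (simp add: \<rho>_def inner_dist_outside)
  qed (auto simp: \<rho>_def)
  have \<rho>pos: "0 < \<rho> V p" if "V \<in> \<V>" "p \<in> V" for V p
  proof -
    have "open (snd (c V) ` (fst (c V) \<inter> V))" by (rule open_chart_image[OF cA[OF that(1)] open_V[OF that(1)]])
    moreover have "fst (c V) \<inter> V = V" using Vc[OF that(1)] by blast
    ultimately have "0 < inner_dist (snd (c V) ` V) (snd (c V) p)" using that(2) by (intro inner_dist_pos) auto
    then show ?thesis using that Vc[OF that(1)] by (auto simp: \<rho>_def)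
  qed
  have \<rho>calm1: "\<forall>\<^sub>F q in nhds p. \<bar>\<rho> V q - \<rho> V p\<bar> \<le> (K\<^sup>2 + 1) * dist (snd d q) (snd d p)"
    if d: "d \<in> uniform_charts" "p \<in> fst d" and "V \<in> \<V>" for d p V
  \<comment> \<open>On the closure of \<open>V\<close> the chart of \<open>V\<close> is available
    and only a change of charts is paid for; off it \<rho> vanishes locally.\<close>
  proof (cases "p \<in> closure V")
    case True
    then have p: "p \<in> fst (c V)" using Vc[OF \<open>V \<in> \<V>\<close>] by blast
    have "\<forall>\<^sub>F q in nhds p. q \<in> fst (c V)"
      by (rule eventually_nhds_in_open[OF topological_chartD(1)[OF cA[OF \<open>V \<in> \<V>\<close>]] p])
    with transition_calm[OF d cK[OF \<open>V \<in> \<V>\<close>] p] show ?thesis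
    proof eventually_elim
      case (elim q)
      then show ?case
        using inner_dist_lipschitz[of "snd (c V) ` V" "snd (c V) q" "snd (c V) p"] p by (simp add: \<rho>_def)
    qed
  next
    case False
    have "\<forall>\<^sub>F q in nhds p. q \<in> - closure V" by (rule eventually_nhds_in_open) (use False in auto)
    then show ?thesis
    proof eventually_elim
      case (elim q)
      then have "\<rho> V q = 0" "\<rho> V p = 0" using False closure_subset[of V] by (auto intro: \<rho>0)
      then show ?case by simp
    qed
  qed
  \<comment> \<open>Near \<open>p\<close> only finitely many \<rho> are not identically 0, so one
    neighbourhood serves all \<open>V\<close>, as the suprema below require.\<close>
  have \<rho>calm: "\<forall>\<^sub>F q in nhds p. \<forall>V. \<bar>\<rho> V q - \<rho> V p\<bar> \<le> (K\<^sup>2 + 1) * dist (snd d q) (snd d p)"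
    if d: "d \<in> uniform_charts" "p \<in> fst d" for d p
  proof -
    obtain S where S: "open S" "p \<in> S" "finite {V \<in> \<V>. V \<inter> S \<noteq> {}}" using locfin by blast
    have "\<forall>\<^sub>F q in nhds p. \<forall>V\<in>{V \<in> \<V>. V \<inter> S \<noteq> {}}. \<bar>\<rho> V q - \<rho> V p\<bar> \<le> (K\<^sup>2 + 1) * dist (snd d q) (snd d p)"
      using \<rho>calm1[OF d] by (intro eventually_ball_finite[OF S(3)]) auto
    moreover have "\<forall>\<^sub>F q in nhds p. q \<in> S" by (rule eventually_nhds_in_open[OF S(1,2)])
    ultimately show ?thesis
    proof eventually_elim
      case (elim q)
      show ?case
      proof
        fix V
        show "\<bar>\<rho> V q - \<rho> V p\<bar> \<le> (K\<^sup>2 + 1) * dist (snd d q) (snd d p)"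
        proof (cases "V \<in> {V \<in> \<V>. V \<inter> S \<noteq> {}}")
          case False
          then have "\<rho> V q = 0" "\<rho> V p = 0" using S(2) elim(2) by (auto intro!: \<rho>0)
          then show ?thesis by simp
        qed (use elim in blast)
      qed
    qed
  qed
  \<comment> \<open>The well-order covers all sets of points; those outside \<V> contribute the
    value 0 to the suprema.\<close>
  obtain R0 :: "'m set rel" where R0: "well_order_on UNIV R0" using well_order_on by blast
  define R where "R = R0 - Id"
  have wfR: "wf R" using R0 by (simp add: R_def well_order_on_def)
  have totR: "(V, V') \<in> R \<or> (V', V) \<in> R" if "V \<noteq> V'" for V V'
    using R0 that by (auto simp: R_def well_order_on_def linear_order_on_def total_on_def)
  \<comment> \<open>Indices that do not precede \<open>V\<close> enter with value 0. This keeps the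
    index set nonempty and gives 0 when nothing precedes \<open>V\<close>.\<close>
  define before where "before V p = (SUP V'. if (V', V) \<in> R then \<rho> V' p else 0)" for V p
  have bdd1: "bdd_above (range (\<lambda>V'. if (V', V) \<in> R then \<rho> V' p else 0))" for V p
    using \<rho>01 by (intro bdd_aboveI2[of _ _ 1]) auto
  define a where "a n = 1 / real (Suc n)" for n
  define \<sigma> where "\<sigma> n V p = min (\<rho> V p - a n) (a n - before V p)" for n V p
  have a: "0 < a n" for n by (simp add: a_def)
  have \<sigma>_le: "\<sigma> n V p \<le> 1" for n V p using \<rho>01(2)[of V p] a[of n] by (simp add: \<sigma>_def min_le_iff_disj)
  \<comment> \<open>Positive exactly on the union of the pieces of layer \<open>n\<close>. Maxima,
    minima and suprema are nonexpansive, so the calmness constant is the same for all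
    layers.\<close>
  define u where "u n p = (SUP V. max 0 (\<sigma> n V p))" for n p
  have bdd2: "bdd_above (range (\<lambda>V. max 0 (\<sigma> n V p)))" for n p
    using \<sigma>_le by (intro bdd_aboveI2[of _ _ 1]) auto
  have near: "\<bar>\<sigma> n V q - \<sigma> n V p\<bar> \<le> \<eta>" "\<bar>u n q - u n p\<bar> \<le> \<eta>"
    if \<eta>: "\<And>V. \<bar>\<rho> V q - \<rho> V p\<bar> \<le> \<eta>" for n V p q \<eta>
  proof -
    have "0 \<le> \<eta>" using \<eta>[of undefined] by linarith
    then have "\<bar>before V q - before V p\<bar> \<le> \<eta>" for V
      unfolding before_def using \<eta> by (intro cSUP_diff_le bdd1) auto
    then have *: "\<bar>\<sigma> n V q - \<sigma> n V p\<bar> \<le> \<eta>" for V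
      using \<eta>[of V] unfolding \<sigma>_def by (smt (verit))
    then show "\<bar>\<sigma> n V q - \<sigma> n V p\<bar> \<le> \<eta>" .
    have "\<bar>max 0 (\<sigma> n V q) - max 0 (\<sigma> n V p)\<bar> \<le> \<eta>" for V using *[of V] by linarith
    then show "\<bar>u n q - u n p\<bar> \<le> \<eta>" unfolding u_def by (rule cSUP_diff_le[OF _ bdd2 bdd2])
  qed
  have calm_u: "calm (K\<^sup>2 + 1) (u n)" and calm_\<sigma>: "calm (K\<^sup>2 + 1) (\<sigma> n V)" for n V
    unfolding calm_def using near by (auto elim!: eventually_mono[OF \<rho>calm])
  define W where "W n V = {p. 0 < \<sigma> n V p}" for n V
  have W_in: "V \<in> \<V>" "p \<in> V" if "p \<in> W n V" for n V p
    using that \<rho>0[of p V] a[of n] by (auto simp: W_def \<sigma>_def)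
  have not_both: "\<not> (p \<in> W n V \<and> p \<in> W n V')" if "(V, V') \<in> R" for n V V' p
  proof
    assume p: "p \<in> W n V \<and> p \<in> W n V'"
    have "\<rho> V p \<le> before V' p"
    proof -
      have "(if (V, V') \<in> R then \<rho> V p else 0) \<le> before V' p"
        unfolding before_def by (rule cSUP_upper[OF UNIV_I bdd1])
      then show ?thesis using that by simp
    qed
    then show False using p by (auto simp: W_def \<sigma>_def)
  qed
  show thesis
  proof (rule that)
    show "calm (K\<^sup>2 + 1) (u n)" for n by (rule calm_u)
    show "open (W n V)" for n V
    proof -
      have "W n V = \<sigma> n V -` {0<..}" by (auto simp: W_def)
      then show ?thesis using open_vimage[OF open_greaterThan calm_continuous[OF calm_\<sigma>]] by simp
    qed
    show "V = V'" if "p \<in> W n V" "p \<in> W n V'" for n V V' p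
      using that totR[of V V'] not_both by blast
    show "\<exists>V. p \<in> W n V" if "0 < u n p" for n p
      using that unfolding u_def less_cSUP_iff[OF UNIV_not_empty bdd2] by (auto simp: W_def less_max_iff_disj)
    show "\<exists>c x r. good_ball c x r \<and> W n V \<subseteq> chart_ball_in c x r" if "W n V \<noteq> {}" for n V
    proof -
      have "V \<in> \<V>" "W n V \<subseteq> V" using that W_in by blast+
      with V[of V] closure_subset[of V] show ?thesis by (meson order_trans)
    qed
    show "0 < e V" if W: "W n V \<noteq> {}" for n V
    proof -
      obtain p where "p \<in> W n V" using W by auto
      from e[OF W_in(1)[OF this]] show ?thesis by simp
    qed
    show "e V \<le> \<epsilon> p" if p: "p \<in> W n V" for n V p
      using e[OF W_in(1)[OF p]] W_in(2)[OF p] by simp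
    show "\<exists>n. 1 / real (Suc n) \<le> u n p" for p
    proof -
      have "p \<in> \<Union>\<V>" by (simp add: cover)
      then obtain V1 where "V1 \<in> {V \<in> \<V>. p \<in> V}" by blast
      \<comment> \<open>The first member of the cover that contains \<open>p\<close>: no earlier
        \<rho> is positive at \<open>p\<close>.\<close>
      from wfE_min[OF wfR this] obtain V0 where V0: "V0 \<in> {V \<in> \<V>. p \<in> V}"
        and min: "\<And>V. (V, V0) \<in> R \<Longrightarrow> V \<notin> {V \<in> \<V>. p \<in> V}" by blast
      have "(if (V, V0) \<in> R then \<rho> V p else 0) = 0" for V using min[of V] \<rho>0[of p V] by auto
      then have b0: "before V0 p = 0" by (simp add: before_def)
      have "0 < \<rho> V0 p" using V0 \<rho>pos by blast
      \<comment> \<open>As 2/(n+1) < \<rho> V0 p, the first term of the minimum is at least 1/(n+1),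
        and the second equals 1/(n+1).\<close>
      then obtain n where "2 / \<rho> V0 p < real n" using reals_Archimedean2 by blast
      then have "2 < \<rho> V0 p * real (Suc n)" using \<open>0 < \<rho> V0 p\<close> by (simp add: divide_less_eq algebra_simps)
      then have "a n \<le> \<rho> V0 p - a n" by (simp add: a_def field_simps)
      then have "\<sigma> n V0 p = a n" using b0 by (simp add: \<sigma>_def)
      moreover have "max 0 (\<sigma> n V0 p) \<le> u n p" unfolding u_def by (rule cSUP_upper[OF UNIV_I bdd2])
      ultimately show ?thesis by (intro exI[of _ n]) (simp add: a_def)
    qed
  qed
qed

section \<open>Cutoffs with bounded differential, and their gluing\<close>

lemma differential_le_mult:
  assumes g: "differential_le g p a" "\<bar>g p\<bar> \<le> 1" and h: "differential_le h p b" "\<bar>h p\<bar> \<le> 1"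
  shows "differential_le (\<lambda>q. g q * h q) p (a + b)"
proof -
  obtain \<delta> \<eta> where \<delta>: "smooth_differential g p \<delta>" "\<forall>v\<in>T p. \<bar>\<delta> v\<bar> \<le> a * N (p, v)"
    and \<eta>: "smooth_differential h p \<eta>" "\<forall>v\<in>T p. \<bar>\<eta> v\<bar> \<le> b * N (p, v)"
    using g h unfolding differential_le_def by blast
  have "\<bar>g p * \<eta> v + \<delta> v * h p\<bar> \<le> (a + b) * N (p, v)" if v: "v \<in> T p" for v
  proof -
    have "\<bar>g p\<bar> * \<bar>\<eta> v\<bar> \<le> 1 * \<bar>\<eta> v\<bar>" using g(2) by (intro mult_right_mono) auto
    moreover have "\<bar>\<delta> v\<bar> * \<bar>h p\<bar> \<le> \<bar>\<delta> v\<bar> * 1" using h(2) by (intro mult_left_mono) auto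
    moreover have "\<bar>g p * \<eta> v + \<delta> v * h p\<bar> \<le> \<bar>g p\<bar> * \<bar>\<eta> v\<bar> + \<bar>\<delta> v\<bar> * \<bar>h p\<bar>"
      using abs_triangle_ineq[of "g p * \<eta> v" "\<delta> v * h p"] by (simp add: abs_mult)
    ultimately show ?thesis using \<delta>(2) \<eta>(2) v by (fastforce simp: distrib_right)
  qed
  with smooth_differential_mult[OF \<delta>(1) \<eta>(1)] show ?thesis unfolding differential_le_def by blast
qed

lemma differential_le_one_minus:
  assumes "differential_le g p a"
  shows "differential_le (\<lambda>q. 1 - g q) p a"
proof -
  obtain \<delta> where \<delta>: "smooth_differential g p \<delta>" "\<forall>v\<in>T p. \<bar>\<delta> v\<bar> \<le> a * N (p, v)"
    using assms unfolding differential_le_def by blast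
  from smooth_differential_add[OF smooth_differential_const smooth_differential_mult[OF smooth_differential_const \<delta>(1)], of 1 "- 1"]
  have "smooth_differential (\<lambda>q. 1 - g q) p (\<lambda>v. - \<delta> v)" by simp
  with \<delta>(2) show ?thesis unfolding differential_le_def by (intro exI[of _ "\<lambda>v. - \<delta> v"]) simp
qed

text \<open>On the pieces, an approximation \<open>h\<close> of \<open>u\<close> within b/8 is put
  through the smooth step. Where u < b/8 one has h < b/4 and the step gives 0; this includes a
  neighbourhood of every point off the pieces, where u \<le> 0. Where u > 3b/4 one has h > 5b/8 and
  the step gives 1. The bound \<open>C\<close> is uniform on the manifold but grows like
  1/b.\<close>

lemma smooth_cutoff:
  fixes W :: "'i \<Rightarrow> 'm set"
  assumes W: "\<And>i. open (W i)" "\<And>i j p. p \<in> W i \<Longrightarrow> p \<in> W j \<Longrightarrow> i = j"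
    and good: "\<And>i. W i \<noteq> {} \<Longrightarrow> \<exists>c x r. good_ball c x r \<and> W i \<subseteq> chart_ball_in c x r"
    and u: "calm a u" "0 \<le> a" and pos: "\<And>p. 0 < u p \<Longrightarrow> \<exists>i. p \<in> W i" and b: "0 < b"
  obtains \<phi> C where "\<And>p. 0 \<le> \<phi> p" "\<And>p. \<phi> p \<le> 1" "0 \<le> C" "\<And>p. differential_le \<phi> p C"
    "\<And>p. (\<And>i. p \<notin> W i) \<Longrightarrow> \<exists>S. open S \<and> p \<in> S \<and> (\<forall>q\<in>S. \<phi> q = 0)"
    "\<And>p. b \<le> u p \<Longrightarrow> \<exists>S. open S \<and> p \<in> S \<and> (\<forall>q\<in>S. \<phi> q = 1)"
proof -
  obtain \<theta> :: "nat \<Rightarrow> real \<Rightarrow> real" and B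
  where \<theta>: "\<And>i t. (\<theta> i has_real_derivative \<theta> (Suc i) t) (at t)"
    "\<And>t. 0 \<le> \<theta> 0 t" "\<And>t. \<theta> 0 t \<le> 1" "\<And>t. t \<le> 0 \<Longrightarrow> \<theta> 0 t = 0" "\<And>t. 1 \<le> t \<Longrightarrow> \<theta> 0 t = 1"
    "\<And>t. \<bar>\<theta> (Suc 0) t\<bar> \<le> B"
    by (rule smooth_step) (rule that)
  obtain h where h: "\<And>i p. p \<in> W i \<Longrightarrow> differential_le h p (C0 * a * K)" "\<And>i p. p \<in> W i \<Longrightarrow> \<bar>h p - u p\<bar> < b / 8"
  proof (rule pieces_approx[where W = W and a = a and u = u and e = "\<lambda>_. b / 8"])
    show "\<And>i. open (W i)" by (rule W(1))
    show "\<And>i j p. p \<in> W i \<Longrightarrow> p \<in> W j \<Longrightarrow> i = j" by (rule W(2))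
    show "\<And>i. W i \<noteq> {} \<Longrightarrow> \<exists>c x r. good_ball c x r \<and> W i \<subseteq> chart_ball_in c x r" by (rule good)
    show "calm a u" "0 \<le> a" by (rule u)+
    show "0 < b / 8" using b by simp
  qed (rule that)
  \<comment> \<open>The affine map taking b/4 to 0 and b/2 to 1.\<close>
  define s where "s t = 4 / b * t - 1" for t
  define \<phi> where "\<phi> p = (if \<exists>i. p \<in> W i then \<theta> 0 (s (h p)) else 0)" for p
  define C where "C = B * (4 / b * (C0 * a * K))"
  have B: "0 \<le> B" using \<theta>(6)[of 0] by linarith
  have C: "0 \<le> C" using B b u(2) C0_ge_1 K_ge_1 by (simp add: C_def)
  have u_open: "open {q. u q < t}" "open {q. t < u q}" for t
    using open_vimage[OF open_lessThan calm_continuous[OF u(1)], of t]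
      open_vimage[OF open_greaterThan calm_continuous[OF u(1)], of t]
    by (simp_all add: vimage_def)
  have zero: "\<exists>S. open S \<and> p \<in> S \<and> (\<forall>q\<in>S. \<phi> q = 0)" if p: "\<And>i. p \<notin> W i" for p
  proof (intro exI[of _ "{q. u q < b / 8}"] conjI ballI u_open)
    show "p \<in> {q. u q < b / 8}" using pos[of p] p b by (cases "0 < u p") auto
    fix q assume q: "q \<in> {q. u q < b / 8}"
    show "\<phi> q = 0"
    proof (cases "\<exists>i. q \<in> W i")
      case True
      then obtain i where i: "q \<in> W i" ..
      have "h q < b / 4" using h(2)[OF i] q unfolding abs_less_iff mem_Collect_eq by linarith
      then have "s (h q) \<le> 0" using b by (simp add: s_def field_simps)
      then show ?thesis using True by (simp add: \<phi>_def \<theta>(4))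
    qed (simp add: \<phi>_def)
  qed
  have one: "\<exists>S. open S \<and> p \<in> S \<and> (\<forall>q\<in>S. \<phi> q = 1)" if p: "b \<le> u p" for p
  proof (intro exI[of _ "{q. 3 * b / 4 < u q}"] conjI ballI u_open)
    show "p \<in> {q. 3 * b / 4 < u q}" using p b by simp
    fix q assume q: "q \<in> {q. 3 * b / 4 < u q}"
    then have "0 < u q" using b by simp
    then obtain i where i: "q \<in> W i" using pos by blast
    have "5 * b / 8 < h q" using h(2)[OF i] q unfolding abs_less_iff mem_Collect_eq by linarith
    then have "1 \<le> s (h q)" using b by (simp add: s_def field_simps)
    then show "\<phi> q = 1" using i by (auto simp: \<phi>_def \<theta>(5))
  qed
  have differential_le: "differential_le \<phi> p C" for p
  proof (cases "\<exists>i. p \<in> W i")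
    case False
    then have "\<exists>S. open S \<and> p \<in> S \<and> (\<forall>q\<in>S. \<phi> q = 0)" by (intro zero) auto
    then obtain S where S: "open S" "p \<in> S" "\<forall>q\<in>S. \<phi> q = 0" by (elim exE conjE)
    show ?thesis by (rule differential_le_cong[OF differential_le_const[OF C, of 0] S(1,2)]) (use S(3) in auto)
  next
    case True
    then obtain i where i: "p \<in> W i" ..
    obtain \<delta> where \<delta>: "smooth_differential h p \<delta>" "\<forall>v\<in>T p. \<bar>\<delta> v\<bar> \<le> C0 * a * K * N (p, v)"
      using h(1)[OF i] unfolding differential_le_def by blast
    have "smooth_differential (\<lambda>q. s (h q)) p (\<lambda>v. 4 / b * \<delta> v)"
      using smooth_differential_add[OF smooth_differential_mult[OF smooth_differential_const \<delta>(1), of "4 / b"] smooth_differential_const, of "- 1"] by (simp add: s_def)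
    from smooth_differential_compose_real[where \<theta> = \<theta> and i = 0, OF \<theta>(1) this]
    have "smooth_differential (\<lambda>q. \<theta> 0 (s (h q))) p (\<lambda>v. \<theta> (Suc 0) (s (h p)) * (4 / b * \<delta> v))" .
    moreover have "\<bar>\<theta> (Suc 0) (s (h p)) * (4 / b * \<delta> v)\<bar> \<le> C * N (p, v)" if v: "v \<in> T p" for v
    proof -
      have "\<bar>\<theta> (Suc 0) (s (h p)) * (4 / b * \<delta> v)\<bar> = \<bar>\<theta> (Suc 0) (s (h p))\<bar> * (4 / b * \<bar>\<delta> v\<bar>)"
        using b by (simp add: abs_mult)
      also have "\<dots> \<le> B * (4 / b * (C0 * a * K * N (p, v)))"
        using \<theta>(6) \<delta>(2) v b B by (intro mult_mono mult_left_mono) auto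
      finally show ?thesis by (simp add: C_def mult.assoc)
    qed
    ultimately have "differential_le (\<lambda>q. \<theta> 0 (s (h q))) p C" unfolding differential_le_def by blast
    then show ?thesis
    proof (rule differential_le_cong[OF _ W(1)[of i] i])
      show "\<theta> 0 (s (h q)) = \<phi> q" if "q \<in> W i" for q using that by (auto simp: \<phi>_def)
    qed
  qed
  show thesis
  proof (rule that[of \<phi> C, OF _ _ C differential_le zero one])
    show "0 \<le> \<phi> p" "\<phi> p \<le> 1" for p by (simp_all add: \<phi>_def \<theta>(2,3))
  qed
qed

text \<open>The order of choices matters: the weights come first, with global differential bounds
  \<open>B n\<close>, and only then the approximations of \<open>f\<close>, whose accuracy depends
  on \<open>B n\<close>. L > 0 makes this accuracy positive.\<close>

lemma smooth_approximation:
  fixes f \<epsilon> :: "'m \<Rightarrow> real"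
  assumes f: "calm (L * K) f" and L: "0 < L" and \<epsilon>: "continuous_on UNIV \<epsilon>" "\<And>p. 0 < \<epsilon> p"
  obtains g where "\<And>p. \<bar>g p - f p\<bar> < \<epsilon> p" "\<And>p. differential_le g p (2 * C0 * K\<^sup>2 * L)"
proof -
  obtain u :: "nat \<Rightarrow> 'm \<Rightarrow> real" and W :: "nat \<Rightarrow> 'm set \<Rightarrow> 'm set" and e :: "'m set \<Rightarrow> real"
    where u: "\<And>n. calm (K\<^sup>2 + 1) (u n)" and W: "\<And>n V. open (W n V)"
      "\<And>n V V' p. p \<in> W n V \<Longrightarrow> p \<in> W n V' \<Longrightarrow> V = V'"
    and pos: "\<And>n p. 0 < u n p \<Longrightarrow> \<exists>V. p \<in> W n V"
    and good: "\<And>n V. W n V \<noteq> {} \<Longrightarrow> \<exists>c x r. good_ball c x r \<and> W n V \<subseteq> chart_ball_in c x r"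
    and e: "\<And>n V. W n V \<noteq> {} \<Longrightarrow> 0 < e V" "\<And>n V p. p \<in> W n V \<Longrightarrow> e V \<le> \<epsilon> p"
    and cover: "\<And>p. \<exists>n. 1 / real (Suc n) \<le> u n p"
    by (rule disjoint_cover[OF \<epsilon>]) (rule that)
  define D0 where "D0 = C0 * (L * K) * K"
  have D0: "0 < D0" using L C0_ge_1 K_ge_1 by (simp add: D0_def)
  define P where "P n \<phi> C \<longleftrightarrow> (\<forall>p. 0 \<le> \<phi> p) \<and> (\<forall>p. \<phi> p \<le> 1) \<and> 0 \<le> C \<and> (\<forall>p. differential_le \<phi> p C) \<and>
      (\<forall>p. (\<forall>V. p \<notin> W n V) \<longrightarrow> (\<exists>S. open S \<and> p \<in> S \<and> (\<forall>q\<in>S. \<phi> q = 0))) \<and>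
      (\<forall>p. 1 / real (Suc n) \<le> u n p \<longrightarrow> (\<exists>S. open S \<and> p \<in> S \<and> (\<forall>q\<in>S. \<phi> q = 1)))" for n \<phi> C
  have "\<exists>\<phi> C. P n \<phi> C" for n
  proof (rule smooth_cutoff[where W = "W n" and u = "u n" and a = "K\<^sup>2 + 1" and b = "1 / real (Suc n)"])
    show "\<And>V. open (W n V)" by (rule W(1))
    show "\<And>V V' p. p \<in> W n V \<Longrightarrow> p \<in> W n V' \<Longrightarrow> V = V'" by (rule W(2))
    show "\<And>V. W n V \<noteq> {} \<Longrightarrow> \<exists>c x r. good_ball c x r \<and> W n V \<subseteq> chart_ball_in c x r" by (rule good)
    show "calm (K\<^sup>2 + 1) (u n)" by (rule u)
    show "\<And>p. 0 < u n p \<Longrightarrow> \<exists>V. p \<in> W n V" by (rule pos)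
    fix \<phi> C
    assume "\<And>p. 0 \<le> \<phi> p" "\<And>p. \<phi> p \<le> 1" "0 \<le> C" "\<And>p. differential_le \<phi> p C"
      "\<And>p. (\<And>V. p \<notin> W n V) \<Longrightarrow> \<exists>S. open S \<and> p \<in> S \<and> (\<forall>q\<in>S. \<phi> q = 0)"
      "\<And>p. 1 / real (Suc n) \<le> u n p \<Longrightarrow> \<exists>S. open S \<and> p \<in> S \<and> (\<forall>q\<in>S. \<phi> q = 1)"
    then have "P n \<phi> C" unfolding P_def by (intro conjI allI impI) simp_all
    then show ?thesis by (intro exI)
  qed simp_all
  then obtain \<phi> C where PC: "\<And>n. P n (\<phi> n) (C n)" by metis
  have \<phi>01: "0 \<le> \<phi> n p" "\<phi> n p \<le> 1" and C: "0 \<le> C n" and \<phi>_differential_le: "differential_le (\<phi> n) p (C n)" for n p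
    using PC[of n] by (simp_all add: P_def)
  have \<phi>_zero: "\<exists>S. open S \<and> p \<in> S \<and> (\<forall>q\<in>S. \<phi> n q = 0)" if "\<forall>V. p \<notin> W n V" for n p
    using PC[of n] that by (simp add: P_def)
  have \<phi>_one: "\<exists>S. open S \<and> p \<in> S \<and> (\<forall>q\<in>S. \<phi> n q = 1)" if "1 / real (Suc n) \<le> u n p" for n p
    using PC[of n] that by (simp add: P_def)
  define B where "B n = (\<Sum>j\<le>n. C j)" for n
  have B: "0 \<le> B n" for n unfolding B_def using C by (intro sum_nonneg)
  \<comment> \<open>\<open>e V / 2\<close> leaves room for the strict estimate of g - f. The other
    term makes accuracy times \<open>B n\<close> at most D0 / 2^(n+1), which sums to at most
    \<open>D0\<close>; the summand 1 avoids division by 0.\<close>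
  define \<eta> where "\<eta> n V = min (e V / 2) (D0 / (2 ^ Suc n * (B n + 1)))" for n V
  have "\<exists>h. \<forall>V. \<forall>p\<in>W n V. differential_le h p D0 \<and> \<bar>h p - f p\<bar> < \<eta> n V" for n
  proof (rule pieces_approx[where W = "W n" and u = f and a = "L * K" and e = "\<eta> n"])
    show "\<And>V. open (W n V)" by (rule W(1))
    show "\<And>V V' p. p \<in> W n V \<Longrightarrow> p \<in> W n V' \<Longrightarrow> V = V'" by (rule W(2))
    show "\<And>V. W n V \<noteq> {} \<Longrightarrow> \<exists>c x r. good_ball c x r \<and> W n V \<subseteq> chart_ball_in c x r" by (rule good)
    show "calm (L * K) f" "0 \<le> L * K" using f L K_ge_1 by auto
    show "0 < \<eta> n V" if "W n V \<noteq> {}" for V using e(1)[OF that] D0 B[of n] by (simp add: \<eta>_def)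
    fix h assume h: "\<And>V p. p \<in> W n V \<Longrightarrow> differential_le h p (C0 * (L * K) * K)" "\<And>V p. p \<in> W n V \<Longrightarrow> \<bar>h p - f p\<bar> < \<eta> n V"
    show ?thesis by (rule exI[of _ h]) (use h in \<open>simp add: D0_def\<close>)
  qed
  then obtain h where h: "\<And>n. \<forall>V. \<forall>p\<in>W n V. differential_le (h n) p D0 \<and> \<bar>h n p - f p\<bar> < \<eta> n V" by metis
  have h_differential_le: "differential_le (h n) p D0" and h_near: "\<bar>h n p - f p\<bar> < e V / 2"
    "\<bar>h n p - f p\<bar> < D0 / (2 ^ Suc n * (B n + 1))" if "p \<in> W n V" for n p V
    using h[of n] that by (auto simp: \<eta>_def)
  \<comment> \<open>What the first \<open>n\<close> cutoffs leave over of the constant 1; the weight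
    \<psi> takes the share \<phi> of it.\<close>
  define R where "R n p = (\<Prod>j<n. 1 - \<phi> j p)" for n p
  define \<psi> where "\<psi> n p = \<phi> n p * R n p" for n p
  have R01: "0 \<le> R n p" "R n p \<le> 1" for n p
    unfolding R_def using \<phi>01 by (auto intro!: prod_nonneg prod_le_1)
  have R_differential_le: "differential_le (R n) p (\<Sum>j<n. C j)" for n p
  proof (induction n)
    case 0
    show ?case using differential_le_const[of 0 1] by (simp add: R_def)
  next
    case (Suc n)
    have "\<bar>R n p\<bar> \<le> 1" "\<bar>1 - \<phi> n p\<bar> \<le> 1" using R01 \<phi>01 by (auto simp: abs_le_iff)
    from differential_le_mult[OF Suc this(1) differential_le_one_minus[OF \<phi>_differential_le] this(2)]
    show ?case by (simp add: R_def)
  qed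
  have \<psi>_differential_le: "differential_le (\<psi> n) p (B n)" for n p
  proof -
    have "\<bar>R n p\<bar> \<le> 1" "\<bar>\<phi> n p\<bar> \<le> 1" using R01 \<phi>01 by (auto simp: abs_le_iff)
    from differential_le_mult[OF \<phi>_differential_le this(2) R_differential_le this(1)]
    have "differential_le (\<psi> n) p (C n + (\<Sum>j<n. C j))" by (simp add: \<psi>_def[abs_def])
    then show ?thesis by (simp add: B_def lessThan_Suc_atMost[symmetric] add.commute)
  qed
  have \<psi>_nonneg: "0 \<le> \<psi> n p" for n p using \<phi>01 R01 by (simp add: \<psi>_def)
  have telescope: "(\<Sum>n<j. \<psi> n p) = 1 - R j p" for j p
    by (induction j) (simp_all add: \<psi>_def R_def algebra_simps)
  have \<psi>_vanish: "\<psi> n p = 0" if "\<phi> j p = 1" "j < n" for n j p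
    using that by (auto simp: \<psi>_def R_def prod_zero_iff)
  have \<psi>_sum: "(\<Sum>n\<le>j. \<psi> n p) = 1" if "\<phi> j p = 1" for j p
  proof -
    have "R (Suc j) p = 0" using that by (simp add: R_def)
    then show ?thesis using telescope[where j = "Suc j"] by (simp add: lessThan_Suc_atMost del: sum.lessThan_Suc)
  qed
  \<comment> \<open>A layer whose cutoff is 1 around \<open>p\<close>, so that all later weights
    vanish there. The choice may jump from point to point.\<close>
  define M where "M p = (SOME n. 1 / real (Suc n) \<le> u n p)" for p
  have M: "1 / real (Suc (M p)) \<le> u (M p) p" for p
    unfolding M_def by (rule someI_ex[OF cover])
  have \<phi>_M: "\<phi> (M p) p = 1" for p using \<phi>_one[OF M] by blast
  define g where "g p = (\<Sum>n\<le>M p. \<psi> n p * h n p)" for p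
  \<comment> \<open>Every stage whose cutoff is 1 at \<open>q\<close> yields the same value, so near
    \<open>p\<close> one fixed finite sum represents \<open>g\<close> although \<open>M\<close>
    varies. The weights sum to 1, hence a constant \<open>a\<close> may be split off.\<close>
  have g_eq: "g q = a + (\<Sum>n\<le>j. \<psi> n q * (h n q - a))" if "\<phi> j q = 1" for q j a
  proof -
    have *: "(\<Sum>n\<le>i. \<psi> n q * h n q) = (\<Sum>n\<le>max (M q) j. \<psi> n q * h n q)" if "\<phi> i q = 1" "i \<le> max (M q) j" for i
      using \<psi>_vanish[OF that(1)] that(2) by (intro sum.mono_neutral_left) auto
    have "g q = (\<Sum>n\<le>j. \<psi> n q * h n q)"
      unfolding g_def using *[OF \<phi>_M] *[OF that] by simp
    also have "\<dots> = (\<Sum>n\<le>j. \<psi> n q) * a + (\<Sum>n\<le>j. \<psi> n q * (h n q - a))"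
      unfolding sum_distrib_right sum.distrib[symmetric] by (intro sum.cong) (simp_all add: algebra_simps)
    finally show ?thesis by (simp add: \<psi>_sum[OF that])
  qed
  have "\<bar>g p - f p\<bar> < \<epsilon> p" for p
  proof -
    have "\<bar>\<psi> n p * (h n p - f p)\<bar> \<le> \<psi> n p * (\<epsilon> p / 2)" for n
    proof (cases "\<exists>V. p \<in> W n V")
      case True
      then obtain V where V: "p \<in> W n V" ..
      have "\<bar>h n p - f p\<bar> \<le> \<epsilon> p / 2" using h_near(1)[OF V] e(2)[OF V] by linarith
      from mult_left_mono[OF this \<psi>_nonneg] show ?thesis by (simp only: abs_mult abs_of_nonneg[OF \<psi>_nonneg])
    next
      case False
      then have "\<phi> n p = 0" using \<phi>_zero[of p n] by blast
      then show ?thesis by (simp add: \<psi>_def)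
    qed
    then have "(\<Sum>n\<le>M p. \<bar>\<psi> n p * (h n p - f p)\<bar>) \<le> (\<Sum>n\<le>M p. \<psi> n p * (\<epsilon> p / 2))"
      by (intro sum_mono)
    also have "\<dots> = \<epsilon> p / 2" using \<psi>_sum[OF \<phi>_M] by (simp only: sum_distrib_right[symmetric] mult_1_left)
    finally have "\<bar>\<Sum>n\<le>M p. \<psi> n p * (h n p - f p)\<bar> \<le> \<epsilon> p / 2"
      by (rule order_trans[OF sum_abs])
    moreover have "g p - f p = (\<Sum>n\<le>M p. \<psi> n p * (h n p - f p))"
      using g_eq[OF \<phi>_M, of p "f p"] by simp
    ultimately have "\<bar>g p - f p\<bar> \<le> \<epsilon> p / 2" by (simp only:)
    then show ?thesis using \<epsilon>(2)[of p] by linarith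
  qed
  moreover have "differential_le g p (2 * C0 * K\<^sup>2 * L)" for p
  proof -
    \<comment> \<open>The number \<open>f p\<close> is subtracted, not the function
      \<open>f\<close>, which may fail to be differentiable. In the product rule at \<open>p\<close>
      the differential of \<psi> is then multiplied by the small number
      \<open>h n p - f p\<close>.\<close>
    define Q where "Q n \<delta> \<longleftrightarrow> smooth_differential (\<lambda>q. \<psi> n q * (h n q - f p)) p \<delta> \<and>
        (\<forall>v\<in>T p. \<bar>\<delta> v\<bar> \<le> (\<psi> n p * D0 + D0 / 2 ^ Suc n) * N (p, v))" for n \<delta>
    have "\<exists>\<delta>. Q n \<delta>" for n
    proof (cases "\<exists>V. p \<in> W n V")
      case True
      then obtain V where V: "p \<in> W n V" ..
      obtain \<delta> where \<delta>: "smooth_differential (h n) p \<delta>" "\<forall>v\<in>T p. \<bar>\<delta> v\<bar> \<le> D0 * N (p, v)"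
        using h_differential_le[OF V] unfolding differential_le_def by blast
      obtain \<kappa> where \<kappa>: "smooth_differential (\<psi> n) p \<kappa>" "\<forall>v\<in>T p. \<bar>\<kappa> v\<bar> \<le> B n * N (p, v)"
        using \<psi>_differential_le[of n p] unfolding differential_le_def by blast
      let ?\<delta> = "\<lambda>v. \<psi> n p * \<delta> v + \<kappa> v * (h n p - f p)"
      have "smooth_differential (\<lambda>q. h n q - f p) p \<delta>" using smooth_differential_add[OF \<delta>(1) smooth_differential_const, of "- f p"] by simp
      from smooth_differential_mult[OF \<kappa>(1) this] have "smooth_differential (\<lambda>q. \<psi> n q * (h n q - f p)) p ?\<delta>" .
      moreover have "\<bar>?\<delta> v\<bar> \<le> (\<psi> n p * D0 + D0 / 2 ^ Suc n) * N (p, v)" if v: "v \<in> T p" for v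
      proof -
        have N: "0 \<le> N (p, v)" by (rule N_nonneg[OF v])
        have "\<bar>\<psi> n p * \<delta> v\<bar> \<le> \<psi> n p * (D0 * N (p, v))"
          using \<delta>(2) v \<psi>_nonneg by (simp add: abs_mult mult_left_mono)
        moreover have "\<bar>\<kappa> v * (h n p - f p)\<bar> \<le> D0 / 2 ^ Suc n * N (p, v)"
        proof -
          have "\<bar>\<kappa> v * (h n p - f p)\<bar> \<le> (B n * N (p, v)) * (D0 / (2 ^ Suc n * (B n + 1)))"
            unfolding abs_mult using \<kappa>(2) v h_near(2)[OF V] B N by (intro mult_mono) auto
          also have "\<dots> = (B n / (B n + 1)) * (D0 / 2 ^ Suc n * N (p, v))" by (simp add: mult_ac)
          also have "\<dots> \<le> 1 * (D0 / 2 ^ Suc n * N (p, v))"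
            using B[of n] D0 N by (intro mult_right_mono) auto
          finally show ?thesis by simp
        qed
        ultimately show ?thesis
          using abs_triangle_ineq[of "\<psi> n p * \<delta> v" "\<kappa> v * (h n p - f p)"] by (simp add: distrib_right mult.assoc)
      qed
      ultimately have "Q n ?\<delta>" unfolding Q_def by blast
      then show ?thesis by (rule exI[of "Q n"])
    next
      \<comment> \<open>\<open>p\<close> lies in no piece of layer \<open>n\<close>, so
        \<open>h n\<close> is arbitrary near \<open>p\<close>, but the cutoff vanishes around
        \<open>p\<close>.\<close>
      case False
      then have "\<exists>S. open S \<and> p \<in> S \<and> (\<forall>q\<in>S. \<phi> n q = 0)" by (intro \<phi>_zero) simp
      then obtain S where S: "open S" "p \<in> S" "\<And>q. q \<in> S \<Longrightarrow> \<phi> n q = 0" by blast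
      have "smooth_differential (\<lambda>q. \<psi> n q * (h n q - f p)) p (\<lambda>_. 0)"
        by (rule smooth_differential_cong[OF smooth_differential_const[of 0] S(1,2)]) (simp add: \<psi>_def S(3))
      then have "Q n (\<lambda>_. 0)"
        unfolding Q_def using \<psi>_nonneg D0 N_nonneg by simp
      then show ?thesis by (rule exI[of "Q n"])
    qed
    then obtain \<delta> where Q: "\<And>n. Q n (\<delta> n)" by metis
    have \<delta>: "smooth_differential (\<lambda>q. \<psi> n q * (h n q - f p)) p (\<delta> n)"
      "\<And>v. v \<in> T p \<Longrightarrow> \<bar>\<delta> n v\<bar> \<le> (\<psi> n p * D0 + D0 / 2 ^ Suc n) * N (p, v)" for n
      using Q[of n] by (auto simp: Q_def)
    from \<phi>_one[OF M[of p]] obtain S where S: "open S" "p \<in> S" and "\<forall>q\<in>S. \<phi> (M p) q = 1"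
      by (elim exE conjE)
    then have S1: "\<phi> (M p) q = 1" if "q \<in> S" for q using that by simp
    have "smooth_differential (\<lambda>q. f p + (\<Sum>n\<le>M p. \<psi> n q * (h n q - f p))) p (\<lambda>v. 0 + (\<Sum>n\<le>M p. \<delta> n v))"
      by (intro smooth_differential_add smooth_differential_const smooth_differential_sum \<delta>(1)) simp
    then have "smooth_differential g p (\<lambda>v. 0 + (\<Sum>n\<le>M p. \<delta> n v))"
      by (rule smooth_differential_cong[OF _ S(1,2)]) (simp add: g_eq[OF S1, of _ "f p"])
    moreover have "\<bar>0 + (\<Sum>n\<le>M p. \<delta> n v)\<bar> \<le> 2 * C0 * K\<^sup>2 * L * N (p, v)" if v: "v \<in> T p" for v
    proof -
      have "\<bar>0 + (\<Sum>n\<le>M p. \<delta> n v)\<bar> \<le> (\<Sum>n\<le>M p. \<bar>\<delta> n v\<bar>)" using sum_abs by simp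
      also have "\<dots> \<le> (\<Sum>n\<le>M p. (\<psi> n p * D0 + D0 / 2 ^ Suc n) * N (p, v))"
        by (intro sum_mono \<delta>(2) v)
      also have "\<dots> = ((\<Sum>n\<le>M p. \<psi> n p) * D0 + (\<Sum>n\<le>M p. D0 / 2 ^ Suc n)) * N (p, v)"
        by (simp only: sum_distrib_right[symmetric] sum.distrib)
      also have "\<dots> \<le> (1 * D0 + D0) * N (p, v)"
      proof (rule mult_right_mono[OF _ N_nonneg[OF v]])
        have "(\<Sum>n\<le>j. D0 / 2 ^ Suc n) = D0 - D0 / 2 ^ Suc j" for j
          by (induction j) (simp_all add: field_simps)
        moreover have "0 \<le> D0 / 2 ^ Suc (M p)" using D0 by simp
        ultimately show "(\<Sum>n\<le>M p. \<psi> n p) * D0 + (\<Sum>n\<le>M p. D0 / 2 ^ Suc n) \<le> 1 * D0 + D0"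
          by (simp only: \<psi>_sum[OF \<phi>_M])
      qed
      also have "\<dots> = 2 * C0 * K\<^sup>2 * L * N (p, v)" by (simp add: D0_def power2_eq_square)
      finally show ?thesis .
    qed
    ultimately show ?thesis unfolding differential_le_def by (intro exI[of _ "\<lambda>v. 0 + (\<Sum>n\<le>M p. \<delta> n v)"]) simp
  qed
  ultimately show thesis by (rule that)
qed

end

theorem theorem3p7:
  fixes \<A> :: "('m::t2_space, 'x::banach) chart set"
    and N :: "'m \<times> ('m, 'x) tangent \<Rightarrow> real"
    and l k :: enat
    and K C0 :: real
    and f \<epsilon> :: "'m \<Rightarrow> real"
  assumes "1 \<le> l" and "1 \<le> k" and "1 \<le> K"
    and "uniform_finsler_manifold l K \<A> N"
    and "property_star TYPE('x) k C0"
    and "finsler_lipschitz \<A> N f"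
    and "continuous_on UNIV \<epsilon>" and "\<forall>p. 0 < \<epsilon> p"
  shows "\<exists>g. finsler_lipschitz \<A> N g \<and> C_smooth_map (min l k) \<A> g \<and>
           (\<forall>p. \<bar>g p - f p\<bar> < \<epsilon> p \<and>
                differential_norm \<A> N g p \<le> ereal (2 * C0 * K\<^sup>2 * finsler_Lip \<A> N f)) \<and>
           finsler_Lip \<A> N g \<le> 2 * C0 * K\<^sup>2 * finsler_Lip \<A> N f"
proof -
  interpret uniform_finsler_star l "min l k" K \<A> N k C0
    using assms by unfold_locales auto
  define L where "L = finsler_Lip \<A> N f"
  have lip: "finsler_lipschitz_const \<A> N L f"
    unfolding L_def by (rule finsler_lipschitz_const_Lip[OF assms(6)])
  then have L: "0 \<le> L" by (simp add: finsler_lipschitz_const_def)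
  have calm: "calm (L * K) f" by (rule finsler_lipschitz_const_calm[OF lip])
  have "\<exists>g. (\<forall>p. \<bar>g p - f p\<bar> < \<epsilon> p) \<and> (\<forall>p. differential_le g p (2 * C0 * K\<^sup>2 * L))"
  \<comment> \<open>For L = 0 the error budget would be 0. But a calm function with constant 0 is
    locally constant, so \<open>f\<close> itself serves as \<open>g\<close>.\<close>
  proof (cases "L = 0")
    case True
    have "differential_le f p 0" for p
    proof -
      obtain c where c: "c \<in> uniform_charts" "p \<in> fst c" using uniform_chart_cover by blast
      then have "\<forall>\<^sub>F q in nhds p. f q = f p" using calm True by (simp add: calm_def)
      then obtain S where S: "open S" "p \<in> S" "\<forall>q\<in>S. f q = f p" unfolding eventually_nhds by blast
      show ?thesis by (rule differential_le_cong[OF differential_le_const[OF order_refl, of "f p"] S(1,2)]) (simp add: S(3))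
    qed
    then show ?thesis using True assms(8) by (intro exI[of _ f]) simp
  next
    case False
    then have "0 < L" using L by simp
    from smooth_approximation[OF calm this assms(7)] assms(8) show ?thesis by metis
  qed
  then obtain g where g: "\<And>p. \<bar>g p - f p\<bar> < \<epsilon> p" "\<And>p. differential_le g p (2 * C0 * K\<^sup>2 * L)" by blast
  have C: "0 \<le> 2 * C0 * K\<^sup>2 * L" using C0_ge_1 L by simp
  have "smooth_at p g" for p using g(2)[of p] by (auto simp: differential_le_def smooth_differential_def)
  then have "C_smooth_map (min l k) \<A> g" by (rule C_smooth_mapI)
  with g(1) finsler_LipI[OF g(2) C] differential_le_differential_norm[OF g(2) C] show ?thesis
    unfolding L_def by blast
qed

end
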